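(* Let $(N,\mathcal I,\mathcal J,\mathcal K)$ be a hypercomplex nilmanifold with $\dim_{\mathbb C}N=2n$, and let $\eta$ be a holomorphic, left-invariant section of the canonical bundle $\Lambda^{2n,0}(N,\mathcal I)$. Then $\nabla\eta=0$, where $\nabla$ is the Obata connection.
   Context: A hypercomplex manifold is a manifold $M$ with three integrable complex structures $\mathcal I,\mathcal J,\mathcal K$ satisfying $\mathcal I\mathcal J=-\mathcal J\mathcal I=\mathcal K$. It carries a unique torsion-free connection $\nabla$ on $TM$ with $\nabla\mathcal I=\nabla\mathcal J=\nabla\mathcal K=0$, called the Obata connection; $\nabla$ also denotes the induced connection on tensor bundles. A nilmanifold is a quotient $N=\Gamma\backslash G$ of a connected, simply connected nilpotent Lie group $G$ by a co-compact discrete subgroup $\Gamma$. A hypercomplex structure on $G$ is left-invariant if left translations are holomorphic with respect to $\mathcal I,\mathcal J,\mathcal K$. A hypercomplex nilmanifold is a nilmanifold $N=\Gamma\backslash G$ with the hypercomplex structure induced by a left-invariant hypercomplex structure on $G$. A section of a tensor bundle on $N$ is called left-invariant if it is induced by (its pull-back to $G$ is) a left-invariant tensor on $G$. Here $\dim_{\mathbb C}N$ is the complex dimension of $(N,\mathcal I)$, so $\dim_{\mathbb R}N=4n$. *)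

theory Defs
  imports "HOL-Analysis.Analysis" "HOL-Algebra.Coset" "HOL-Algebra.Generated_Groups"
begin

(* For open S, smooth_on S f says that f is C^k on S for every k. *)
primrec Ck_on :: "nat \<Rightarrow> 'e::euclidean_space set \<Rightarrow> ('e \<Rightarrow> 'b::real_normed_vector) \<Rightarrow> bool" where
  "Ck_on 0 S f = continuous_on S f"
| "Ck_on (Suc k) S f = ((\<forall>x\<in>S. f differentiable (at x)) \<and>
     (\<forall>v. Ck_on k S (\<lambda>x. frechet_derivative f (at x) v)))"

definition smooth_on :: "'e::euclidean_space set \<Rightarrow> ('e \<Rightarrow> 'b::real_normed_vector) \<Rightarrow> bool" where
  "smooth_on S f \<longleftrightarrow> (\<forall>k. Ck_on k S f)"

(* The atlas need not be maximal; only the values of a chart (U, phi) on U matter. *)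
record ('a, 'e) manifold =
  mtop :: "'a topology"
  atlas :: "('a set \<times> ('a \<Rightarrow> 'e)) set"

definition is_chart :: "'a topology \<Rightarrow> 'a set \<Rightarrow> ('a \<Rightarrow> 'e::euclidean_space) \<Rightarrow> bool" where
  "is_chart X U \<phi> \<longleftrightarrow> openin X U \<and> open (\<phi> ` U) \<and>
     homeomorphic_map (subtopology X U) (top_of_set (\<phi> ` U)) \<phi>"

definition smooth_manifold :: "('a, 'e::euclidean_space) manifold \<Rightarrow> bool" where
  "smooth_manifold M \<longleftrightarrow>
     Hausdorff_space (mtop M) \<and> second_countable (mtop M) \<and>
     (\<forall>(U, \<phi>) \<in> atlas M. is_chart (mtop M) U \<phi>) \<and>
     \<Union> (fst ` atlas M) = topspace (mtop M) \<and>
     (\<forall>(U, \<phi>) \<in> atlas M. \<forall>(V, \<psi>) \<in> atlas M. smooth_on (\<phi> ` (U \<inter> V)) (\<psi> \<circ> inv_into U \<phi>))"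

definition smooth_map ::
  "('a, 'e::euclidean_space) manifold \<Rightarrow> ('b, 'f::euclidean_space) manifold \<Rightarrow> ('a \<Rightarrow> 'b) \<Rightarrow> bool" where
  "smooth_map M N F \<longleftrightarrow> continuous_map (mtop M) (mtop N) F \<and>
     (\<forall>(U, \<phi>) \<in> atlas M. \<forall>(V, \<psi>) \<in> atlas N.
        smooth_on (\<phi> ` (U \<inter> F -` V)) (\<psi> \<circ> F \<circ> inv_into U \<phi>))"

definition prod_manifold ::
  "('a, 'e) manifold \<Rightarrow> ('b, 'f) manifold \<Rightarrow> ('a \<times> 'b, 'e \<times> 'f) manifold" where
  "prod_manifold M N = \<lparr>mtop = prod_topology (mtop M) (mtop N),
     atlas = {(U \<times> V, map_prod \<phi> \<psi>) | U \<phi> V \<psi>. (U, \<phi>) \<in> atlas M \<and> (V, \<psi>) \<in> atlas N}\<rparr>"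

definition open_submanifold :: "('a, 'e) manifold \<Rightarrow> 'a set \<Rightarrow> ('a, 'e) manifold" where
  "open_submanifold M W = \<lparr>mtop = subtopology (mtop M) W,
     atlas = {(U \<inter> W, \<phi>) | U \<phi>. (U, \<phi>) \<in> atlas M}\<rparr>"

definition diffeomorphism ::
  "('a, 'e::euclidean_space) manifold \<Rightarrow> ('b, 'f::euclidean_space) manifold \<Rightarrow> ('a \<Rightarrow> 'b) \<Rightarrow> bool" where
  "diffeomorphism M N F \<longleftrightarrow> smooth_map M N F \<and>
     (\<exists>H. smooth_map N M H \<and> (\<forall>x\<in>topspace (mtop M). H (F x) = x) \<and>
          (\<forall>y\<in>topspace (mtop N). F (H y) = y))"

definition local_diffeomorphism ::
  "('a, 'e::euclidean_space) manifold \<Rightarrow> ('b, 'f::euclidean_space) manifold \<Rightarrow> ('a \<Rightarrow> 'b) \<Rightarrow> bool" where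
  "local_diffeomorphism M N F \<longleftrightarrow>
     (\<forall>p\<in>topspace (mtop M). \<exists>U V. openin (mtop M) U \<and> p \<in> U \<and> openin (mtop N) V \<and>
        diffeomorphism (open_submanifold M U) (open_submanifold N V) F)"

(* Functions on M are total functions on the ambient type, normalised to be 0 off M,
   so that equality of functions on M is HOL equality. *)
definition smooth_functions ::
  "('a, 'e::euclidean_space) manifold \<Rightarrow> ('a \<Rightarrow> 'b::real_normed_vector) set" where
  "smooth_functions M = {f. (\<forall>x. x \<notin> topspace (mtop M) \<longrightarrow> f x = 0) \<and>
     (\<forall>(U, \<phi>) \<in> atlas M. smooth_on (\<phi> ` U) (f \<circ> inv_into U \<phi>))}"

definition pullback_fun ::
  "('a, 'e) manifold \<Rightarrow> ('a \<Rightarrow> 'b) \<Rightarrow> ('b \<Rightarrow> 'c) \<Rightarrow> 'a \<Rightarrow> 'c::zero" where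
  "pullback_fun M F f = (\<lambda>x. if x \<in> topspace (mtop M) then f (F x) else 0)"

(* Smooth vector fields are the derivations of the algebra of smooth real functions. *)
type_synonym 'a vfield = "('a \<Rightarrow> real) \<Rightarrow> ('a \<Rightarrow> real)"

definition vector_fields :: "('a, 'e::euclidean_space) manifold \<Rightarrow> 'a vfield set" where
  "vector_fields M = {X.
     (\<forall>f\<in>smooth_functions M. X f \<in> smooth_functions M) \<and>
     (\<forall>f\<in>smooth_functions M. \<forall>g\<in>smooth_functions M. X (\<lambda>x. f x + g x) = (\<lambda>x. X f x + X g x)) \<and>
     (\<forall>c. \<forall>f\<in>smooth_functions M. X (\<lambda>x. c * f x) = (\<lambda>x. c * X f x)) \<and>
     (\<forall>f\<in>smooth_functions M. \<forall>g\<in>smooth_functions M.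
        X (\<lambda>x. f x * g x) = (\<lambda>x. X f x * g x + f x * X g x)) \<and>
     (\<forall>f. f \<notin> smooth_functions M \<longrightarrow> X f = (\<lambda>x. 0))}"

definition vf_add :: "'a vfield \<Rightarrow> 'a vfield \<Rightarrow> 'a vfield" where
  "vf_add X Y = (\<lambda>f x. X f x + Y f x)"

definition vf_scale :: "('a \<Rightarrow> real) \<Rightarrow> 'a vfield \<Rightarrow> 'a vfield" where
  "vf_scale h X = (\<lambda>f x. h x * X f x)"

definition lie_bracket :: "'a vfield \<Rightarrow> 'a vfield \<Rightarrow> 'a vfield" where
  "lie_bracket X Y = (\<lambda>f x. X (Y f) x - Y (X f) x)"

definition vf_complex :: "'a vfield \<Rightarrow> ('a \<Rightarrow> complex) \<Rightarrow> ('a \<Rightarrow> complex)" where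
  "vf_complex X h = (\<lambda>x. Complex (X (\<lambda>y. Re (h y)) x) (X (\<lambda>y. Im (h y)) x))"

(* Tensor fields are the maps on vector fields that are multilinear over the smooth functions. *)
definition endo_field :: "('a, 'e::euclidean_space) manifold \<Rightarrow> ('a vfield \<Rightarrow> 'a vfield) \<Rightarrow> bool" where
  "endo_field M A \<longleftrightarrow>
     (\<forall>X\<in>vector_fields M. A X \<in> vector_fields M) \<and>
     (\<forall>X\<in>vector_fields M. \<forall>Y\<in>vector_fields M. A (vf_add X Y) = vf_add (A X) (A Y)) \<and>
     (\<forall>h\<in>smooth_functions M. \<forall>X\<in>vector_fields M. A (vf_scale h X) = vf_scale h (A X))"

definition vf_tuples :: "('a, 'e::euclidean_space) manifold \<Rightarrow> nat \<Rightarrow> 'a vfield list set" where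
  "vf_tuples M k = {Xs. length Xs = k \<and> set Xs \<subseteq> vector_fields M}"

type_synonym 'a cform = "'a vfield list \<Rightarrow> 'a \<Rightarrow> complex"

(* Complex-valued k-forms, i.e. sections of the complexified k-th exterior power of T*M. *)
definition complex_form :: "('a, 'e::euclidean_space) manifold \<Rightarrow> nat \<Rightarrow> 'a cform \<Rightarrow> bool" where
  "complex_form M k \<omega> \<longleftrightarrow>
     (\<forall>Xs\<in>vf_tuples M k. \<omega> Xs \<in> smooth_functions M) \<and>
     (\<forall>Xs\<in>vf_tuples M k. \<forall>i<k. \<forall>X\<in>vector_fields M. \<forall>Y\<in>vector_fields M.
        \<omega> (Xs[i := vf_add X Y]) = (\<lambda>x. \<omega> (Xs[i := X]) x + \<omega> (Xs[i := Y]) x)) \<and>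
     (\<forall>Xs\<in>vf_tuples M k. \<forall>i<k. \<forall>X\<in>vector_fields M. \<forall>h\<in>smooth_functions M.
        \<omega> (Xs[i := vf_scale h X]) = (\<lambda>x. complex_of_real (h x) * \<omega> (Xs[i := X]) x)) \<and>
     (\<forall>Xs\<in>vf_tuples M k. \<forall>i j. i < j \<and> j < k \<and> Xs ! i = Xs ! j \<longrightarrow> \<omega> Xs = (\<lambda>x. 0))"

definition omit :: "nat \<Rightarrow> 'b list \<Rightarrow> 'b list" where
  "omit i xs = take i xs @ drop (Suc i) xs"

definition ext_deriv :: "'a cform \<Rightarrow> 'a cform" where
  "ext_deriv \<omega> Xs x =
     (\<Sum>i<length Xs. (-1) ^ i * vf_complex (Xs ! i) (\<omega> (omit i Xs)) x) +
     (\<Sum>j<length Xs. \<Sum>i<j. (-1) ^ (i + j) *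
        \<omega> (lie_bracket (Xs ! i) (Xs ! j) # omit i (omit j Xs)) x)"

(* Behaviour of tensors under a smooth map F. For local diffeomorphisms every field on N has a
   unique F-related lift, and the lifts span each tangent space of M, so the relations below
   express dF o A = B o dF and omega = F^* beta. *)
definition vf_related :: "('a, 'e::euclidean_space) manifold \<Rightarrow> ('b, 'f::euclidean_space) manifold \<Rightarrow>
    ('a \<Rightarrow> 'b) \<Rightarrow> 'a vfield \<Rightarrow> 'b vfield \<Rightarrow> bool" where
  "vf_related M N F X Y \<longleftrightarrow> X \<in> vector_fields M \<and> Y \<in> vector_fields N \<and>
     (\<forall>f\<in>smooth_functions N. X (pullback_fun M F f) = pullback_fun M F (Y f))"

definition endo_related :: "('a, 'e::euclidean_space) manifold \<Rightarrow> ('b, 'f::euclidean_space) manifold \<Rightarrow>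
    ('a \<Rightarrow> 'b) \<Rightarrow> ('a vfield \<Rightarrow> 'a vfield) \<Rightarrow> ('b vfield \<Rightarrow> 'b vfield) \<Rightarrow> bool" where
  "endo_related M N F A B \<longleftrightarrow>
     (\<forall>X Y. vf_related M N F X Y \<longrightarrow> vf_related M N F (A X) (B Y))"

definition form_related :: "('a, 'e::euclidean_space) manifold \<Rightarrow> ('b, 'f::euclidean_space) manifold \<Rightarrow>
    ('a \<Rightarrow> 'b) \<Rightarrow> nat \<Rightarrow> 'a cform \<Rightarrow> 'b cform \<Rightarrow> bool" where
  "form_related M N F k \<omega> \<beta> \<longleftrightarrow>
     (\<forall>Xs Ys. length Xs = k \<and> list_all2 (vf_related M N F) Xs Ys \<longrightarrow>
        \<omega> Xs = pullback_fun M F (\<beta> Ys))"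

(* Integrability is the vanishing of the Nijenhuis tensor
   N(X,Y) = [AX,AY] - A[AX,Y] - A[X,AY] - [X,Y]. *)
definition complex_structure ::
  "('a, 'e::euclidean_space) manifold \<Rightarrow> ('a vfield \<Rightarrow> 'a vfield) \<Rightarrow> bool" where
  "complex_structure M A \<longleftrightarrow> endo_field M A \<and>
     (\<forall>X\<in>vector_fields M. A (A X) = vf_scale (\<lambda>_. - 1) X) \<and>
     (\<forall>X\<in>vector_fields M. \<forall>Y\<in>vector_fields M.
        lie_bracket (A X) (A Y) =
          vf_add (vf_add (A (lie_bracket (A X) Y)) (A (lie_bracket X (A Y)))) (lie_bracket X Y))"

definition hypercomplex :: "('a, 'e::euclidean_space) manifold \<Rightarrow>
    ('a vfield \<Rightarrow> 'a vfield) \<Rightarrow> ('a vfield \<Rightarrow> 'a vfield) \<Rightarrow> ('a vfield \<Rightarrow> 'a vfield) \<Rightarrow> bool" where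
  "hypercomplex M I J K \<longleftrightarrow>
     smooth_manifold M \<and>
     complex_structure M I \<and> complex_structure M J \<and> complex_structure M K \<and>
     (\<forall>X\<in>vector_fields M. I (J X) = K X \<and> vf_scale (\<lambda>_. - 1) (J (I X)) = K X)"

(* Value of the complex-multilinear extension of omega at the complexified fields
   Xs!0 + i Ys!0, Xs!1 + i Ys!1, ...; the set T collects the slots contributing i Ys!j. *)
definition form_cext :: "'a cform \<Rightarrow> 'a vfield list \<Rightarrow> 'a vfield list \<Rightarrow> 'a \<Rightarrow> complex" where
  "form_cext \<omega> Xs Ys x =
     (\<Sum>T\<in>Pow {..<length Xs}. \<i> ^ card T *
        \<omega> (map (\<lambda>j. if j \<in> T then Ys ! j else Xs ! j) [0..<length Xs]) x)"

(* The (p, k-p)-part of a k-form: omega is evaluated on the (1,0)-parts (X - i IX)/2 of p of the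
   arguments and on the (0,1)-parts (X + i IX)/2 of the others, summed over all choices S of p
   slots. In particular (1,0)-forms satisfy alpha(IX) = i alpha(X). *)
definition bidegree_part :: "('a vfield \<Rightarrow> 'a vfield) \<Rightarrow> nat \<Rightarrow> 'a cform \<Rightarrow> 'a cform" where
  "bidegree_part I p \<omega> Xs x =
     (\<Sum>S | S \<subseteq> {..<length Xs} \<and> card S = p.
        form_cext \<omega>
          (map (vf_scale (\<lambda>_. 1/2)) Xs)
          (map (\<lambda>j. vf_scale (\<lambda>_. if j \<in> S then - (1/2) else 1/2) (I (Xs ! j))) [0..<length Xs]) x)"

definition form_of_type :: "('a, 'e::euclidean_space) manifold \<Rightarrow> ('a vfield \<Rightarrow> 'a vfield) \<Rightarrow>
    nat \<Rightarrow> nat \<Rightarrow> 'a cform \<Rightarrow> bool" where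
  "form_of_type M I p q \<omega> \<longleftrightarrow> complex_form M (p + q) \<omega> \<and>
     (\<forall>Xs\<in>vf_tuples M (p + q). bidegree_part I p \<omega> Xs = \<omega> Xs)"

(* On forms of type (p,q): the (p,q+1)-part of d omega. *)
definition dolbeault :: "('a vfield \<Rightarrow> 'a vfield) \<Rightarrow> nat \<Rightarrow> 'a cform \<Rightarrow> 'a cform" where
  "dolbeault I p \<omega> = bidegree_part I p (ext_deriv \<omega>)"

definition holomorphic_form :: "('a, 'e::euclidean_space) manifold \<Rightarrow> ('a vfield \<Rightarrow> 'a vfield) \<Rightarrow>
    nat \<Rightarrow> 'a cform \<Rightarrow> bool" where
  "holomorphic_form M I p \<omega> \<longleftrightarrow> form_of_type M I p 0 \<omega> \<and>
     (\<forall>Xs\<in>vf_tuples M (p + 1). dolbeault I p \<omega> Xs = (\<lambda>x. 0))"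

definition affine_connection ::
  "('a, 'e::euclidean_space) manifold \<Rightarrow> ('a vfield \<Rightarrow> 'a vfield \<Rightarrow> 'a vfield) \<Rightarrow> bool" where
  "affine_connection M D \<longleftrightarrow>
     (\<forall>X\<in>vector_fields M. \<forall>Y\<in>vector_fields M. D X Y \<in> vector_fields M) \<and>
     (\<forall>X\<in>vector_fields M. \<forall>X'\<in>vector_fields M. \<forall>Y\<in>vector_fields M.
        D (vf_add X X') Y = vf_add (D X Y) (D X' Y)) \<and>
     (\<forall>h\<in>smooth_functions M. \<forall>X\<in>vector_fields M. \<forall>Y\<in>vector_fields M.
        D (vf_scale h X) Y = vf_scale h (D X Y)) \<and>
     (\<forall>X\<in>vector_fields M. \<forall>Y\<in>vector_fields M. \<forall>Y'\<in>vector_fields M.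
        D X (vf_add Y Y') = vf_add (D X Y) (D X Y')) \<and>
     (\<forall>h\<in>smooth_functions M. \<forall>X\<in>vector_fields M. \<forall>Y\<in>vector_fields M.
        D X (vf_scale h Y) = vf_add (vf_scale (X h) Y) (vf_scale h (D X Y)))"

definition torsion_free ::
  "('a, 'e::euclidean_space) manifold \<Rightarrow> ('a vfield \<Rightarrow> 'a vfield \<Rightarrow> 'a vfield) \<Rightarrow> bool" where
  "torsion_free M D \<longleftrightarrow> (\<forall>X\<in>vector_fields M. \<forall>Y\<in>vector_fields M.
     vf_add (D X Y) (vf_scale (\<lambda>_. - 1) (D Y X)) = lie_bracket X Y)"

definition parallel_endo :: "('a, 'e::euclidean_space) manifold \<Rightarrow>
    ('a vfield \<Rightarrow> 'a vfield \<Rightarrow> 'a vfield) \<Rightarrow> ('a vfield \<Rightarrow> 'a vfield) \<Rightarrow> bool" where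
  "parallel_endo M D A \<longleftrightarrow> (\<forall>X\<in>vector_fields M. \<forall>Y\<in>vector_fields M. D X (A Y) = A (D X Y))"

(* These properties determine D uniquely on vector fields. *)
definition obata_connection :: "('a, 'e::euclidean_space) manifold \<Rightarrow>
    ('a vfield \<Rightarrow> 'a vfield) \<Rightarrow> ('a vfield \<Rightarrow> 'a vfield) \<Rightarrow> ('a vfield \<Rightarrow> 'a vfield) \<Rightarrow>
    ('a vfield \<Rightarrow> 'a vfield \<Rightarrow> 'a vfield) \<Rightarrow> bool" where
  "obata_connection M I J K D \<longleftrightarrow> affine_connection M D \<and> torsion_free M D \<and>
     parallel_endo M D I \<and> parallel_endo M D J \<and> parallel_endo M D K"

definition form_cov_deriv ::
  "('a vfield \<Rightarrow> 'a vfield \<Rightarrow> 'a vfield) \<Rightarrow> 'a vfield \<Rightarrow> 'a cform \<Rightarrow> 'a cform" where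
  "form_cov_deriv D X \<omega> Ys x =
     vf_complex X (\<omega> Ys) x - (\<Sum>i<length Ys. \<omega> (Ys[i := D X (Ys ! i)]) x)"

definition parallel_form :: "('a, 'e::euclidean_space) manifold \<Rightarrow>
    ('a vfield \<Rightarrow> 'a vfield \<Rightarrow> 'a vfield) \<Rightarrow> nat \<Rightarrow> 'a cform \<Rightarrow> bool" where
  "parallel_form M D k \<omega> \<longleftrightarrow>
     (\<forall>X\<in>vector_fields M. \<forall>Ys\<in>vf_tuples M k. form_cov_deriv D X \<omega> Ys = (\<lambda>x. 0))"

definition lie_group :: "'g monoid \<Rightarrow> ('g, 'e::euclidean_space) manifold \<Rightarrow> bool" where
  "lie_group G M \<longleftrightarrow> group G \<and> smooth_manifold M \<and> topspace (mtop M) = carrier G \<and>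
     smooth_map (prod_manifold M M) M (\<lambda>(x, y). x \<otimes>\<^bsub>G\<^esub> y) \<and>
     smooth_map M M (\<lambda>x. inv\<^bsub>G\<^esub> x)"

primrec lower_central_series :: "'g monoid \<Rightarrow> nat \<Rightarrow> 'g set" where
  "lower_central_series G 0 = carrier G"
| "lower_central_series G (Suc n) = generate G
     {x \<otimes>\<^bsub>G\<^esub> y \<otimes>\<^bsub>G\<^esub> inv\<^bsub>G\<^esub> x \<otimes>\<^bsub>G\<^esub> inv\<^bsub>G\<^esub> y | x y. x \<in> carrier G \<and> y \<in> lower_central_series G n}"

definition nilpotent_group :: "'g monoid \<Rightarrow> bool" where
  "nilpotent_group G \<longleftrightarrow> group G \<and> (\<exists>n. lower_central_series G n = {\<one>\<^bsub>G\<^esub>})"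

(* As for the constant simply_connected on sets, but for abstract topologies:
   any two loops are freely homotopic. *)
definition simply_connected_space :: "'a topology \<Rightarrow> bool" where
  "simply_connected_space X \<longleftrightarrow>
     (\<forall>p q. pathin X p \<and> p 1 = p 0 \<and> pathin X q \<and> q 1 = q 0 \<longrightarrow>
        homotopic_with (\<lambda>r. r 1 = r 0) (top_of_set {0..1}) X p q)"

definition coset_proj :: "'g monoid \<Rightarrow> 'g set \<Rightarrow> 'g \<Rightarrow> 'g set" where
  "coset_proj G \<Gamma> g = \<Gamma> #>\<^bsub>G\<^esub> g"

(* N is the set of cosets Gamma g with the (unique) manifold structure for which the
   projection from G is a local diffeomorphism. *)
definition nilmanifold :: "'g monoid \<Rightarrow> ('g, 'e::euclidean_space) manifold \<Rightarrow> 'g set \<Rightarrow>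
    ('g set, 'e) manifold \<Rightarrow> bool" where
  "nilmanifold G M \<Gamma> N \<longleftrightarrow>
     lie_group G M \<and> connected_space (mtop M) \<and> simply_connected_space (mtop M) \<and>
     nilpotent_group G \<and>
     subgroup \<Gamma> G \<and> subtopology (mtop M) \<Gamma> = discrete_topology \<Gamma> \<and>
     smooth_manifold N \<and> topspace (mtop N) = rcosets\<^bsub>G\<^esub> \<Gamma> \<and>
     local_diffeomorphism M N (coset_proj G \<Gamma>) \<and>
     compact_space (mtop N)"

definition left_invariant_endo :: "'g monoid \<Rightarrow> ('g, 'e::euclidean_space) manifold \<Rightarrow>
    ('g vfield \<Rightarrow> 'g vfield) \<Rightarrow> bool" where
  "left_invariant_endo G M A \<longleftrightarrow> (\<forall>g\<in>carrier G. endo_related M M (\<lambda>x. g \<otimes>\<^bsub>G\<^esub> x) A A)"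

definition left_invariant_form :: "'g monoid \<Rightarrow> ('g, 'e::euclidean_space) manifold \<Rightarrow>
    nat \<Rightarrow> 'g cform \<Rightarrow> bool" where
  "left_invariant_form G M k \<omega> \<longleftrightarrow> (\<forall>g\<in>carrier G. form_related M M (\<lambda>x. g \<otimes>\<^bsub>G\<^esub> x) k \<omega> \<omega>)"

definition hypercomplex_nilmanifold :: "'g monoid \<Rightarrow> ('g, 'e::euclidean_space) manifold \<Rightarrow> 'g set \<Rightarrow>
    ('g set, 'e) manifold \<Rightarrow> ('g set vfield \<Rightarrow> 'g set vfield) \<Rightarrow>
    ('g set vfield \<Rightarrow> 'g set vfield) \<Rightarrow> ('g set vfield \<Rightarrow> 'g set vfield) \<Rightarrow> bool" where
  "hypercomplex_nilmanifold G M \<Gamma> N I J K \<longleftrightarrow>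
     nilmanifold G M \<Gamma> N \<and> hypercomplex N I J K \<and>
     (\<exists>I' J' K'. hypercomplex M I' J' K' \<and>
        left_invariant_endo G M I' \<and> left_invariant_endo G M J' \<and> left_invariant_endo G M K' \<and>
        endo_related M N (coset_proj G \<Gamma>) I' I \<and>
        endo_related M N (coset_proj G \<Gamma>) J' J \<and>
        endo_related M N (coset_proj G \<Gamma>) K' K)"

definition left_invariant_section :: "'g monoid \<Rightarrow> ('g, 'e::euclidean_space) manifold \<Rightarrow> 'g set \<Rightarrow>
    ('g set, 'e) manifold \<Rightarrow> nat \<Rightarrow> 'g set cform \<Rightarrow> bool" where
  "left_invariant_section G M \<Gamma> N k \<eta> \<longleftrightarrow>
     (\<exists>\<omega>. complex_form M k \<omega> \<and> left_invariant_form G M k \<omega> \<and>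
          form_related M N (coset_proj G \<Gamma>) k \<omega> \<eta>)"

end

theory Submission
  imports Defs
begin

text \<open>
  On a hypercomplex manifold of complex dimension \<open>2n\<close> put \<open>\<eta>\<^sup>J(Y\<^sub>1, \<dots>) = cnj (\<eta>(J Y\<^sub>1, \<dots>))\<close> for a form
  \<open>\<eta>\<close> of type \<open>(2n,0)\<close>; since \<open>J\<close> anticommutes with \<open>I\<close>, this is again of type \<open>(2n,0)\<close>, and such forms
  are proportional pointwise. Hence \<open>\<eta>\<^sup>J = u \<eta>\<close> and \<open>\<nabla>\<^sub>X \<eta> = \<theta>(X) \<eta>\<close>. If \<open>\<eta>\<close> and \<open>J\<close> are left-invariant,
  then \<open>\<eta>\<close> vanishes everywhere or nowhere and \<open>u\<close> is constant; differentiating \<open>\<eta>\<^sup>J = u \<eta>\<close> with \<open>\<nabla>J = 0\<close>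
  shows that \<open>\<theta>\<close> is real. As \<open>\<nabla>\<close> is torsion-free, \<open>d\<eta> = \<theta> \<and> \<eta>\<close>, so holomorphicity of \<open>\<eta>\<close> says
  \<open>\<theta>(X) + \<i> \<theta>(I X) = 0\<close>, and a real \<open>\<theta>\<close> with this property is zero.
\<close>

section \<open>Smooth maps between Euclidean spaces\<close>

text \<open>Vector fields are derivations of the algebra of global functions, so a field has no
  value at a point to begin with. Proportionality of two forms is linear algebra in one tangent
  space and needs such values; cut-off functions and Hadamard's lemma supply them, by showing that
  an expression linear over the functions sees only finitely many numbers at \<open>p\<close>.
  Constancy of \<open>u\<close> meets another obstacle: left translations of \<open>G\<close> do not
  act on the cosets \<open>\<Gamma> g\<close>. Two points of \<open>N\<close> are therefore compared
  by lifting tangent vectors to \<open>G\<close>, moving them along a left translation and pushing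
  them down again, and one and the same tuple must transport \<open>\<eta>\<close> and its composite
  with \<open>J\<close>. Constancy matters because the relation between the two is differentiated: a
  varying \<open>u\<close> would contribute a term with its derivative, and nothing could be said
  about the imaginary part of \<open>\<theta>\<close>. The one-form \<open>\<theta>\<close> is
  formed at one fixed point, as a quotient on a tuple where \<open>\<eta>\<close> is
  nonzero.\<close>

lemma Ck_on_subset: "Ck_on k S f \<Longrightarrow> T \<subseteq> S \<Longrightarrow> Ck_on k T f"
  by (induction k arbitrary: f) (auto intro: continuous_on_subset)

lemma Ck_on_cong:
  assumes "open S" "\<And>x. x \<in> S \<Longrightarrow> f x = g x" "Ck_on k S f"
  shows "Ck_on k S g"
  using assms(2,3)
proof (induction k arbitrary: f g)
  case 0
  then show ?case using continuous_on_cong[of S S f g] by simp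
next
  case (Suc k)
  have d: "f differentiable at x" if "x \<in> S" for x using Suc.prems that by simp
  have e: "frechet_derivative f (at x) = frechet_derivative g (at x)" if "x \<in> S" for x
    using frechet_derivative_transform_within_open[OF d[OF that] assms(1) that] Suc.prems(1) by blast
  have "g differentiable at x" if "x \<in> S" for x
    using d[OF that] assms(1) that Suc.prems(1) unfolding differentiable_def
    by (metis has_derivative_transform_within_open)
  moreover have "Ck_on k S (\<lambda>x. frechet_derivative g (at x) v)" for v
    by (rule Suc.IH[of "\<lambda>x. frechet_derivative f (at x) v"]) (use e Suc.prems in auto)
  ultimately show ?case by simp
qed

text \<open>\<open>frechet_derivative\<close> is a choice operator; uniqueness of derivatives lets
  any explicit formula \<open>f'\<close> take its place. The closure properties below rest on
  this.\<close>

lemma Ck_on_SucI: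
  assumes "open S" "\<And>x. x \<in> S \<Longrightarrow> (f has_derivative f' x) (at x)"
    "\<And>v. Ck_on k S (\<lambda>x. f' x v)"
  shows "Ck_on (Suc k) S f"
proof -
  have "frechet_derivative f (at x) = f' x" if "x \<in> S" for x
    using assms(2)[OF that] frechet_derivative_at by metis
  then have "Ck_on k S (\<lambda>x. frechet_derivative f (at x) v)" for v
    using Ck_on_cong[OF assms(1) _ assms(3)[of v]] by simp
  then show ?thesis using assms(2) by (auto simp: differentiable_def)
qed

lemma Ck_on_SucD:
  assumes "Ck_on (Suc k) S f" "x \<in> S"
  shows "(f has_derivative frechet_derivative f (at x)) (at x)"
  using assms frechet_derivative_works by auto

text \<open>The recursion does not list lower orders, but the product and chain rules need them for
  the factors left undifferentiated.\<close>

lemma Ck_on_Suc_imp: "Ck_on (Suc k) S f \<Longrightarrow> Ck_on k S f"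
proof (induction k arbitrary: f)
  case 0
  then show ?case
    by (auto intro!: continuous_at_imp_continuous_on differentiable_imp_continuous_within)
next
  case (Suc k)
  then show ?case unfolding Ck_on.simps(2)[of "Suc k"] Ck_on.simps(2)[of k S f] by blast
qed

lemma Ck_on_local:
  assumes "\<And>x. x \<in> S \<Longrightarrow> \<exists>T. open T \<and> x \<in> T \<and> Ck_on k T f"
  shows "Ck_on k S f"
  using assms
proof (induction k arbitrary: f)
  case 0
  then show ?case
    by (auto intro!: continuous_at_imp_continuous_on) (metis continuous_on_eq_continuous_at)
next
  case (Suc k)
  then show ?case by simp metis
qed

lemma Ck_on_const: "open S \<Longrightarrow> Ck_on k S (\<lambda>x. c)"
  by (induction k arbitrary: c) (auto)

lemma Ck_on_linear:
  assumes "bounded_linear L" "open S" "Ck_on k S f"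
  shows "Ck_on k S (\<lambda>x. L (f x))"
  using assms(3)
proof (induction k arbitrary: f)
  case 0
  then show ?case using assms(1) by (simp add: bounded_linear.continuous_on)
next
  case (Suc k)
  show ?case
  proof (rule Ck_on_SucI[OF assms(2)])
    fix x assume "x \<in> S"
    show "((\<lambda>x. L (f x)) has_derivative (\<lambda>v. L (frechet_derivative f (at x) v))) (at x)"
      using bounded_linear.has_derivative[OF assms(1) Ck_on_SucD[OF Suc.prems \<open>x \<in> S\<close>]] .
  next
    fix v show "Ck_on k S (\<lambda>x. L (frechet_derivative f (at x) v))"
      using Suc by simp
  qed
qed

lemma Ck_on_add:
  assumes "open S" "Ck_on k S f" "Ck_on k S g"
  shows "Ck_on k S (\<lambda>x. f x + g x)"
  using assms(2,3)
proof (induction k arbitrary: f g)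
  case 0
  then show ?case by (simp add: continuous_on_add)
next
  case (Suc k)
  show ?case
  proof (rule Ck_on_SucI[OF assms(1)])
    fix x assume "x \<in> S"
    show "((\<lambda>x. f x + g x) has_derivative
       (\<lambda>v. frechet_derivative f (at x) v + frechet_derivative g (at x) v)) (at x)"
      using has_derivative_add[OF Ck_on_SucD[OF Suc.prems(1) \<open>x \<in> S\<close>] Ck_on_SucD[OF Suc.prems(2) \<open>x \<in> S\<close>]] .
  next
    fix v show "Ck_on k S (\<lambda>x. frechet_derivative f (at x) v + frechet_derivative g (at x) v)"
      using Suc by simp
  qed
qed

lemma Ck_on_sum:
  assumes "open S" "\<And>i. i \<in> A \<Longrightarrow> Ck_on k S (f i)"
  shows "Ck_on k S (\<lambda>x. \<Sum>i\<in>A. f i x)"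
  using assms(2)
  by (induction A rule: infinite_finite_induct) (auto simp: Ck_on_const Ck_on_add assms(1))

lemma Ck_on_bilinear:
  assumes "bounded_bilinear B" "open S" "Ck_on k S f" "Ck_on k S g"
  shows "Ck_on k S (\<lambda>x. B (f x) (g x))"
  using assms(3,4)
proof (induction k arbitrary: f g)
  case 0
  then show ?case using assms(1) by (simp add: bounded_bilinear.continuous_on)
next
  case (Suc k)
  show ?case
  proof (rule Ck_on_SucI[OF assms(2)])
    fix x assume "x \<in> S"
    show "((\<lambda>x. B (f x) (g x)) has_derivative
       (\<lambda>v. B (f x) (frechet_derivative g (at x) v) + B (frechet_derivative f (at x) v) (g x))) (at x)"
      using bounded_bilinear.FDERIV[OF assms(1) Ck_on_SucD[OF Suc.prems(1) \<open>x \<in> S\<close>] Ck_on_SucD[OF Suc.prems(2) \<open>x \<in> S\<close>]] .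
  next
    fix v show "Ck_on k S (\<lambda>x. B (f x) (frechet_derivative g (at x) v) + B (frechet_derivative f (at x) v) (g x))"
      using Suc Ck_on_Suc_imp[OF Suc.prems(1)] Ck_on_Suc_imp[OF Suc.prems(2)]
      by (intro Ck_on_add assms) simp_all
  qed
qed

lemmas Ck_on_scaleR = Ck_on_bilinear[OF bounded_bilinear_scaleR]
lemmas Ck_on_inner_left = Ck_on_linear[OF bounded_linear_inner_left]

lemma Ck_on_compose:
  fixes f :: "'d::euclidean_space \<Rightarrow> 'e::euclidean_space" and g :: "'e \<Rightarrow> 'b::real_normed_vector"
  assumes "open S" "f ` S \<subseteq> T" "Ck_on k S f" "Ck_on k T g"
  shows "Ck_on k S (\<lambda>x. g (f x))"
  using assms(3,4)
proof (induction k arbitrary: g)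
  case 0
  then show ?case using assms(2) continuous_on_compose2[of T g S f] by simp
next
  case (Suc k)
  show ?case
  proof (rule Ck_on_SucI[OF assms(1)])
    fix x assume x: "x \<in> S"
    then have fx: "f x \<in> T" using assms(2) by auto
    let ?f' = "frechet_derivative f (at x)" and ?g' = "frechet_derivative g (at (f x))"
    have g': "(g has_derivative ?g') (at (f x))" using Ck_on_SucD[OF Suc.prems(2) fx] .
    \<comment> \<open>\<open>Ck_on\<close> controls derivatives in fixed directions only, whereas
      \<open>?f' v\<close> varies with the point; expanding it in \<open>Basis\<close> leaves fixed
      directions \<open>b\<close> with varying coefficients.\<close>
    have "?g' v = (\<Sum>b\<in>Basis. (v \<bullet> b) *\<^sub>R ?g' b)" for v
    proof -
      have l: "linear ?g'" using g' has_derivative_linear by blast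
      have "?g' v = ?g' (\<Sum>b\<in>Basis. (v \<bullet> b) *\<^sub>R b)" by (simp add: euclidean_representation)
      also have "\<dots> = (\<Sum>b\<in>Basis. (v \<bullet> b) *\<^sub>R ?g' b)"
        by (simp add: linear_sum[OF l] linear_cmul[OF l])
      finally show ?thesis .
    qed
    from this[of "?f' _", symmetric]
    show "((\<lambda>x. g (f x)) has_derivative (\<lambda>v. \<Sum>b\<in>Basis. (?f' v \<bullet> b) *\<^sub>R ?g' b)) (at x)"
      using has_derivative_compose[OF Ck_on_SucD[OF Suc.prems(1) x] g'] by simp
  next
    fix v
    show "Ck_on k S (\<lambda>x. \<Sum>b\<in>Basis. (frechet_derivative f (at x) v \<bullet> b) *\<^sub>R frechet_derivative g (at (f x)) b)"
      using Suc.IH[OF Ck_on_Suc_imp[OF Suc.prems(1)], of "\<lambda>y. frechet_derivative g (at y) _"] Suc.prems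
      by (intro Ck_on_sum Ck_on_scaleR Ck_on_inner_left assms(1)) auto
  qed
qed

lemma smooth_on_derivative:
  "smooth_on S f \<Longrightarrow> smooth_on S (\<lambda>x. frechet_derivative f (at x) v)"
  unfolding smooth_on_def by (metis Ck_on.simps(2))

lemma smooth_on_has_derivative:
  "smooth_on S f \<Longrightarrow> x \<in> S \<Longrightarrow> (f has_derivative frechet_derivative f (at x)) (at x)"
  unfolding smooth_on_def by (blast intro: Ck_on_SucD)

lemma smooth_on_continuous: "smooth_on S f \<Longrightarrow> continuous_on S f"
  unfolding smooth_on_def by (metis Ck_on.simps(1))

lemma smooth_on_subset: "smooth_on S f \<Longrightarrow> T \<subseteq> S \<Longrightarrow> smooth_on T f"
  unfolding smooth_on_def by (metis Ck_on_subset)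

lemma smooth_on_cong:
  "open S \<Longrightarrow> (\<And>x. x \<in> S \<Longrightarrow> f x = g x) \<Longrightarrow> smooth_on S f \<Longrightarrow> smooth_on S g"
  unfolding smooth_on_def by (metis Ck_on_cong)

lemma smooth_on_local:
  "(\<And>x. x \<in> S \<Longrightarrow> \<exists>T. open T \<and> x \<in> T \<and> smooth_on T f) \<Longrightarrow> smooth_on S f"
  unfolding smooth_on_def by (intro allI Ck_on_local) blast

lemma smooth_on_const: "open S \<Longrightarrow> smooth_on S (\<lambda>x. c)"
  unfolding smooth_on_def by (simp add: Ck_on_const)

lemma smooth_on_add:
  "open S \<Longrightarrow> smooth_on S f \<Longrightarrow> smooth_on S g \<Longrightarrow> smooth_on S (\<lambda>x. f x + g x)"
  unfolding smooth_on_def by (simp add: Ck_on_add)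

lemma smooth_on_linear:
  "bounded_linear L \<Longrightarrow> open S \<Longrightarrow> smooth_on S f \<Longrightarrow> smooth_on S (\<lambda>x. L (f x))"
  unfolding smooth_on_def by (simp add: Ck_on_linear)

lemma smooth_on_bilinear:
  "bounded_bilinear B \<Longrightarrow> open S \<Longrightarrow> smooth_on S f \<Longrightarrow> smooth_on S g \<Longrightarrow> smooth_on S (\<lambda>x. B (f x) (g x))"
  unfolding smooth_on_def by (simp add: Ck_on_bilinear)

lemma smooth_on_compose:
  "open S \<Longrightarrow> f ` S \<subseteq> T \<Longrightarrow> smooth_on S f \<Longrightarrow> smooth_on T g \<Longrightarrow> smooth_on S (\<lambda>x. g (f x))"
  unfolding smooth_on_def by (metis Ck_on_compose)

lemma smooth_on_ident: "open S \<Longrightarrow> smooth_on S (\<lambda>x. x)"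
  unfolding smooth_on_def
proof
  fix k assume "open S"
  then show "Ck_on k S (\<lambda>x. x)"
    by (cases k) (auto intro!: Ck_on_SucI[where f' = "\<lambda>_ v. v"] Ck_on_const continuous_on_id simp del: Ck_on.simps(2))
qed


text \<open>The derivative of \<open>1/f\<close> is built from \<open>1/f\<close> itself and the
  derivative of \<open>f\<close>, so the induction on the order stays with the same
  function.\<close>

lemma smooth_on_inverse:
  fixes f :: "'e::euclidean_space \<Rightarrow> real"
  assumes "open S" "smooth_on S f" "\<And>x. x \<in> S \<Longrightarrow> f x \<noteq> 0"
  shows "smooth_on S (\<lambda>x. inverse (f x))"
proof -
  have "Ck_on k S (\<lambda>x. inverse (f x))" for k
  proof (induction k)
    case 0
    then show ?case using assms smooth_on_continuous[OF assms(2)] by (simp add: continuous_on_inverse)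
  next
    case (Suc k)
    have f': "Ck_on k S (\<lambda>x. frechet_derivative f (at x) v)" for v
      using smooth_on_derivative[OF assms(2)] by (simp add: smooth_on_def)
    show ?case
    proof (rule Ck_on_SucI[OF assms(1)])
      fix x assume "x \<in> S"
      show "((\<lambda>x. inverse (f x)) has_derivative
          (\<lambda>v. - 1 *\<^sub>R (inverse (f x) *\<^sub>R (inverse (f x) *\<^sub>R frechet_derivative f (at x) v)))) (at x)"
        using Deriv.has_derivative_inverse[OF _ smooth_on_has_derivative[OF assms(2) \<open>x \<in> S\<close>]] assms(3)[OF \<open>x \<in> S\<close>]
        by (simp add: algebra_simps)
    next
      fix v show "Ck_on k S (\<lambda>x. - 1 *\<^sub>R (inverse (f x) *\<^sub>R (inverse (f x) *\<^sub>R frechet_derivative f (at x) v)))"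
        by (intro Ck_on_scaleR Ck_on_const assms(1) Suc f')
    qed
  qed
  then show ?thesis by (simp add: smooth_on_def)
qed

section \<open>Flat functions and bump functions on Euclidean space\<close>

definition flat_exp :: "nat \<Rightarrow> real \<Rightarrow> real" where
  "flat_exp m x = (if x > 0 then exp (- inverse x) * inverse x ^ m else 0)"

lemma flat_exp_tendsto: "(flat_exp m \<longlongrightarrow> 0) (at 0)"
proof (rule filterlim_split_at)
  have "((\<lambda>x::real. inverse x ^ m / exp (inverse x)) \<longlongrightarrow> 0) (at_right 0)"
    by (rule filterlim_compose[OF tendsto_power_div_exp_0 filterlim_inverse_at_top_right])
  then show "(flat_exp m \<longlongrightarrow> 0) (at_right 0)"
    by (rule Lim_transform_eventually)
      (auto simp: eventually_at_filter flat_exp_def exp_minus field_simps)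
  show "(flat_exp m \<longlongrightarrow> 0) (at_left 0)"
    by (rule Lim_transform_eventually[OF tendsto_const])
      (auto simp: eventually_at_filter flat_exp_def)
qed

text \<open>The exponent \<open>m\<close> makes the family closed under differentiation, so that all
  members are smooth by one induction; \<open>m = 0\<close> is the classical flat function.\<close>

lemma flat_exp_has_derivative:
  "(flat_exp m has_real_derivative (flat_exp (m + 2) x - m * flat_exp (m + 1) x)) (at x)"
proof -
  consider "x > 0" | "x < 0" | "x = 0" by linarith
  then show ?thesis
  proof cases
    case 1
    have "((\<lambda>x. exp (- inverse x) * inverse x ^ m) has_real_derivative
        (flat_exp (m + 2) x - m * flat_exp (m + 1) x)) (at x)"
    proof (cases m)
      case 0
      then show ?thesis
        using 1 by (auto intro!: derivative_eq_intros simp: flat_exp_def field_simps power2_eq_square)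
    next
      case (Suc n)
      then show ?thesis
        using 1 by (auto intro!: derivative_eq_intros simp: flat_exp_def field_simps power2_eq_square)
          (cases n; simp)
    qed
    then show ?thesis
      by (rule has_field_derivative_transform_within_open[where S = "{0<..}"]) (use 1 in \<open>auto simp: flat_exp_def\<close>)
  next
    case 2
    have "((\<lambda>x. 0) has_real_derivative (flat_exp (m + 2) x - m * flat_exp (m + 1) x)) (at x)"
      using 2 by (simp add: flat_exp_def)
    then show ?thesis
      by (rule has_field_derivative_transform_within_open[where S = "{..<0}"]) (use 2 in \<open>auto simp: flat_exp_def\<close>)
  next
    case 3
    \<comment> \<open>The difference quotient at 0 is \<open>flat_exp (Suc m)\<close>.\<close>
    have "((\<lambda>h. (flat_exp m h - flat_exp m 0) / h) \<longlongrightarrow> 0) (at 0)"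
      using flat_exp_tendsto[of "Suc m"]
      by (rule Lim_transform_eventually) (auto simp: eventually_at_filter flat_exp_def field_simps)
    then show ?thesis using 3 by (simp add: DERIV_def flat_exp_def)
  qed
qed

lemma smooth_on_flat_exp: "smooth_on UNIV (flat_exp m)"
proof -
  have "Ck_on k UNIV (flat_exp m)" for k m
  proof (induction k arbitrary: m)
    case 0
    then show ?case
      by (auto intro!: continuous_at_imp_continuous_on DERIV_isCont[OF flat_exp_has_derivative])
  next
    case (Suc k)
    show ?case
    proof (rule Ck_on_SucI)
      fix x
      show "(flat_exp m has_derivative (\<lambda>v. v *\<^sub>R (flat_exp (m + 2) x + (- real m) *\<^sub>R flat_exp (m + 1) x))) (at x)"
        using flat_exp_has_derivative[of m x] by (simp add: has_field_derivative_def mult_commute_abs)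
    next
      fix v show "Ck_on k UNIV (\<lambda>x. v *\<^sub>R (flat_exp (m + 2) x + (- real m) *\<^sub>R flat_exp (m + 1) x))"
        by (intro Ck_on_scaleR Ck_on_add Ck_on_const Suc open_UNIV)
    qed simp
  qed
  then show ?thesis by (simp add: smooth_on_def)
qed

lemma smooth_bump:
  fixes a :: "'e::euclidean_space"
  assumes "r > 0"
  obtains b :: "'e \<Rightarrow> real" where "smooth_on UNIV b"
    "\<And>x. dist a x \<le> r / 2 \<Longrightarrow> b x = 1" "\<And>x. dist a x \<ge> r \<Longrightarrow> b x = 0"
proof
  \<comment> \<open>The constants give \<open>s = 1\<close> at distance \<open>r / 2\<close> and
    \<open>s = 0\<close> at distance \<open>r\<close>. Since \<open>s\<close> and \<open>t\<close>
    add up to 1, one of them is positive, and so is the denominator of \<open>b\<close>.\<close>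
  define s :: "'e \<Rightarrow> real" where "s x = 4/3 + (- 4 / (3 * r\<^sup>2)) *\<^sub>R ((x + - a) \<bullet> (x + - a))" for x
  define t :: "'e \<Rightarrow> real" where "t x = 1 + (- 1) *\<^sub>R s x" for x
  define b where "b x = flat_exp 0 (s x) *\<^sub>R inverse (flat_exp 0 (s x) + flat_exp 0 (t x))" for x
  have sm: "smooth_on UNIV s"
    unfolding s_def by (intro smooth_on_add smooth_on_bilinear[OF bounded_bilinear_scaleR]
      smooth_on_bilinear[OF bounded_bilinear_inner] smooth_on_const smooth_on_ident open_UNIV)
  have tm: "smooth_on UNIV t"
    unfolding t_def by (intro smooth_on_add smooth_on_bilinear[OF bounded_bilinear_scaleR]
      sm smooth_on_const open_UNIV)
  have hs: "smooth_on UNIV (\<lambda>x. flat_exp 0 (s x))" "smooth_on UNIV (\<lambda>x. flat_exp 0 (t x))"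
    by (rule smooth_on_compose[OF _ _ _ smooth_on_flat_exp], auto simp: sm tm)+
  have nz: "flat_exp 0 (s x) + flat_exp 0 (t x) \<noteq> 0" for x
  proof -
    have "s x > 0 \<or> t x > 0" by (auto simp: t_def)
    moreover have "flat_exp 0 u \<ge> 0" "u > 0 \<Longrightarrow> flat_exp 0 u > 0" for u by (auto simp: flat_exp_def)
    ultimately show ?thesis by (metis add_pos_nonneg add_nonneg_pos less_irrefl)
  qed
  show "smooth_on UNIV b"
    unfolding b_def by (intro smooth_on_bilinear[OF bounded_bilinear_scaleR] smooth_on_inverse
      smooth_on_add hs nz open_UNIV)
  have s: "s x = 4/3 - 4/3 * ((dist a x) / r)\<^sup>2" for x
  proof -
    have "(x + - a) \<bullet> (x + - a) = (dist a x)\<^sup>2"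
      by (simp add: dist_norm norm_minus_commute[of a] power2_norm_eq_inner)
    then show ?thesis using assms by (simp add: s_def power_divide field_simps)
  qed
  show "b x = 1" if "dist a x \<le> r / 2" for x
  proof -
    have "(dist a x / r)\<^sup>2 \<le> (1/2)\<^sup>2" using that assms by (intro power_mono) (auto simp: field_simps)
    then have "(dist a x / r)\<^sup>2 \<le> 1/4" by (simp only: power_one_over) (simp add: power2_eq_square)
    then have "t x \<le> 0" unfolding t_def s real_scaleR_def by argo
    then have "flat_exp 0 (t x) = 0" by (simp add: flat_exp_def)
    then show ?thesis using nz[of x] by (simp add: b_def)
  qed
  show "b x = 0" if "dist a x \<ge> r" for x
  proof -
    have "1\<^sup>2 \<le> (dist a x / r)\<^sup>2" using that assms by (intro power_mono) (auto simp: field_simps)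
    then have "s x \<le> 0" unfolding s by simp
    then show ?thesis by (simp add: b_def flat_exp_def)
  qed
qed

text \<open>Each differentiation in \<open>y\<close> under the integral brings out a factor
  \<open>t\<close>; the weight \<open>t ^ m\<close> absorbs it in the induction on the
  order.\<close>

lemma smooth_on_radial_integral:
  fixes h :: "'e::euclidean_space \<Rightarrow> real"
  assumes "smooth_on (ball c r) h" "a \<in> ball c r"
  shows "smooth_on (ball c r) (\<lambda>y. integral (cbox 0 1) (\<lambda>t. t ^ m * h (a + t *\<^sub>R (y - a))))"
proof -
  have mem: "a + t *\<^sub>R (y - a) \<in> ball c r" if "y \<in> ball c r" "t \<in> cbox 0 (1::real)" for y t
    using convexD_alt[OF convex_ball assms(2) that(1), of t] that(2) by (simp add: algebra_simps)
  have cont: "continuous_on (ball c r \<times> cbox 0 1) (\<lambda>(y, t). t ^ m * k (a + t *\<^sub>R (y - a)))"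
    if "smooth_on (ball c r) k" for k :: "'e \<Rightarrow> real" and m
    unfolding case_prod_beta
    by (intro continuous_intros continuous_on_compose2[OF smooth_on_continuous[OF that]])
      (use mem in auto)
  have int: "(\<lambda>t. t ^ m * k (a + t *\<^sub>R (y - a))) integrable_on cbox 0 1"
    if "smooth_on (ball c r) k" "y \<in> ball c r" for k :: "'e \<Rightarrow> real" and m y
  proof (rule integrable_continuous)
    show "continuous_on (cbox 0 1) (\<lambda>t. t ^ m * k (a + t *\<^sub>R (y - a)))"
      by (intro continuous_intros continuous_on_compose2[OF smooth_on_continuous[OF that(1)]])
        (use mem[OF that(2)] in auto)
  qed
  have "Ck_on k (ball c r) (\<lambda>y. integral (cbox 0 1) (\<lambda>t. t ^ m * h (a + t *\<^sub>R (y - a))))"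
    if "smooth_on (ball c r) h" for k m h
    using that
  proof (induction k arbitrary: m h)
    case 0
    have "continuous_on (ball c r) (\<lambda>y. integral (cbox 0 1) (\<lambda>t. t ^ m * h (a + t *\<^sub>R (y - a))))"
      by (rule integral_continuous_on_param[OF cont[OF 0]])
    then show ?case by simp
  next
    case (Suc k)
    \<comment> \<open>The Leibniz rule wants the derivative as a continuous map into bounded linear
      functions; continuity is then checked direction by direction.\<close>
    define h' where "h' z = Blinfun (frechet_derivative h (at z))" for z
    have h': "blinfun_apply (h' z) = frechet_derivative h (at z)" if "z \<in> ball c r" for z
      unfolding h'_def
      by (rule bounded_linear_Blinfun_apply, rule has_derivative_bounded_linear,
        rule smooth_on_has_derivative[OF Suc.prems that])
    have ch': "continuous_on (ball c r) h'"
    proof (rule continuous_on_blinfun_componentwise)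
      fix i :: 'e
      show "continuous_on (ball c r) (\<lambda>x. blinfun_apply (h' x) i)"
        using smooth_on_continuous[OF smooth_on_derivative[OF Suc.prems, of i]]
        by (rule continuous_on_eq) (simp add: h')
    qed
    define g where "g y t = t ^ Suc m *\<^sub>R h' (a + t *\<^sub>R (y - a))" for y t
    have cg: "continuous_on (ball c r \<times> cbox 0 1) (\<lambda>(y, t). g y t)"
      unfolding g_def case_prod_beta
      by (intro continuous_intros continuous_on_compose2[OF ch']) (use mem in auto)
    show ?case
    proof (rule Ck_on_SucI[OF open_ball])
      fix x assume x: "x \<in> ball c r"
      have "((\<lambda>y. integral (cbox 0 1) (\<lambda>t. t ^ m * h (a + t *\<^sub>R (y - a)))) has_derivative
          blinfun_apply (integral (cbox 0 1) (g x))) (at x within ball c r)"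
      proof (rule leibniz_rule[OF _ int[OF Suc.prems] cg x])
        fix y and t :: real assume y: "y \<in> ball c r" "t \<in> cbox 0 1"
        have d: "((\<lambda>y. a + t *\<^sub>R (y - a)) has_derivative (\<lambda>v. t *\<^sub>R v)) (at y)"
          by (auto intro!: derivative_eq_intros)
        have "((\<lambda>y. h (a + t *\<^sub>R (y - a))) has_derivative
           (\<lambda>v. frechet_derivative h (at (a + t *\<^sub>R (y - a))) (t *\<^sub>R v))) (at y)"
          by (rule has_derivative_compose[OF d smooth_on_has_derivative[OF Suc.prems mem[OF y]]])
        from has_derivative_mult_right[OF this, of "t ^ m"]
        have "((\<lambda>y. t ^ m * h (a + t *\<^sub>R (y - a))) has_derivative
           (\<lambda>v. t ^ m * frechet_derivative h (at (a + t *\<^sub>R (y - a))) (t *\<^sub>R v))) (at y)" .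
        moreover have "(\<lambda>v. t ^ m * frechet_derivative h (at (a + t *\<^sub>R (y - a))) (t *\<^sub>R v)) = blinfun_apply (g y t)"
          by (simp add: fun_eq_iff g_def h'[OF mem[OF y], symmetric] blinfun.scaleR_left blinfun.scaleR_right)
        ultimately show "((\<lambda>y. t ^ m * h (a + t *\<^sub>R (y - a))) has_derivative blinfun_apply (g y t)) (at y within ball c r)"
          by (simp add: has_derivative_at_withinI)
      qed auto
      moreover have "blinfun_apply (integral (cbox 0 1) (g x)) =
          (\<lambda>v. integral (cbox 0 1) (\<lambda>t. t ^ Suc m * frechet_derivative h (at (a + t *\<^sub>R (x - a))) v))"
      proof
        fix v
        have "continuous_on (cbox 0 1) (g x)"
          unfolding g_def
          by (intro continuous_intros continuous_on_compose2[OF ch']) (use mem[OF x] in auto)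
        then have "blinfun_apply (integral (cbox 0 1) (g x)) v = integral (cbox 0 1) (\<lambda>t. blinfun_apply (g x t) v)"
          using integral_linear[OF integrable_continuous, of 0 1 "g x" "\<lambda>f. blinfun_apply f v"]
          by (simp add: o_def blinfun.bounded_linear_left)
        also have "\<dots> = integral (cbox 0 1) (\<lambda>t. t ^ Suc m * frechet_derivative h (at (a + t *\<^sub>R (x - a))) v)"
          by (rule integral_cong) (simp add: g_def h'[OF mem[OF x], symmetric] blinfun.scaleR_left)
        finally show "blinfun_apply (integral (cbox 0 1) (g x)) v =
          integral (cbox 0 1) (\<lambda>t. t ^ Suc m * frechet_derivative h (at (a + t *\<^sub>R (x - a))) v)" .
      qed
      ultimately show "((\<lambda>y. integral (cbox 0 1) (\<lambda>t. t ^ m * h (a + t *\<^sub>R (y - a)))) has_derivative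
          (\<lambda>v. integral (cbox 0 1) (\<lambda>t. t ^ Suc m * frechet_derivative h (at (a + t *\<^sub>R (x - a))) v))) (at x)"
        unfolding at_within_open[OF x open_ball] by (simp only:)
    next
      fix v
      show "Ck_on k (ball c r) (\<lambda>x. integral (cbox 0 1) (\<lambda>t. t ^ Suc m * frechet_derivative h (at (a + t *\<^sub>R (x - a))) v))"
        by (rule Suc.IH[OF smooth_on_derivative[OF Suc.prems]])
    qed
  qed
  then show ?thesis using assms by (simp add: smooth_on_def)
qed

text \<open>With the integral remainder the coefficients are smooth on the whole ball, so that
  derivations can be applied to them.\<close>

lemma hadamard_lemma:
  fixes f :: "'e::euclidean_space \<Rightarrow> real"
  assumes "smooth_on (ball c r) f" "a \<in> ball c r"
  obtains g where "\<And>b. smooth_on (ball c r) (g b)"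
    "\<And>b. g b a = frechet_derivative f (at a) b"
    "\<And>y. y \<in> ball c r \<Longrightarrow> f y = f a + (\<Sum>b\<in>Basis. ((y - a) \<bullet> b) * g b y)"
proof
  let ?f' = "\<lambda>z. frechet_derivative f (at z)"
  define g where "g b y = integral (cbox 0 1) (\<lambda>t. t ^ 0 * ?f' (a + t *\<^sub>R (y - a)) b)" for b y
  show "smooth_on (ball c r) (g b)" for b
    unfolding g_def by (rule smooth_on_radial_integral[OF smooth_on_derivative[OF assms(1)] assms(2)])
  show "g b a = ?f' a b" for b by (simp add: g_def)
  fix y assume y: "y \<in> ball c r"
  have mem: "a + t *\<^sub>R (y - a) \<in> ball c r" if "t \<in> cbox 0 (1::real)" for t
    using convexD_alt[OF convex_ball assms(2) y, of t] that by (simp add: algebra_simps)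
  have "((\<lambda>t. ?f' (a + t *\<^sub>R (y - a)) (y - a)) has_integral f (a + 1 *\<^sub>R (y - a)) - f (a + 0 *\<^sub>R (y - a))) {0..1}"
  proof (rule fundamental_theorem_of_calculus)
    fix t :: real assume "t \<in> {0..1}"
    have d: "((\<lambda>t. a + t *\<^sub>R (y - a)) has_derivative (\<lambda>s. s *\<^sub>R (y - a))) (at t)"
      by (auto intro!: derivative_eq_intros)
    have D: "(f has_derivative ?f' (a + t *\<^sub>R (y - a))) (at (a + t *\<^sub>R (y - a)))"
      using smooth_on_has_derivative[OF assms(1)] mem \<open>t \<in> {0..1}\<close> by simp
    then have l: "linear (?f' (a + t *\<^sub>R (y - a)))" using has_derivative_linear by blast
    show "((\<lambda>t. f (a + t *\<^sub>R (y - a))) has_vector_derivative ?f' (a + t *\<^sub>R (y - a)) (y - a)) (at t within {0..1})"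
      using has_derivative_compose[OF d D] unfolding has_vector_derivative_def linear_cmul[OF l]
      by (rule has_derivative_at_withinI)
  qed simp
  then have "f y - f a = integral (cbox 0 1) (\<lambda>t. ?f' (a + t *\<^sub>R (y - a)) (y - a))"
    by (simp add: integral_unique)
  also have "\<dots> = integral (cbox 0 1) (\<lambda>t. \<Sum>b\<in>Basis. ((y - a) \<bullet> b) * ?f' (a + t *\<^sub>R (y - a)) b)"
  proof (rule integral_cong)
    fix t :: real assume t: "t \<in> cbox 0 1"
    have l: "linear (?f' (a + t *\<^sub>R (y - a)))"
      using smooth_on_has_derivative[OF assms(1) mem[OF t]] has_derivative_linear by blast
    have "?f' (a + t *\<^sub>R (y - a)) (y - a) = ?f' (a + t *\<^sub>R (y - a)) (\<Sum>b\<in>Basis. ((y - a) \<bullet> b) *\<^sub>R b)"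
      by (simp only: euclidean_representation)
    then show "?f' (a + t *\<^sub>R (y - a)) (y - a) = (\<Sum>b\<in>Basis. ((y - a) \<bullet> b) * ?f' (a + t *\<^sub>R (y - a)) b)"
      by (simp only: linear_sum[OF l] linear_cmul[OF l] real_scaleR_def)
  qed
  also have "\<dots> = (\<Sum>b\<in>Basis. ((y - a) \<bullet> b) * g b y)"
  proof -
    have "(\<lambda>t. ?f' (a + t *\<^sub>R (y - a)) b) integrable_on cbox 0 1" for b
      by (rule integrable_continuous, rule continuous_on_compose2[OF smooth_on_continuous[OF smooth_on_derivative[OF assms(1)]]])
        (use mem in \<open>auto intro!: continuous_intros\<close>)
    from integrable_cmul[OF this]
    show ?thesis by (subst integral_sum) (auto simp: g_def)
  qed
  finally show "f y = f a + (\<Sum>b\<in>Basis. ((y - a) \<bullet> b) * g b y)" by simp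
qed

section \<open>Smooth functions and tangent vectors on a manifold\<close>

lemma chart_openin: "is_chart X U \<phi> \<Longrightarrow> openin X U"
  by (simp add: is_chart_def)

lemma chart_subset: "is_chart X U \<phi> \<Longrightarrow> U \<subseteq> topspace X"
  by (simp add: is_chart_def openin_subset)

lemma chart_inj: "is_chart X U \<phi> \<Longrightarrow> inj_on \<phi> U"
  using chart_subset[of X U \<phi>] homeomorphic_imp_injective_map[of "subtopology X U" _ \<phi>]
  by (auto simp: is_chart_def Int_absorb1)

lemma chart_preimage_open:
  assumes "is_chart X U \<phi>" "open W"
  shows "openin X {x \<in> U. \<phi> x \<in> W}"
proof -
  have "continuous_map (subtopology X U) euclidean \<phi>"
    using assms(1) homeomorphic_imp_continuous_map[of "subtopology X U" "top_of_set (\<phi> ` U)" \<phi>]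
      continuous_map_into_fulltopology[of "subtopology X U" euclidean "\<phi> ` U" \<phi>]
    by (simp add: is_chart_def)
  from openin_continuous_map_preimage[OF this, of W] assms(2)
  have "openin (subtopology X U) {x \<in> U. \<phi> x \<in> W}"
    using chart_subset[OF assms(1)] by (simp add: Int_absorb1 Collect_conj_eq Int_assoc)
  then show ?thesis by (rule openin_trans_full[OF _ chart_openin[OF assms(1)]])
qed

lemma chart_image_open:
  assumes "is_chart X U \<phi>" "openin X W" "W \<subseteq> U"
  shows "open (\<phi> ` W)"
proof -
  have "openin (subtopology X U) W" unfolding openin_subtopology using assms(2,3) by blast
  moreover have "open_map (subtopology X U) (top_of_set (\<phi> ` U)) \<phi>"
    using assms(1) homeomorphic_imp_open_map unfolding is_chart_def by blast
  ultimately have "openin (top_of_set (\<phi> ` U)) (\<phi> ` W)" by (simp add: open_map_def)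
  moreover have "open (\<phi> ` U)" using assms(1) by (simp add: is_chart_def)
  ultimately show ?thesis by (rule openin_open_trans)
qed

lemma smooth_manifold_chart:
  "smooth_manifold M \<Longrightarrow> (U, \<phi>) \<in> atlas M \<Longrightarrow> is_chart (mtop M) U \<phi>"
  by (auto simp: smooth_manifold_def)

lemma smooth_manifold_transition:
  assumes "smooth_manifold M" "(U, \<phi>) \<in> atlas M" "(V, \<psi>) \<in> atlas M"
  shows "smooth_on (\<phi> ` (U \<inter> V)) (\<psi> \<circ> inv_into U \<phi>)"
proof -
  have "\<forall>(U, \<phi>)\<in>atlas M. \<forall>(V, \<psi>)\<in>atlas M. smooth_on (\<phi> ` (U \<inter> V)) (\<psi> \<circ> inv_into U \<phi>)"
    using assms(1) unfolding smooth_manifold_def by (elim conjE)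
  from bspec[OF this assms(2)] show ?thesis using assms(3) by fast
qed

lemma smooth_manifold_chart_at:
  assumes "smooth_manifold M" "p \<in> topspace (mtop M)"
  obtains U \<phi> where "(U, \<phi>) \<in> atlas M" "p \<in> U"
proof -
  have "p \<in> \<Union> (fst ` atlas M)" using assms by (simp add: smooth_manifold_def)
  then show ?thesis using that by auto
qed

section \<open>Smoothness at a point and gluing\<close>

definition smooth_at ::
  "('a, 'e::euclidean_space) manifold \<Rightarrow> ('a \<Rightarrow> 'b::real_normed_vector) \<Rightarrow> 'a \<Rightarrow> bool" where
  "smooth_at M f p \<longleftrightarrow> (\<exists>(U, \<phi>)\<in>atlas M. p \<in> U \<and>
     (\<exists>W. open W \<and> \<phi> p \<in> W \<and> W \<subseteq> \<phi> ` U \<and> smooth_on W (f \<circ> inv_into U \<phi>)))"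

text \<open>The transition map carries smoothness over to the new chart. The definition offers some
  chart at \<open>p\<close>, while operations on two functions need a common one.\<close>

lemma smooth_at_chart:
  assumes "smooth_manifold M" "smooth_at M f p" "(V, \<psi>) \<in> atlas M" "p \<in> V"
  obtains W where "open W" "\<psi> p \<in> W" "W \<subseteq> \<psi> ` V" "smooth_on W (f \<circ> inv_into V \<psi>)"
proof -
  obtain U \<phi> W0 where U: "(U, \<phi>) \<in> atlas M" "p \<in> U" and W0: "open W0" "\<phi> p \<in> W0" "W0 \<subseteq> \<phi> ` U"
    "smooth_on W0 (f \<circ> inv_into U \<phi>)"
    using assms(2) unfolding smooth_at_def by blast
  note cU = smooth_manifold_chart[OF assms(1) U(1)] and cV = smooth_manifold_chart[OF assms(1,3)]
  define Q where "Q = {x \<in> U. \<phi> x \<in> W0} \<inter> V"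
  have Q: "openin (mtop M) Q"
    unfolding Q_def by (intro openin_Int chart_preimage_open[OF cU] W0 chart_openin[OF cV])
  have oQ: "open (\<psi> ` Q)" by (rule chart_image_open[OF cV Q]) (simp add: Q_def)
  have tr: "smooth_on (\<psi> ` (V \<inter> U)) (\<phi> \<circ> inv_into V \<psi>)"
    by (rule smooth_manifold_transition[OF assms(1,3) U(1)])
  have inv: "inv_into V \<psi> (\<psi> x) = x" if "x \<in> Q" for x
    using chart_inj[OF cV] that by (simp add: Q_def)
  have invU: "inv_into U \<phi> (\<phi> x) = x" if "x \<in> Q" for x
    using chart_inj[OF cU] that by (simp add: Q_def)
  have "smooth_on (\<psi> ` Q) (\<lambda>y. (f \<circ> inv_into U \<phi>) ((\<phi> \<circ> inv_into V \<psi>) y))"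
    by (rule smooth_on_compose[OF oQ _ smooth_on_subset[OF tr] W0(4)]) (auto simp: inv, auto simp: Q_def)
  then have "smooth_on (\<psi> ` Q) (f \<circ> inv_into V \<psi>)"
    by (rule smooth_on_cong[OF oQ, rotated]) (auto simp: inv invU)
  then show thesis using that[OF oQ] U W0 assms(4) by (auto simp: Q_def)
qed

lemma smooth_at_cong:
  assumes "smooth_manifold M" "smooth_at M f p" "openin (mtop M) Q" "p \<in> Q" "\<And>x. x \<in> Q \<Longrightarrow> f x = g x"
  shows "smooth_at M g p"
proof -
  have "p \<in> topspace (mtop M)" using assms(3,4) openin_subset by blast
  then obtain U \<phi> where U: "(U, \<phi>) \<in> atlas M" "p \<in> U" using smooth_manifold_chart_at[OF assms(1)] by blast
  note c = smooth_manifold_chart[OF assms(1) U(1)]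
  obtain W where W: "open W" "\<phi> p \<in> W" "W \<subseteq> \<phi> ` U" "smooth_on W (f \<circ> inv_into U \<phi>)"
    using smooth_at_chart[OF assms(1,2) U] by blast
  have o: "open (W \<inter> \<phi> ` (U \<inter> Q))"
    by (intro open_Int W(1) chart_image_open[OF c] openin_Int chart_openin[OF c] assms(3)) simp
  have "smooth_on (W \<inter> \<phi> ` (U \<inter> Q)) (g \<circ> inv_into U \<phi>)"
    by (rule smooth_on_cong[OF o _ smooth_on_subset[OF W(4)]]) (auto simp: assms(5) chart_inj[OF c])
  then show ?thesis unfolding smooth_at_def using U o W assms(4) by blast
qed

lemma smooth_functions_iff:
  assumes "smooth_manifold M"
  shows "f \<in> smooth_functions M \<longleftrightarrow>
    (\<forall>x. x \<notin> topspace (mtop M) \<longrightarrow> f x = 0) \<and> (\<forall>p\<in>topspace (mtop M). smooth_at M f p)"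
proof -
  have "(\<forall>(U, \<phi>)\<in>atlas M. smooth_on (\<phi> ` U) (f \<circ> inv_into U \<phi>)) \<longleftrightarrow>
     (\<forall>p\<in>topspace (mtop M). smooth_at M f p)" (is "?L \<longleftrightarrow> ?R")
  proof
    assume L: ?L
    show ?R
    proof
      fix p assume "p \<in> topspace (mtop M)"
      then obtain U \<phi> where U: "(U, \<phi>) \<in> atlas M" "p \<in> U" using smooth_manifold_chart_at[OF assms(1)] by blast
      have "open (\<phi> ` U)" using smooth_manifold_chart[OF assms U(1)] by (simp add: is_chart_def)
      then show "smooth_at M f p" unfolding smooth_at_def using U L by blast
    qed
  next
    assume R: ?R
    have "smooth_on (\<phi> ` U) (f \<circ> inv_into U \<phi>)" if U: "(U, \<phi>) \<in> atlas M" for U \<phi>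
    proof (rule smooth_on_local)
      fix y assume "y \<in> \<phi> ` U"
      then obtain p where p: "p \<in> U" "y = \<phi> p" by blast
      then have "smooth_at M f p" using R chart_subset[OF smooth_manifold_chart[OF assms U]] by blast
      from smooth_at_chart[OF assms this U p(1)] p(2)
      show "\<exists>T. open T \<and> y \<in> T \<and> smooth_on T (f \<circ> inv_into U \<phi>)" by metis
    qed
    then show ?L by blast
  qed
  then show ?thesis by (auto simp: smooth_functions_def)
qed

lemma smooth_at_topspace: "smooth_manifold M \<Longrightarrow> smooth_at M f p \<Longrightarrow> p \<in> topspace (mtop M)"
  unfolding smooth_at_def using chart_subset smooth_manifold_chart by blast

lemma smooth_functions_smooth_at:
  "smooth_manifold M \<Longrightarrow> f \<in> smooth_functions M \<Longrightarrow> p \<in> topspace (mtop M) \<Longrightarrow> smooth_at M f p"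
  by (simp add: smooth_functions_iff)

lemma smooth_functions_off: "f \<in> smooth_functions M \<Longrightarrow> x \<notin> topspace (mtop M) \<Longrightarrow> f x = 0"
  by (simp add: smooth_functions_def)

lemma smooth_at_const:
  assumes "smooth_manifold M" "p \<in> topspace (mtop M)"
  shows "smooth_at M (\<lambda>x. c) p"
proof -
  obtain U \<phi> where U: "(U, \<phi>) \<in> atlas M" "p \<in> U"
    using smooth_manifold_chart_at[OF assms] by blast
  then have "open (\<phi> ` U)" using smooth_manifold_chart[OF assms(1)] by (simp add: is_chart_def)
  then have "smooth_on (\<phi> ` U) ((\<lambda>x. c) \<circ> inv_into U \<phi>)"
    by (simp add: o_def smooth_on_const)
  then show ?thesis unfolding smooth_at_def using U \<open>open (\<phi> ` U)\<close> by blast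
qed

lemma smooth_at_linear:
  assumes "bounded_linear L" "smooth_at M f p"
  shows "smooth_at M (\<lambda>x. L (f x)) p"
  using assms(2) smooth_on_linear[OF assms(1)] unfolding smooth_at_def o_def by blast

text \<open>The operation enters only through its preservation of smoothness on open sets of the
  model space, which covers sums and bilinear products at once.\<close>

lemma smooth_at_binary:
  fixes B :: "'b::real_normed_vector \<Rightarrow> 'c::real_normed_vector \<Rightarrow> 'd::real_normed_vector"
    and M :: "('a, 'e::euclidean_space) manifold"
  assumes "smooth_manifold M" "smooth_at M f p" "smooth_at M g p"
    and B: "\<And>W (f' :: 'e \<Rightarrow> 'b) (g' :: 'e \<Rightarrow> 'c). open W \<Longrightarrow> smooth_on W f' \<Longrightarrow> smooth_on W g' \<Longrightarrow> smooth_on W (\<lambda>x. B (f' x) (g' x))"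
  shows "smooth_at M (\<lambda>x. B (f x) (g x)) p"
proof -
  obtain U \<phi> where U: "(U, \<phi>) \<in> atlas M" "p \<in> U"
    using smooth_manifold_chart_at[OF assms(1) smooth_at_topspace[OF assms(1,2)]] by blast
  obtain W where W: "open W" "\<phi> p \<in> W" "W \<subseteq> \<phi> ` U" "smooth_on W (f \<circ> inv_into U \<phi>)"
    using smooth_at_chart[OF assms(1,2) U] by blast
  obtain W' where W': "open W'" "\<phi> p \<in> W'" "W' \<subseteq> \<phi> ` U" "smooth_on W' (g \<circ> inv_into U \<phi>)"
    using smooth_at_chart[OF assms(1,3) U] by blast
  have "smooth_on (W \<inter> W') ((\<lambda>x. B (f x) (g x)) \<circ> inv_into U \<phi>)"
    using B[OF open_Int[OF W(1) W'(1)] smooth_on_subset[OF W(4)] smooth_on_subset[OF W'(4)]]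
    by (simp add: o_def)
  then show ?thesis unfolding smooth_at_def using U W W' by blast
qed

lemmas smooth_at_add = smooth_at_binary[where B = "(+)", OF _ _ _ smooth_on_add]

lemma smooth_at_bilinear:
  assumes "smooth_manifold M" "bounded_bilinear B" "smooth_at M f p" "smooth_at M g p"
  shows "smooth_at M (\<lambda>x. B (f x) (g x)) p"
  by (rule smooth_at_binary[OF assms(1,3,4)]) (rule smooth_on_bilinear[OF assms(2)])

lemma smooth_functions_linear:
  assumes "smooth_manifold M" "bounded_linear L" "f \<in> smooth_functions M"
  shows "(\<lambda>x. L (f x)) \<in> smooth_functions M"
  using assms by (auto simp: smooth_functions_iff smooth_at_linear linear_0 bounded_linear.linear)

lemma smooth_functions_add:
  assumes "smooth_manifold M" "f \<in> smooth_functions M" "g \<in> smooth_functions M"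
  shows "(\<lambda>x. f x + g x) \<in> smooth_functions M"
  using assms by (auto simp: smooth_functions_iff smooth_at_add)

lemma smooth_functions_bilinear:
  assumes "smooth_manifold M" "bounded_bilinear B" "f \<in> smooth_functions M" "g \<in> smooth_functions M"
  shows "(\<lambda>x. B (f x) (g x)) \<in> smooth_functions M"
  using assms by (auto simp: smooth_functions_iff smooth_at_bilinear bounded_bilinear.zero_left)

lemmas smooth_functions_mult = smooth_functions_bilinear[OF _ bounded_bilinear_mult]

lemma smooth_functions_cmult:
  fixes c :: real
  shows "smooth_manifold M \<Longrightarrow> f \<in> smooth_functions M \<Longrightarrow> (\<lambda>x. c * f x) \<in> smooth_functions M"
  by (rule smooth_functions_linear[OF _ bounded_linear_mult_right])

lemma smooth_functions_zero: "smooth_manifold M \<Longrightarrow> (\<lambda>x. 0) \<in> smooth_functions M"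
  by (simp add: smooth_functions_iff smooth_at_const)

lemma smooth_functions_sum:
  assumes "smooth_manifold M" "\<And>i. i \<in> A \<Longrightarrow> f i \<in> smooth_functions M"
  shows "(\<lambda>x. \<Sum>i\<in>A. f i x) \<in> smooth_functions M"
  using assms(2)
  by (induction A rule: infinite_finite_induct)
    (auto simp: smooth_functions_zero[OF assms(1)] smooth_functions_add[OF assms(1)])

lemma smooth_functions_const:
  assumes "smooth_manifold M"
  shows "(\<lambda>x. if x \<in> topspace (mtop M) then c else 0) \<in> smooth_functions M"
  unfolding smooth_functions_iff[OF assms]
  by (auto intro!: smooth_at_cong[OF assms smooth_at_const[OF assms, where c = c] openin_topspace])

text \<open>\<open>Q\<close> and the complement of \<open>C\<close> cover the space; the product is
  smooth on the first and constantly zero on the second, which is open because \<open>C\<close> is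
  closed.\<close>

lemma smooth_functions_extend:
  fixes f :: "'a \<Rightarrow> 'b::real_normed_vector"
  assumes M: "smooth_manifold M" and \<rho>: "\<rho> \<in> smooth_functions M"
    and C: "closedin (mtop M) C" "C \<subseteq> Q" "\<And>x. x \<notin> C \<Longrightarrow> \<rho> x = 0"
    and Q: "openin (mtop M) Q" and f: "\<And>x. x \<in> Q \<Longrightarrow> smooth_at M f x"
  shows "(\<lambda>x. if x \<in> Q then \<rho> x *\<^sub>R f x else 0) \<in> smooth_functions M"
  unfolding smooth_functions_iff[OF M]
proof (intro conjI allI impI ballI)
  fix x assume "x \<notin> topspace (mtop M)"
  then show "(if x \<in> Q then \<rho> x *\<^sub>R f x else 0) = 0" using openin_subset[OF Q] by auto
next
  fix x assume x: "x \<in> topspace (mtop M)"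
  show "smooth_at M (\<lambda>x. if x \<in> Q then \<rho> x *\<^sub>R f x else 0) x"
  proof (cases "x \<in> Q")
    case True
    have "smooth_at M (\<lambda>x. \<rho> x *\<^sub>R f x) x"
      by (rule smooth_at_bilinear[OF M bounded_bilinear_scaleR smooth_functions_smooth_at[OF M \<rho> x] f[OF True]])
    then show ?thesis by (rule smooth_at_cong[OF M _ Q True]) simp
  next
    case False
    have "openin (mtop M) (topspace (mtop M) - C)" using C(1) by blast
    then show ?thesis
      by (rule smooth_at_cong[OF M smooth_at_const[OF M x]]) (use x False C in auto)
  qed
qed

text \<open>The preimage of a closed ball in a chart is compact, and the Hausdorff property makes it
  closed in \<open>M\<close>; without this the extension by zero could fail to be smooth.
  \<open>C\<close> is returned along with \<open>\<rho>\<close> for use in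
  \<open>smooth_functions_extend\<close>.\<close>

lemma bump_function:
  assumes M: "smooth_manifold M" and Q: "openin (mtop M) Q" "p \<in> Q"
  obtains \<rho> :: "'a \<Rightarrow> real" and Q' C where "\<rho> \<in> smooth_functions (M :: ('a, 'e::euclidean_space) manifold)"
    "openin (mtop M) Q'" "p \<in> Q'" "Q' \<subseteq> C" "closedin (mtop M) C" "C \<subseteq> Q"
    "\<And>x. x \<in> Q' \<Longrightarrow> \<rho> x = 1" "\<And>x. x \<notin> C \<Longrightarrow> \<rho> x = 0"
proof -
  have "p \<in> topspace (mtop M)" using Q openin_subset by blast
  then obtain U \<phi> where U: "(U, \<phi>) \<in> atlas M" "p \<in> U" using smooth_manifold_chart_at[OF M] by blast
  note c = smooth_manifold_chart[OF M U(1)]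
  have "open (\<phi> ` (U \<inter> Q))"
    by (intro chart_image_open[OF c] openin_Int chart_openin[OF c] Q(1)) simp
  then obtain r where r: "r > 0" "cball (\<phi> p) r \<subseteq> \<phi> ` (U \<inter> Q)"
    using U Q unfolding open_contains_cball by blast
  obtain b where b: "smooth_on UNIV b" "\<And>x. dist (\<phi> p) x \<le> r / 2 \<Longrightarrow> b x = (1::real)"
    "\<And>x. dist (\<phi> p) x \<ge> r \<Longrightarrow> b x = 0"
    using smooth_bump[OF r(1)] by metis
  define C where "C = {x \<in> U. \<phi> x \<in> cball (\<phi> p) r}"
  have CQ: "C \<subseteq> Q"
  proof
    fix x assume x: "x \<in> C"
    then obtain y where "y \<in> U \<inter> Q" "\<phi> x = \<phi> y" using r(2) unfolding C_def by blast
    then show "x \<in> Q" using chart_inj[OF c] x unfolding C_def inj_on_def by blast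
  qed
  have im: "\<phi> ` C = cball (\<phi> p) r" using r(2) unfolding C_def by auto
  have "compactin (top_of_set (\<phi> ` U)) (cball (\<phi> p) r)"
    using r(2) by (auto simp: compactin_subtopology)
  then have "compactin (subtopology (mtop M) U) C"
    using homeomorphic_map_compactness[of "subtopology (mtop M) U" _ \<phi> C] c chart_subset[OF c]
    unfolding is_chart_def im by (auto simp: C_def)
  then have "compactin (mtop M) C" by (simp add: compactin_subtopology)
  then have C: "closedin (mtop M) C"
    using M compactin_imp_closedin unfolding smooth_manifold_def by blast
  define \<rho> where "\<rho> x = (if x \<in> U then b (\<phi> x) else 0)" for x
  have off: "\<rho> x = 0" if "x \<notin> C" for x
    using that b(3) by (auto simp: \<rho>_def C_def)
  define Q' where "Q' = {x \<in> U. \<phi> x \<in> ball (\<phi> p) (r / 2)}"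
  have "smooth_at M \<rho> x" if x: "x \<in> topspace (mtop M)" for x
  proof (cases "x \<in> U")
    case True
    have o: "open (\<phi> ` U)" using c by (simp add: is_chart_def)
    have "smooth_on (\<phi> ` U) (\<rho> \<circ> inv_into U \<phi>)"
      by (rule smooth_on_cong[OF o _ smooth_on_subset[OF b(1)]]) (auto simp: \<rho>_def chart_inj[OF c])
    then show ?thesis unfolding smooth_at_def using U True o by blast
  next
    case False
    have "openin (mtop M) (topspace (mtop M) - C)" using C by blast
    then show ?thesis
      by (rule smooth_at_cong[OF M smooth_at_const[OF M x]]) (use x False off in \<open>auto simp: C_def\<close>)
  qed
  then have "\<rho> \<in> smooth_functions M"
    using chart_subset[OF c] by (auto simp: smooth_functions_iff[OF M] \<rho>_def)
  moreover have "openin (mtop M) Q'" unfolding Q'_def by (rule chart_preimage_open[OF c open_ball])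
  moreover have "p \<in> Q'" "Q' \<subseteq> C" using U r by (auto simp: Q'_def C_def)
  moreover have "\<rho> x = 1" if "x \<in> Q'" for x using that b(2) by (auto simp: \<rho>_def Q'_def)
  ultimately show thesis using that[of \<rho> Q' C] C CQ off by blast
qed

section \<open>Tangent vectors as derivations at a point\<close>

definition point_derivation ::
  "('a, 'e::euclidean_space) manifold \<Rightarrow> 'a \<Rightarrow> (('a \<Rightarrow> real) \<Rightarrow> real) \<Rightarrow> bool" where
  "point_derivation M p v \<longleftrightarrow>
     (\<forall>f\<in>smooth_functions M. \<forall>g\<in>smooth_functions M. v (\<lambda>x. f x + g x) = v f + v g) \<and>
     (\<forall>c. \<forall>f\<in>smooth_functions M. v (\<lambda>x. c * f x) = c * v f) \<and>
     (\<forall>f\<in>smooth_functions M. \<forall>g\<in>smooth_functions M. v (\<lambda>x. f x * g x) = v f * g p + f p * v g)"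

lemma point_derivation_add:
  "point_derivation M p v \<Longrightarrow> f \<in> smooth_functions M \<Longrightarrow> g \<in> smooth_functions M \<Longrightarrow>
     v (\<lambda>x. f x + g x) = v f + v g"
  by (simp add: point_derivation_def)

lemma point_derivation_cmult:
  "point_derivation M p v \<Longrightarrow> f \<in> smooth_functions M \<Longrightarrow> v (\<lambda>x. c * f x) = c * v f"
  by (simp add: point_derivation_def)

lemma point_derivation_mult:
  "point_derivation M p v \<Longrightarrow> f \<in> smooth_functions M \<Longrightarrow> g \<in> smooth_functions M \<Longrightarrow>
     v (\<lambda>x. f x * g x) = v f * g p + f p * v g"
  by (simp add: point_derivation_def)

lemma vector_field_smooth:
  "X \<in> vector_fields M \<Longrightarrow> f \<in> smooth_functions M \<Longrightarrow> X f \<in> smooth_functions M"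
  by (simp add: vector_fields_def)

lemma vector_field_point_derivation:
  "X \<in> vector_fields M \<Longrightarrow> point_derivation M p (\<lambda>f. X f p)"
  by (simp add: vector_fields_def point_derivation_def)

text \<open>With a bump \<open>\<rho>\<close> inside \<open>Q\<close>, the products
  \<open>\<rho> f\<close> and \<open>\<rho> g\<close> are the same global function. Apply the
  Leibniz rule and cancel, using \<open>f p = g p\<close>.\<close>

lemma point_derivation_local:
  assumes M: "smooth_manifold M" and v: "point_derivation M p v"
    and fg: "f \<in> smooth_functions M" "g \<in> smooth_functions M"
    and Q: "openin (mtop M) Q" "p \<in> Q" "\<And>x. x \<in> Q \<Longrightarrow> f x = g x"
  shows "v f = v g"
proof -
  obtain \<rho> Q' C where \<rho>: "\<rho> \<in> smooth_functions M" "p \<in> Q'" "Q' \<subseteq> C" "C \<subseteq> Q"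
    "\<And>x. x \<in> Q' \<Longrightarrow> \<rho> x = 1" "\<And>x. x \<notin> C \<Longrightarrow> \<rho> x = (0::real)"
    by (rule bump_function[OF M Q(1,2)]) blast
  have "(\<lambda>x. \<rho> x * f x) = (\<lambda>x. \<rho> x * g x)" using \<rho> Q by fastforce
  then have "v \<rho> * f p + \<rho> p * v f = v \<rho> * g p + \<rho> p * v g"
    using v \<rho>(1) fg unfolding point_derivation_def by metis
  then show ?thesis using \<rho> Q by simp
qed

lemma point_derivation_sum:
  assumes "smooth_manifold M" "point_derivation M p v" "\<And>i. i \<in> A \<Longrightarrow> f i \<in> smooth_functions M"
  shows "v (\<lambda>x. \<Sum>i\<in>A. f i x) = (\<Sum>i\<in>A. v (f i))"
proof -
  have z: "v (\<lambda>x. 0) = 0"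
    using point_derivation_cmult[OF assms(2) smooth_functions_zero[OF assms(1)], of 0] by simp
  show ?thesis
    using assms(3)
  proof (induction A rule: infinite_finite_induct)
    case (insert i A)
    then show ?case
      using assms(2) smooth_functions_sum[OF assms(1), of A f] unfolding point_derivation_def by simp
  qed (simp_all add: z)
qed

text \<open>This is the Leibniz rule for \<open>1 * 1 = 1\<close>. The constant is cut off outside
  the space, where smooth functions vanish by convention.\<close>

lemma point_derivation_const:
  assumes M: "smooth_manifold M" and v: "point_derivation M p v" and p: "p \<in> topspace (mtop M)"
  shows "v (\<lambda>x. if x \<in> topspace (mtop M) then c else 0) = 0"
proof -
  let ?one = "\<lambda>x. if x \<in> topspace (mtop M) then (1::real) else 0"
  have s: "?one \<in> smooth_functions M" by (rule smooth_functions_const[OF M])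
  have "v (\<lambda>x. ?one x * ?one x) = v ?one * ?one p + ?one p * v ?one"
    by (rule point_derivation_mult[OF v s s])
  moreover have "(\<lambda>x. ?one x * ?one x) = ?one" by auto
  ultimately have z: "v ?one = 0" using p by simp
  have "(\<lambda>x. if x \<in> topspace (mtop M) then c else 0) = (\<lambda>x. c * ?one x)" by auto
  then show ?thesis using v s z unfolding point_derivation_def by auto
qed


section \<open>Algebra of vector fields and tensoriality\<close>

lemma vf_add_vector_field:
  assumes M: "smooth_manifold M" and "X \<in> vector_fields M" "Y \<in> vector_fields M"
  shows "vf_add X Y \<in> vector_fields M"
  using assms(2,3) smooth_functions_add[OF M]
  by (auto simp: vector_fields_def vf_add_def fun_eq_iff algebra_simps)

lemma vf_scale_vector_field:
  assumes M: "smooth_manifold M" and "h \<in> smooth_functions M" "X \<in> vector_fields M"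
  shows "vf_scale h X \<in> vector_fields M"
  using assms(2,3)
  by (auto simp: vector_fields_def vf_scale_def fun_eq_iff distrib_left mult.left_commute mult.assoc
      intro: smooth_functions_mult[OF M])

lemma zero_vector_field: "smooth_manifold M \<Longrightarrow> (\<lambda>f x. 0) \<in> vector_fields M"
  by (simp add: vector_fields_def smooth_functions_zero)

lemma vf_sum_vector_field:
  assumes M: "smooth_manifold M" and "\<And>i. i \<in> A \<Longrightarrow> X i \<in> vector_fields M"
  shows "(\<lambda>f x. \<Sum>i\<in>A. X i f x) \<in> vector_fields M"
  using assms(2)
proof (induction A rule: infinite_finite_induct)
  case (insert i A)
  then have "vf_add (X i) (\<lambda>f x. \<Sum>i\<in>A. X i f x) \<in> vector_fields M"
    by (intro vf_add_vector_field[OF M]) auto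
  then show ?case using insert by (simp add: vf_add_def)
qed (simp_all add: zero_vector_field[OF M])

text \<open>Tensoriality at \<open>p\<close>, i.e. dependence on the value of a field at \<open>p\<close> only (lemma \<open>pointlinear_cong\<close>).\<close>

definition pointlinear ::
  "('a, 'e::euclidean_space) manifold \<Rightarrow> 'a \<Rightarrow> ('a vfield \<Rightarrow> 'v::real_vector) \<Rightarrow> bool" where
  "pointlinear M p A \<longleftrightarrow>
     (\<forall>X\<in>vector_fields M. \<forall>Y\<in>vector_fields M. A (vf_add X Y) = A X + A Y) \<and>
     (\<forall>h\<in>smooth_functions M. \<forall>X\<in>vector_fields M. A (vf_scale h X) = h p *\<^sub>R A X)"

lemma pointlinear_add:
  "pointlinear M p A \<Longrightarrow> X \<in> vector_fields M \<Longrightarrow> Y \<in> vector_fields M \<Longrightarrow> A (vf_add X Y) = A X + A Y"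
  by (simp add: pointlinear_def)

lemma pointlinear_scale:
  "pointlinear M p A \<Longrightarrow> h \<in> smooth_functions M \<Longrightarrow> X \<in> vector_fields M \<Longrightarrow> A (vf_scale h X) = h p *\<^sub>R A X"
  by (simp add: pointlinear_def)

lemma pointlinear_sum:
  fixes M :: "('a, 'e::euclidean_space) manifold"
  assumes M: "smooth_manifold M" and A: "pointlinear M p A"
    and "\<And>i. i \<in> S \<Longrightarrow> X i \<in> vector_fields M"
  shows "A (\<lambda>f x. \<Sum>i\<in>S. X i f x) = (\<Sum>i\<in>S. A (X i))"
proof -
  have "vf_scale (\<lambda>x. 0) (\<lambda>f x. 0) = (\<lambda>(f :: 'a \<Rightarrow> real) x. 0)" by (simp add: vf_scale_def)
  then have z: "A (\<lambda>f x. 0) = 0"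
    using pointlinear_scale[OF A smooth_functions_zero[OF M] zero_vector_field[OF M]] by simp
  show ?thesis
    using assms(3)
  proof (induction S rule: infinite_finite_induct)
    case (insert i S)
    have "A (vf_add (X i) (\<lambda>f x. \<Sum>i\<in>S. X i f x)) = A (X i) + A (\<lambda>f x. \<Sum>i\<in>S. X i f x)"
      using insert by (intro pointlinear_add[OF A] vf_sum_vector_field[OF M]) auto
    then show ?case using insert by (simp add: vf_add_def)
  qed (simp_all add: z)
qed

text \<open>Data for coordinates near \<open>p\<close>: a ball in a chart, because Hadamard's lemma
  needs convexity; a cut-off function vanishing off a closed \<open>C\<close> inside its preimage;
  and an open \<open>Q\<close> on which the cut-off is 1, so that cut-off coordinates are true
  coordinates there.\<close>

locale bump_chart =
  fixes M :: "('a, 'e::euclidean_space) manifold" and U \<phi> p r and \<rho> :: "'a \<Rightarrow> real" and Q C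
  assumes M: "smooth_manifold M" and chart: "(U, \<phi>) \<in> atlas M"
    and ball_image: "ball (\<phi> p) r \<subseteq> \<phi> ` U"
    and Q: "openin (mtop M) Q" "p \<in> Q" "Q \<subseteq> C"
    and C: "closedin (mtop M) C" "C \<subseteq> {x \<in> U. \<phi> x \<in> ball (\<phi> p) r}"
    and \<rho>: "\<rho> \<in> smooth_functions M" "\<And>x. x \<in> Q \<Longrightarrow> \<rho> x = 1" "\<And>x. x \<notin> C \<Longrightarrow> \<rho> x = 0"

lemma bump_chart_exists:
  fixes M :: "('a, 'e::euclidean_space) manifold"
  assumes M: "smooth_manifold M" and p: "p \<in> topspace (mtop M)"
  obtains U \<phi> r \<rho> Q C where "bump_chart M U \<phi> p r \<rho> Q C"
proof -
  obtain U \<phi> where U: "(U, \<phi>) \<in> atlas M" "p \<in> U" using smooth_manifold_chart_at[OF M p] by blast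
  note c = smooth_manifold_chart[OF M U(1)]
  have "open (\<phi> ` U)" using c by (simp add: is_chart_def)
  then obtain r where r: "r > 0" "ball (\<phi> p) r \<subseteq> \<phi> ` U"
    using U(2) open_contains_ball by blast
  have "openin (mtop M) {x \<in> U. \<phi> x \<in> ball (\<phi> p) r}" by (rule chart_preimage_open[OF c open_ball])
  moreover have "p \<in> {x \<in> U. \<phi> x \<in> ball (\<phi> p) r}" using U r by simp
  ultimately obtain \<rho> :: "'a \<Rightarrow> real" and Q C where "\<rho> \<in> smooth_functions M"
    "openin (mtop M) Q" "p \<in> Q" "Q \<subseteq> C" "closedin (mtop M) C" "C \<subseteq> {x \<in> U. \<phi> x \<in> ball (\<phi> p) r}"
    "\<And>x. x \<in> Q \<Longrightarrow> \<rho> x = 1" "\<And>x. x \<notin> C \<Longrightarrow> \<rho> x = 0"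
    by (rule bump_function[OF M]) blast
  then show thesis using that[of U \<phi> r \<rho> Q C] M U r unfolding bump_chart_def by blast
qed

context bump_chart
begin

lemma chart_is_chart: "is_chart (mtop M) U \<phi>"
  by (rule smooth_manifold_chart[OF M chart])

definition "cell = {x \<in> U. \<phi> x \<in> ball (\<phi> p) r}"

definition cut :: "('e \<Rightarrow> real) \<Rightarrow> 'a \<Rightarrow> real" where
  "cut g = (\<lambda>x. if x \<in> cell then \<rho> x *\<^sub>R g (\<phi> x) else 0)"

definition local_rep :: "('a \<Rightarrow> real) \<Rightarrow> 'e \<Rightarrow> real" where
  "local_rep f = (\<lambda>y. f (inv_into U \<phi> y))"

text \<open>The constant coordinate field in direction \<open>e\<close>, damped by
  \<open>\<rho>\<close> to become global; the zero branch is the normalisation that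
  \<open>vector_fields\<close> demands.\<close>

definition coord_field :: "'e \<Rightarrow> 'a vfield" where
  "coord_field e f = (if f \<in> smooth_functions M
     then cut (\<lambda>y. frechet_derivative (local_rep f) (at y) e) else (\<lambda>x. 0))"

text \<open>Identifies derivations at \<open>p\<close> with vectors of the model space; taking
  \<open>coord_field\<close> at \<open>p\<close> is the inverse.\<close>

definition tangent_coord :: "(('a \<Rightarrow> real) \<Rightarrow> real) \<Rightarrow> 'e" where
  "tangent_coord v = (\<Sum>b\<in>Basis. v (cut (\<lambda>y. y \<bullet> b)) *\<^sub>R b)"

lemma cell_open: "openin (mtop M) cell"
  unfolding cell_def by (rule chart_preimage_open[OF chart_is_chart open_ball])

lemma Q_cell: "Q \<subseteq> cell"
  using Q C unfolding cell_def by blast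

lemma local_rep_chart: "x \<in> cell \<Longrightarrow> local_rep f (\<phi> x) = f x"
  using chart_inj[OF chart_is_chart] by (simp add: local_rep_def cell_def)

lemma local_rep_smooth:
  assumes "f \<in> smooth_functions M"
  shows "smooth_on (ball (\<phi> p) r) (local_rep f)"
proof -
  have "\<forall>(U, \<phi>)\<in>atlas M. smooth_on (\<phi> ` U) (f \<circ> inv_into U \<phi>)"
    using assms by (simp add: smooth_functions_def)
  from bspec[OF this chart] have "smooth_on (\<phi> ` U) (local_rep f)"
    by (simp add: local_rep_def o_def)
  then show ?thesis using ball_image by (rule smooth_on_subset)
qed

lemma cut_smooth:
  assumes "smooth_on (ball (\<phi> p) r) g"
  shows "cut g \<in> smooth_functions M"
  unfolding cut_def
proof (rule smooth_functions_extend[OF M \<rho>(1) C(1) _ \<rho>(3) cell_open])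
  show "C \<subseteq> cell" using C(2) by (simp add: cell_def)
  fix x assume x: "x \<in> cell"
  have "smooth_on (ball (\<phi> p) r) ((\<lambda>x. g (\<phi> x)) \<circ> inv_into U \<phi>)"
    by (rule smooth_on_cong[OF open_ball _ assms])
      (use ball_image in \<open>auto simp: f_inv_into_f subset_iff\<close>)
  then show "smooth_at M (\<lambda>x. g (\<phi> x)) x"
    unfolding smooth_at_def using chart x ball_image open_ball[of "\<phi> p" r] unfolding cell_def by blast
qed

lemma coordinate_cut_smooth: "cut (\<lambda>y. y \<bullet> b) \<in> smooth_functions M"
  by (intro cut_smooth smooth_on_linear[OF bounded_linear_inner_left] smooth_on_ident open_ball)

lemma coord_field_vector_field: "coord_field e \<in> vector_fields M"
proof -
  have D: "(local_rep f has_derivative frechet_derivative (local_rep f) (at y)) (at y)"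
    if "f \<in> smooth_functions M" "y \<in> ball (\<phi> p) r" for f y
    by (rule smooth_on_has_derivative[OF local_rep_smooth[OF that(1)] that(2)])
  have add: "coord_field e (\<lambda>x. f x + g x) = (\<lambda>x. coord_field e f x + coord_field e g x)"
    if fg: "f \<in> smooth_functions M" "g \<in> smooth_functions M" for f g
  proof -
    have "frechet_derivative (local_rep (\<lambda>x. f x + g x)) (at y) e =
        frechet_derivative (local_rep f) (at y) e + frechet_derivative (local_rep g) (at y) e"
      if "y \<in> ball (\<phi> p) r" for y
      using fun_cong[OF frechet_derivative_at[OF has_derivative_add[OF D[OF fg(1) that] D[OF fg(2) that]]], of e]
      unfolding local_rep_def by (rule sym)
    then show ?thesis
      using fg smooth_functions_add[OF M fg]
      by (auto simp: coord_field_def cut_def fun_eq_iff algebra_simps cell_def)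
  qed
  have scale: "coord_field e (\<lambda>x. c * f x) = (\<lambda>x. c * coord_field e f x)"
    if f: "f \<in> smooth_functions M" for c f
  proof -
    have "frechet_derivative (local_rep (\<lambda>x. c * f x)) (at y) e =
        c * frechet_derivative (local_rep f) (at y) e"
      if "y \<in> ball (\<phi> p) r" for y
      using fun_cong[OF frechet_derivative_at[OF has_derivative_mult_right[OF D[OF f that], of c]], of e]
      unfolding local_rep_def by (rule sym)
    then show ?thesis
      using f smooth_functions_cmult[OF M f]
      by (auto simp: coord_field_def cut_def fun_eq_iff cell_def)
  qed
  have mult: "coord_field e (\<lambda>x. f x * g x) = (\<lambda>x. coord_field e f x * g x + f x * coord_field e g x)"
    if fg: "f \<in> smooth_functions M" "g \<in> smooth_functions M" for f g
  proof -
    have "frechet_derivative (local_rep (\<lambda>x. f x * g x)) (at y) e =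
        local_rep f y * frechet_derivative (local_rep g) (at y) e +
        frechet_derivative (local_rep f) (at y) e * local_rep g y"
      if "y \<in> ball (\<phi> p) r" for y
      using fun_cong[OF frechet_derivative_at[OF has_derivative_mult[OF D[OF fg(1) that] D[OF fg(2) that]]], of e]
      unfolding local_rep_def by (rule sym)
    then show ?thesis
      using fg smooth_functions_mult[OF M fg] local_rep_chart
      by (auto simp: coord_field_def cut_def fun_eq_iff algebra_simps cell_def)
  qed
  have "coord_field e f \<in> smooth_functions M" if "f \<in> smooth_functions M" for f
    using cut_smooth[OF smooth_on_derivative[OF local_rep_smooth[OF that]]] that
    by (simp add: coord_field_def)
  then show ?thesis
    unfolding vector_fields_def using add scale mult by (auto simp: coord_field_def)
qed

text \<open>Hadamard's lemma writes \<open>f\<close> near \<open>q\<close> as a constant plus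
  products of coordinates centred at \<open>q\<close> with smooth functions; the Leibniz rule leaves
  the derivatives of the coordinates. The point ranges over all of \<open>Q\<close> because
  \<open>pointlinear_expand\<close> compares fields on a neighbourhood and not only at
  \<open>p\<close>.\<close>

lemma point_derivation_expand:
  assumes q: "q \<in> Q" and v: "point_derivation M q v" and f: "f \<in> smooth_functions M"
  shows "v f = (\<Sum>b\<in>Basis. v (cut (\<lambda>y. y \<bullet> b)) * frechet_derivative (local_rep f) (at (\<phi> q)) b)"
proof -
  let ?T = "topspace (mtop M)"
  let ?a = "\<phi> q"
  have qc: "q \<in> cell" using q Q_cell by blast
  then have a: "?a \<in> ball (\<phi> p) r" by (simp add: cell_def)
  have qT: "q \<in> ?T" using q Q(1) openin_subset by blast
  obtain g where g: "\<And>b. smooth_on (ball (\<phi> p) r) (g b)"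
    "\<And>b. g b ?a = frechet_derivative (local_rep f) (at ?a) b"
    "\<And>y. y \<in> ball (\<phi> p) r \<Longrightarrow> local_rep f y = local_rep f ?a + (\<Sum>b\<in>Basis. ((y - ?a) \<bullet> b) * g b y)"
    by (rule hadamard_lemma[OF local_rep_smooth[OF f] a]) blast
  \<comment> \<open>On \<open>Q\<close> this is the coordinate \<open>b\<close> minus its value at
    \<open>q\<close>. The constant carries the factor \<open>\<rho>\<close>, whose derivative at
    \<open>q\<close> is 0, so that the whole is a global smooth function.\<close>
  let ?c = "\<lambda>b x. cut (\<lambda>y. y \<bullet> b) x + - (?a \<bullet> b) * \<rho> x"
  have c: "?c b \<in> smooth_functions M" for b
    by (intro smooth_functions_add[OF M] smooth_functions_cmult[OF M] \<rho>(1) coordinate_cut_smooth)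
  have gs: "cut (g b) \<in> smooth_functions M" for b by (rule cut_smooth[OF g(1)])
  let ?k = "\<lambda>x. if x \<in> ?T then f q else 0"
  have ks: "?k \<in> smooth_functions M" by (rule smooth_functions_const[OF M])
  have vr: "v \<rho> = 0"
  proof -
    have "v \<rho> = v (\<lambda>x. if x \<in> ?T then 1 else 0)"
      by (rule point_derivation_local[OF M v \<rho>(1) smooth_functions_const[OF M] Q(1) q])
        (use \<rho>(2) Q(1) openin_subset in fastforce)
    then show ?thesis using point_derivation_const[OF M v qT] by simp
  qed
  have prod: "(\<lambda>x. ?c b x * cut (g b) x) \<in> smooth_functions M" for b
    by (rule smooth_functions_mult[OF M c gs])
  have sum: "(\<lambda>x. \<Sum>b\<in>Basis. ?c b x * cut (g b) x) \<in> smooth_functions M"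
    by (rule smooth_functions_sum[OF M prod])
  have "v f = v (\<lambda>x. ?k x + (\<Sum>b\<in>Basis. ?c b x * cut (g b) x))"
  proof (rule point_derivation_local[OF M v f smooth_functions_add[OF M ks sum] Q(1) q])
    fix x assume x: "x \<in> Q"
    then have xc: "x \<in> cell" and xT: "x \<in> ?T" using Q_cell Q(1) openin_subset by blast+
    then have "\<phi> x \<in> ball (\<phi> p) r" by (simp add: cell_def)
    from g(3)[OF this] local_rep_chart[OF xc] local_rep_chart[OF qc]
    show "f x = ?k x + (\<Sum>b\<in>Basis. ?c b x * cut (g b) x)"
      using xc xT \<rho>(2)[OF x] by (simp add: cut_def inner_diff_left)
  qed
  also have "\<dots> = (\<Sum>b\<in>Basis. v (\<lambda>x. ?c b x * cut (g b) x))"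
    using point_derivation_add[OF v ks sum] point_derivation_const[OF M v qT]
      point_derivation_sum[OF M v, of Basis "\<lambda>b x. ?c b x * cut (g b) x"] prod by simp
  also have "\<dots> = (\<Sum>b\<in>Basis. v (cut (\<lambda>y. y \<bullet> b)) * frechet_derivative (local_rep f) (at ?a) b)"
  proof (rule sum.cong[OF refl])
    fix b :: 'e
    have "v (\<lambda>x. ?c b x * cut (g b) x) = v (?c b) * cut (g b) q + ?c b q * v (cut (g b))"
      by (rule point_derivation_mult[OF v c gs])
    moreover have "?c b q = 0" using \<rho>(2)[OF q] qc by (simp add: cut_def)
    moreover have "cut (g b) q = frechet_derivative (local_rep f) (at ?a) b"
      using \<rho>(2)[OF q] qc g(2) by (simp add: cut_def)
    moreover have "v (?c b) = v (cut (\<lambda>y. y \<bullet> b)) + - (?a \<bullet> b) * v \<rho>"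
      by (simp only: point_derivation_add[OF v coordinate_cut_smooth smooth_functions_cmult[OF M \<rho>(1)]]
        point_derivation_cmult[OF v \<rho>(1)])
    then have "v (?c b) = v (cut (\<lambda>y. y \<bullet> b))" using vr by simp
    ultimately show "v (\<lambda>x. ?c b x * cut (g b) x) =
        v (cut (\<lambda>y. y \<bullet> b)) * frechet_derivative (local_rep f) (at ?a) b" by simp
  qed
  finally show ?thesis .
qed

lemma p_cell: "p \<in> cell"
  using Q Q_cell by blast

lemma coord_field_at:
  "f \<in> smooth_functions M \<Longrightarrow> coord_field e f p = frechet_derivative (local_rep f) (at (\<phi> p)) e"
  using p_cell \<rho>(2)[OF Q(2)] by (simp add: coord_field_def cut_def)

text \<open>Used to extend a tangent vector at \<open>p\<close> to a global field.\<close>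

lemma point_derivation_coord_field:
  assumes v: "point_derivation M p v" and f: "f \<in> smooth_functions M"
  shows "v f = coord_field (tangent_coord v) f p"
proof -
  let ?f' = "frechet_derivative (local_rep f) (at (\<phi> p))"
  have "\<phi> p \<in> ball (\<phi> p) r" using p_cell by (simp add: cell_def)
  then have l: "linear ?f'"
    using smooth_on_has_derivative[OF local_rep_smooth[OF f]] has_derivative_linear by blast
  show ?thesis
    unfolding point_derivation_expand[OF Q(2) v f] coord_field_at[OF f] tangent_coord_def
    by (simp add: linear_sum[OF l] linear_cmul[OF l])
qed

lemma coord_field_coordinate: "coord_field e (cut (\<lambda>y. y \<bullet> b)) p = e \<bullet> b"
proof -
  have o: "open (\<phi> ` Q)"
  proof (rule chart_image_open[OF chart_is_chart Q(1)])
    show "Q \<subseteq> U" using Q_cell by (auto simp: cell_def)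
  qed
  have "((\<lambda>y. y \<bullet> b) has_derivative (\<lambda>y. y \<bullet> b)) (at (\<phi> p))"
    by (rule bounded_linear_imp_has_derivative[OF bounded_linear_inner_left])
  then have "(local_rep (cut (\<lambda>y. y \<bullet> b)) has_derivative (\<lambda>y. y \<bullet> b)) (at (\<phi> p))"
  proof (rule has_derivative_transform_within_open[OF _ o])
    show "\<phi> p \<in> \<phi> ` Q" using Q(2) by blast
    fix y assume "y \<in> \<phi> ` Q"
    then obtain x where x: "x \<in> Q" "y = \<phi> x" by blast
    then have "x \<in> cell" using Q_cell by blast
    then show "y \<bullet> b = local_rep (cut (\<lambda>y. y \<bullet> b)) y"
      using local_rep_chart[of x] x \<rho>(2) by (simp add: cut_def)
  qed
  from fun_cong[OF frechet_derivative_at[OF this], of e] show ?thesis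
    unfolding coord_field_at[OF coordinate_cut_smooth] by (rule sym)
qed

abbreviation tangent_vector :: "'a vfield \<Rightarrow> 'e" where
  "tangent_vector X \<equiv> tangent_coord (\<lambda>f. X f p)"

lemma tangent_vector_inner: "b \<in> Basis \<Longrightarrow> tangent_vector X \<bullet> b = X (cut (\<lambda>y. y \<bullet> b)) p"
  by (simp add: tangent_coord_def inner_sum_left inner_Basis if_distrib[of "\<lambda>u. _ * u"] cong: if_cong)

lemma tangent_vector_coord_field: "tangent_vector (coord_field e) = e"
  by (rule euclidean_eqI) (simp add: tangent_vector_inner coord_field_coordinate)

lemma pointlinear_tangent_vector: "pointlinear M p tangent_vector"
  by (auto simp: pointlinear_def tangent_coord_def vf_add_def vf_scale_def sum.distrib algebra_simps scaleR_sum_right)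

text \<open>After multiplication by a bump \<open>h\<close> vanishing off \<open>Q\<close>, the
  field is everywhere a combination of coordinate fields with smooth coefficients, so linearity over
  the functions applies; \<open>h p = 1\<close> removes the bump again.\<close>

lemma pointlinear_expand:
  assumes A: "pointlinear M p A" and X: "X \<in> vector_fields M"
  shows "A X = (\<Sum>b\<in>Basis. (tangent_vector X \<bullet> b) *\<^sub>R A (coord_field b))"
proof -
  obtain h :: "'a \<Rightarrow> real" and Q' C' where h: "h \<in> smooth_functions M" "p \<in> Q'" "C' \<subseteq> Q"
    "\<And>x. x \<in> Q' \<Longrightarrow> h x = 1" "\<And>x. x \<notin> C' \<Longrightarrow> h x = 0"
    by (rule bump_function[OF M Q(1,2)]) blast
  let ?h = "\<lambda>b x. h x * X (cut (\<lambda>y. y \<bullet> b)) x"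
  have hs: "?h b \<in> smooth_functions M" for b
    by (rule smooth_functions_mult[OF M h(1) vector_field_smooth[OF X coordinate_cut_smooth]])
  have "vf_scale h X = (\<lambda>f x. \<Sum>b\<in>Basis. vf_scale (?h b) (coord_field b) f x)"
  proof (intro ext)
    fix f x
    show "vf_scale h X f x = (\<Sum>b\<in>Basis. vf_scale (?h b) (coord_field b) f x)"
    proof (cases "f \<in> smooth_functions M \<and> x \<in> Q")
      case True
      then have "x \<in> cell" "\<rho> x = 1" using Q_cell \<rho>(2) by auto
      then have "coord_field b f x = frechet_derivative (local_rep f) (at (\<phi> x)) b" for b
        using True by (simp add: coord_field_def cut_def)
      then show ?thesis
        using point_derivation_expand[OF _ vector_field_point_derivation[OF X], of x f] True
        by (simp add: vf_scale_def sum_distrib_left mult.assoc)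
    next
      case False
      moreover have "h x = 0" if "x \<notin> Q" using h(3,5) that by blast
      moreover have "X f = (\<lambda>x. 0)" if "f \<notin> smooth_functions M" using X that by (simp add: vector_fields_def)
      ultimately show ?thesis by (auto simp: vf_scale_def coord_field_def)
    qed
  qed
  then have "A (vf_scale h X) = (\<Sum>b\<in>Basis. A (vf_scale (?h b) (coord_field b)))"
    using pointlinear_sum[OF M A vf_scale_vector_field[OF M hs coord_field_vector_field]] by simp
  moreover have "h p = 1" using h by blast
  ultimately show ?thesis
    using pointlinear_scale[OF A h(1) X] pointlinear_scale[OF A hs coord_field_vector_field]
    by (simp add: tangent_vector_inner)
qed

lemma pointlinear_cong:
  assumes "pointlinear M p A" "X \<in> vector_fields M" "Y \<in> vector_fields M"
    "tangent_vector X = tangent_vector Y"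
  shows "A X = A Y"
  using assms by (simp add: pointlinear_expand)

end

section \<open>Lifting vector fields along local diffeomorphisms\<close>

lemma open_submanifold_simps [simp]:
  "mtop (open_submanifold M W) = subtopology (mtop M) W"
  "atlas (open_submanifold M W) = {(U \<inter> W, \<phi>) | U \<phi>. (U, \<phi>) \<in> atlas M}"
  by (simp_all add: open_submanifold_def)

text \<open>Charts of an open submanifold invert \<open>\<phi>\<close> on the smaller set
  \<open>U1 \<inter> U\<close>; on the image of \<open>R\<close> this inverse agrees with the one on
  \<open>U1\<close>, which \<open>smooth_at M\<close> speaks of.\<close>

lemma smooth_map_compose_at:
  assumes M: "smooth_manifold M" and N: "smooth_manifold N"
    and U: "openin (mtop M) U" and V: "openin (mtop N) V"
    and F: "smooth_map (open_submanifold M U) (open_submanifold N V) F"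
    and x: "x \<in> U" and f: "smooth_at N f (F x)"
  shows "smooth_at M (\<lambda>y. f (F y)) x"
proof -
  have cont: "continuous_map (subtopology (mtop M) U) (subtopology (mtop N) V) F"
    using F by (simp add: smooth_map_def)
  have topU: "topspace (subtopology (mtop M) U) = U" and topV: "topspace (subtopology (mtop N) V) = V"
    using openin_subset[OF U] openin_subset[OF V] by auto
  have FV: "F y \<in> V" if "y \<in> U" for y
    using continuous_map_image_subset_topspace[OF cont] that unfolding topU topV by blast
  have xM: "x \<in> topspace (mtop M)" using U x openin_subset by blast
  obtain U1 \<phi> where U1: "(U1, \<phi>) \<in> atlas M" "x \<in> U1"
    using smooth_manifold_chart_at[OF M xM] by blast
  obtain V1 \<psi> where V1: "(V1, \<psi>) \<in> atlas N" "F x \<in> V1"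
    using smooth_manifold_chart_at[OF N smooth_at_topspace[OF N f]] by blast
  note cU = smooth_manifold_chart[OF M U1(1)] and cV = smooth_manifold_chart[OF N V1(1)]
  obtain W where W: "open W" "\<psi> (F x) \<in> W" "W \<subseteq> \<psi> ` V1" "smooth_on W (f \<circ> inv_into V1 \<psi>)"
    using smooth_at_chart[OF N f V1] by blast
  define Z where "Z = {z \<in> V1. \<psi> z \<in> W}"
  have "openin (subtopology (mtop N) V) (Z \<inter> V)"
    using chart_preimage_open[OF cV W(1)] unfolding Z_def openin_subtopology by blast
  from openin_continuous_map_preimage[OF cont this]
  have "openin (subtopology (mtop M) U) {y \<in> U. F y \<in> Z \<inter> V}" by (simp only: topU)
  then have o1: "openin (mtop M) {y \<in> U. F y \<in> Z \<inter> V}" by (rule openin_trans_full[OF _ U])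
  define R where "R = U1 \<inter> {y \<in> U. F y \<in> Z \<inter> V}"
  have R: "openin (mtop M) R" unfolding R_def by (rule openin_Int[OF chart_openin[OF cU] o1])
  have RU: "R \<subseteq> U1" by (simp add: R_def)
  have oR: "open (\<phi> ` R)" by (rule chart_image_open[OF cU R RU])
  have inj: "inj_on \<phi> U1" by (rule chart_inj[OF cU])
  have inv: "inv_into U1 \<phi> (\<phi> y) = y" "inv_into (U1 \<inter> U) \<phi> (\<phi> y) = y" if "y \<in> R" for y
    using that inj inj_on_subset[OF inj, of "U1 \<inter> U"] by (simp_all add: R_def)
  have invV: "inv_into V1 \<psi> (\<psi> (F y)) = F y" if "y \<in> R" for y
    using that chart_inj[OF cV] by (simp add: R_def Z_def)
  have a1: "(U1 \<inter> U, \<phi>) \<in> atlas (open_submanifold M U)" using U1(1) by auto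
  have a2: "(V1 \<inter> V, \<psi>) \<in> atlas (open_submanifold N V)" using V1(1) by auto
  have "\<forall>(U, \<phi>)\<in>atlas (open_submanifold M U). \<forall>(V, \<psi>)\<in>atlas (open_submanifold N V).
      smooth_on (\<phi> ` (U \<inter> F -` V)) (\<psi> \<circ> F \<circ> inv_into U \<phi>)"
    using F unfolding smooth_map_def by (elim conjE)
  from bspec[OF this a1] a2
  have sm: "smooth_on (\<phi> ` ((U1 \<inter> U) \<inter> F -` (V1 \<inter> V))) (\<psi> \<circ> F \<circ> inv_into (U1 \<inter> U) \<phi>)"
    by fast
  have "smooth_on (\<phi> ` R) (\<lambda>y. (f \<circ> inv_into V1 \<psi>) ((\<psi> \<circ> F \<circ> inv_into (U1 \<inter> U) \<phi>) y))"
  proof (rule smooth_on_compose[OF oR _ smooth_on_subset[OF sm] W(4)])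
    show "(\<psi> \<circ> F \<circ> inv_into (U1 \<inter> U) \<phi>) ` \<phi> ` R \<subseteq> W"
      by (auto simp: inv) (auto simp: R_def Z_def)
    show "\<phi> ` R \<subseteq> \<phi> ` ((U1 \<inter> U) \<inter> F -` (V1 \<inter> V))"
      by (auto simp: R_def Z_def)
  qed
  then have "smooth_on (\<phi> ` R) ((\<lambda>y. f (F y)) \<circ> inv_into U1 \<phi>)"
    by (rule smooth_on_cong[OF oR, rotated]) (auto simp: inv invV)
  moreover have "\<phi> x \<in> \<phi> ` R" using x U1 V1 W(2) FV[OF x] by (auto simp: R_def Z_def)
  moreover have "\<phi> ` R \<subseteq> \<phi> ` U1" using RU by blast
  ultimately show ?thesis unfolding smooth_at_def using U1 oR by blast
qed

lemma open_submanifold_topspace: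
  assumes "smooth_manifold M"
  shows "open_submanifold M (topspace (mtop M)) = M"
proof -
  have "U \<inter> topspace (mtop M) = U" if "(U, \<phi>) \<in> atlas M" for U \<phi>
    using chart_subset[OF smooth_manifold_chart[OF assms that]] by blast
  then have "{(U \<inter> topspace (mtop M), \<phi>) | U \<phi>. (U, \<phi>) \<in> atlas M} = {(U, \<phi>) | U \<phi>. (U, \<phi>) \<in> atlas M}"
    by fastforce
  then show ?thesis by (simp add: open_submanifold_def subtopology_topspace)
qed

text \<open>\<open>e f\<close> is \<open>f\<close> composed with a local inverse of \<open>F\<close>
  and cut off by a bump that is 1 near \<open>F x\<close>. Stating it together with openness of
  \<open>F\<close> and smoothness of pullbacks keeps the local inverse out of later
  arguments.\<close>

lemma local_extension:
  fixes M :: "('a, 'e::euclidean_space) manifold" and N :: "('b, 'f::euclidean_space) manifold"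
  assumes M: "smooth_manifold M" and N: "smooth_manifold N"
    and F: "local_diffeomorphism M N F" and x: "x \<in> topspace (mtop M)"
  obtains Q and e :: "('a \<Rightarrow> real) \<Rightarrow> 'b \<Rightarrow> real" where
    "openin (mtop M) Q" "x \<in> Q"
    "\<And>Q'. openin (mtop M) Q' \<Longrightarrow> Q' \<subseteq> Q \<Longrightarrow> openin (mtop N) (F ` Q')"
    "\<And>y (f :: 'b \<Rightarrow> real). y \<in> Q \<Longrightarrow> smooth_at N f (F y) \<Longrightarrow> smooth_at M (\<lambda>y. f (F y)) y"
    "\<And>f. f \<in> smooth_functions M \<Longrightarrow> e f \<in> smooth_functions N"
    "\<And>f y. f \<in> smooth_functions M \<Longrightarrow> y \<in> Q \<Longrightarrow> e f (F y) = f y"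
proof -
  obtain U V where U: "openin (mtop M) U" "x \<in> U" and V: "openin (mtop N) V"
    and d: "diffeomorphism (open_submanifold M U) (open_submanifold N V) F"
    using F x unfolding local_diffeomorphism_def by blast
  have topU: "topspace (subtopology (mtop M) U) = U" and topV: "topspace (subtopology (mtop N) V) = V"
    using openin_subset[OF U(1)] openin_subset[OF V] by auto
  have sF: "smooth_map (open_submanifold M U) (open_submanifold N V) F"
    using d by (simp add: diffeomorphism_def)
  have "\<exists>H. smooth_map (open_submanifold N V) (open_submanifold M U) H \<and>
      (\<forall>x\<in>U. H (F x) = x) \<and> (\<forall>y\<in>V. F (H y) = y)"
    using d unfolding diffeomorphism_def open_submanifold_simps topU topV by (elim conjE)
  then obtain H where sH: "smooth_map (open_submanifold N V) (open_submanifold M U) H"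
    and HF: "\<And>y. y \<in> U \<Longrightarrow> H (F y) = y" and FH: "\<And>z. z \<in> V \<Longrightarrow> F (H z) = z"
    by blast
  have cF: "continuous_map (subtopology (mtop M) U) (subtopology (mtop N) V) F"
    and cH: "continuous_map (subtopology (mtop N) V) (subtopology (mtop M) U) H"
    using sF sH by (simp_all add: smooth_map_def)
  have FV: "F y \<in> V" if "y \<in> U" for y
    using continuous_map_image_subset_topspace[OF cF] that unfolding topU topV by blast
  have HU: "H z \<in> U" if "z \<in> V" for z
    using continuous_map_image_subset_topspace[OF cH] that unfolding topU topV by blast
  obtain \<rho> :: "'b \<Rightarrow> real" and Q0 C where \<rho>: "\<rho> \<in> smooth_functions N"
    "openin (mtop N) Q0" "F x \<in> Q0" "Q0 \<subseteq> C" "closedin (mtop N) C" "C \<subseteq> V"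
    "\<And>x. x \<in> Q0 \<Longrightarrow> \<rho> x = 1" "\<And>x. x \<notin> C \<Longrightarrow> \<rho> x = 0"
    by (rule bump_function[OF N V FV[OF U(2)]]) blast
  define Q where "Q = {y \<in> U. F y \<in> Q0}"
  define e :: "('a \<Rightarrow> real) \<Rightarrow> 'b \<Rightarrow> real" where
    "e f = (\<lambda>z. if z \<in> V then \<rho> z *\<^sub>R f (H z) else 0)" for f
  have "openin (subtopology (mtop N) V) Q0"
    using \<rho>(2,4,6) unfolding openin_subtopology by blast
  from openin_continuous_map_preimage[OF cF this]
  have "openin (subtopology (mtop M) U) Q" by (simp only: topU Q_def)
  then have 1: "openin (mtop M) Q" by (rule openin_trans_full[OF _ U(1)])
  have 2: "openin (mtop N) (F ` Q')" if Q': "openin (mtop M) Q'" "Q' \<subseteq> Q" for Q'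
  proof -
    have QU: "Q' \<subseteq> U" using Q'(2) by (auto simp: Q_def)
    then have "openin (subtopology (mtop M) U) Q'"
      using Q' unfolding openin_subtopology by blast
    from openin_continuous_map_preimage[OF cH this]
    have "openin (subtopology (mtop N) V) {z \<in> V. H z \<in> Q'}" by (simp only: topV)
    moreover have "{z \<in> V. H z \<in> Q'} = F ` Q'"
    proof
      show "{z \<in> V. H z \<in> Q'} \<subseteq> F ` Q'" using FH by force
      show "F ` Q' \<subseteq> {z \<in> V. H z \<in> Q'}" using FV HF QU by auto
    qed
    ultimately show ?thesis using openin_trans_full[OF _ V] by simp
  qed
  have 3: "smooth_at M (\<lambda>y. f (F y)) y" if "y \<in> Q" "smooth_at N f (F y)" for y and f :: "'b \<Rightarrow> real"
    by (rule smooth_map_compose_at[OF M N U(1) V sF _ that(2)]) (use that(1) in \<open>simp add: Q_def\<close>)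
  have 4: "e f \<in> smooth_functions N" if f: "f \<in> smooth_functions M" for f
    unfolding e_def
  proof (rule smooth_functions_extend[OF N \<rho>(1,5,6,8) V])
    fix z assume z: "z \<in> V"
    have "smooth_at M f (H z)"
      using HU[OF z] openin_subset[OF U(1)] by (intro smooth_functions_smooth_at[OF M f]) blast
    then show "smooth_at N (\<lambda>z. f (H z)) z"
      by (rule smooth_map_compose_at[OF N M V U(1) sH z])
  qed
  have 5: "e f (F y) = f y" if "y \<in> Q" for f y
    using that \<rho>(7) HF FV by (simp add: e_def Q_def)
  show thesis
    by (rule that[of Q e]) (use 1 2 3 4 5 U(2) \<rho>(3) in \<open>auto simp: Q_def\<close>)
qed

lemma local_diffeomorphism_topspace:
  assumes "local_diffeomorphism M N F" "x \<in> topspace (mtop M)"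
  shows "F x \<in> topspace (mtop N)"
proof -
  obtain U V where U: "openin (mtop M) U" "x \<in> U" and V: "openin (mtop N) V"
    and d: "diffeomorphism (open_submanifold M U) (open_submanifold N V) F"
    using assms unfolding local_diffeomorphism_def by blast
  have "continuous_map (subtopology (mtop M) U) (subtopology (mtop N) V) F"
    using d by (simp add: diffeomorphism_def smooth_map_def)
  from continuous_map_image_subset_topspace[OF this] show ?thesis using U assms(2) by auto
qed

lemma pullback_smooth:
  fixes M :: "('a, 'e::euclidean_space) manifold" and N :: "('b, 'f::euclidean_space) manifold"
    and f :: "'b \<Rightarrow> real"
  assumes M: "smooth_manifold M" and N: "smooth_manifold N"
    and F: "local_diffeomorphism M N F" and f: "f \<in> smooth_functions N"
  shows "pullback_fun M F f \<in> smooth_functions M"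
  unfolding smooth_functions_iff[OF M]
proof (intro conjI allI impI ballI)
  fix x assume x: "x \<in> topspace (mtop M)"
  obtain Q where Q: "x \<in> Q"
    "\<And>y (f :: 'b \<Rightarrow> real). y \<in> Q \<Longrightarrow> smooth_at N f (F y) \<Longrightarrow> smooth_at M (\<lambda>y. f (F y)) y"
    by (rule local_extension[OF M N F x]) blast
  have "smooth_at M (\<lambda>y. f (F y)) x"
    by (rule Q(2)[OF Q(1) smooth_functions_smooth_at[OF N f local_diffeomorphism_topspace[OF F x]]])
  then show "smooth_at M (pullback_fun M F f) x"
    by (rule smooth_at_cong[OF M _ openin_topspace x]) (simp add: pullback_fun_def)
qed (simp add: pullback_fun_def)

text \<open>The lift of \<open>Y\<close> applies \<open>Y\<close> to local extensions of functions along local inverses of \<open>F\<close>.\<close>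

lemma lift_vector_field:
  fixes M :: "('a, 'e::euclidean_space) manifold" and N :: "('b, 'f::euclidean_space) manifold"
  assumes M: "smooth_manifold M" and N: "smooth_manifold N"
    and F: "local_diffeomorphism M N F" and Y: "Y \<in> vector_fields N"
  shows "\<exists>X. vf_related M N F X Y"
proof -
  let ?T = "topspace (mtop M)"
  \<comment> \<open>One predicate for all facts about a local extension, so that neighbourhoods and
    extension operators can be chosen for all points at once.\<close>
  define P where "P x Q e \<longleftrightarrow>
    openin (mtop M) Q \<and> x \<in> Q \<and> (\<forall>Q'. openin (mtop M) Q' \<longrightarrow> Q' \<subseteq> Q \<longrightarrow> openin (mtop N) (F ` Q')) \<and>
    (\<forall>y\<in>Q. \<forall>f :: 'b \<Rightarrow> real. smooth_at N f (F y) \<longrightarrow> smooth_at M (\<lambda>y. f (F y)) y) \<and>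
    (\<forall>f\<in>smooth_functions M. e f \<in> smooth_functions N \<and> (\<forall>y\<in>Q. e f (F y) = f y))"
    for x Q and e :: "('a \<Rightarrow> real) \<Rightarrow> 'b \<Rightarrow> real"
  have "\<exists>Q e. P x Q e" if "x \<in> ?T" for x
  proof (rule local_extension[OF M N F that])
    fix Q and e :: "('a \<Rightarrow> real) \<Rightarrow> 'b \<Rightarrow> real"
    assume *: "openin (mtop M) Q" "x \<in> Q"
      "\<And>Q'. openin (mtop M) Q' \<Longrightarrow> Q' \<subseteq> Q \<Longrightarrow> openin (mtop N) (F ` Q')"
      "\<And>y (f :: 'b \<Rightarrow> real). y \<in> Q \<Longrightarrow> smooth_at N f (F y) \<Longrightarrow> smooth_at M (\<lambda>y. f (F y)) y"
      "\<And>f. f \<in> smooth_functions M \<Longrightarrow> e f \<in> smooth_functions N"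
      "\<And>f y. f \<in> smooth_functions M \<Longrightarrow> y \<in> Q \<Longrightarrow> e f (F y) = f y"
    have "P x Q e" unfolding P_def by (intro conjI ballI allI impI *)
    then show "\<exists>Q e. P x Q e" by blast
  qed
  then obtain Q E where QE: "\<And>x. x \<in> ?T \<Longrightarrow> P x (Q x) (E x)" by metis
  have Q: "openin (mtop M) (Q x)" "x \<in> Q x"
    "openin (mtop M) Q' \<Longrightarrow> Q' \<subseteq> Q x \<Longrightarrow> openin (mtop N) (F ` Q')" if "x \<in> ?T" for x Q'
    using QE[OF that] by (simp_all add: P_def)
  have Fs: "smooth_at M (\<lambda>y. f (F y)) y" if "x \<in> ?T" "y \<in> Q x" "smooth_at N f (F y)"
    for x y and f :: "'b \<Rightarrow> real"
    using QE[OF that(1)] that(2,3) by (simp add: P_def)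
  have E: "E x f \<in> smooth_functions N" "\<And>y. y \<in> Q x \<Longrightarrow> E x f (F y) = f y"
    if "x \<in> ?T" "f \<in> smooth_functions M" for x f
    using QE[OF that(1)] that(2) by (simp_all add: P_def)
  define X where "X f x = (if f \<in> smooth_functions M \<and> x \<in> ?T then Y (E x f) (F x) else 0)" for f x
  \<comment> \<open>The value \<open>X f x\<close> is independent of the chosen extension: any
    \<open>g\<close> with \<open>g \<circ> F = f\<close> near \<open>x\<close> computes it, because
    \<open>Y\<close> is local and \<open>F\<close> is open near \<open>x\<close>. The derivation
    rules for \<open>X\<close> reduce to this.\<close>
  have X_eq: "X f x = Y g (F x)"
    if f: "f \<in> smooth_functions M" and g: "g \<in> smooth_functions N"
      and Q': "openin (mtop M) Q'" "x \<in> Q'" "\<And>y. y \<in> Q' \<Longrightarrow> g (F y) = f y" for f g x Q'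
  proof -
    have x: "x \<in> ?T" using Q'(1,2) openin_subset by blast
    have "Y (E x f) (F x) = Y g (F x)"
    proof (rule point_derivation_local[OF N vector_field_point_derivation[OF Y] E(1)[OF x f] g])
      show "openin (mtop N) (F ` (Q' \<inter> Q x))"
        by (rule Q(3)[OF x openin_Int[OF Q'(1) Q(1)[OF x]]]) simp
      show "F x \<in> F ` (Q' \<inter> Q x)" using Q'(2) Q(2)[OF x] by blast
      show "E x f z = g z" if "z \<in> F ` (Q' \<inter> Q x)" for z
        using that E(2)[OF x f] Q'(3) by auto
    qed
    then show ?thesis using f x by (simp add: X_def)
  qed
  have smooth: "X f \<in> smooth_functions M" if f: "f \<in> smooth_functions M" for f
    unfolding smooth_functions_iff[OF M]
  proof (intro conjI allI impI ballI)
    fix x assume x: "x \<in> ?T"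
    have "smooth_at M (\<lambda>y. Y (E x f) (F y)) x"
      by (rule Fs[OF x Q(2)[OF x] smooth_functions_smooth_at[OF N vector_field_smooth[OF Y E(1)[OF x f]]
        local_diffeomorphism_topspace[OF F x]]])
    then show "smooth_at M (X f) x"
    proof (rule smooth_at_cong[OF M _ Q(1,2)[OF x]])
      fix y assume "y \<in> Q x"
      then show "Y (E x f) (F y) = X f y"
        using X_eq[OF f E(1)[OF x f] Q(1)[OF x] _ E(2)[OF x f]] by simp
    qed
  qed (simp add: X_def)
  have off: "X f x = 0" if "x \<notin> ?T" for f x using that by (simp add: X_def)
  have "X \<in> vector_fields M"
    unfolding vector_fields_def
  proof (intro CollectI conjI ballI allI impI ext)
    fix f g :: "'a \<Rightarrow> real" and x assume f: "f \<in> smooth_functions M" and g: "g \<in> smooth_functions M"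
    note fg = smooth_functions_add[OF M f g] and fg' = smooth_functions_mult[OF M f g]
    show "X (\<lambda>x. f x + g x) x = X f x + X g x"
    proof (cases "x \<in> ?T")
      case x: True
      have "X (\<lambda>x. f x + g x) x = Y (\<lambda>z. E x f z + E x g z) (F x)"
        by (rule X_eq[OF fg smooth_functions_add[OF N E(1)[OF x f] E(1)[OF x g]] Q(1,2)[OF x]])
          (simp add: E(2)[OF x f] E(2)[OF x g])
      then show ?thesis
        using point_derivation_add[OF vector_field_point_derivation[OF Y] E(1)[OF x f] E(1)[OF x g]] f g x
        by (simp add: X_def)
    qed (simp add: off)
    show "X (\<lambda>x. f x * g x) x = X f x * g x + f x * X g x"
    proof (cases "x \<in> ?T")
      case x: True
      have "X (\<lambda>x. f x * g x) x = Y (\<lambda>z. E x f z * E x g z) (F x)"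
        by (rule X_eq[OF fg' smooth_functions_mult[OF N E(1)[OF x f] E(1)[OF x g]] Q(1,2)[OF x]])
          (simp add: E(2)[OF x f] E(2)[OF x g])
      then show ?thesis
        using point_derivation_mult[OF vector_field_point_derivation[OF Y] E(1)[OF x f] E(1)[OF x g]] f g x
          E(2)[OF x f Q(2)[OF x]] E(2)[OF x g Q(2)[OF x]]
        by (simp add: X_def)
    qed (simp add: off)
  next
    fix c and f :: "'a \<Rightarrow> real" and x assume f: "f \<in> smooth_functions M"
    show "X (\<lambda>x. c * f x) x = c * X f x"
    proof (cases "x \<in> ?T")
      case x: True
      have "X (\<lambda>x. c * f x) x = Y (\<lambda>z. c * E x f z) (F x)"
        by (rule X_eq[OF smooth_functions_cmult[OF M f] smooth_functions_cmult[OF N E(1)[OF x f]] Q(1,2)[OF x]])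
          (simp add: E(2)[OF x f])
      then show ?thesis
        using point_derivation_cmult[OF vector_field_point_derivation[OF Y] E(1)[OF x f]] f x
        by (simp add: X_def)
    qed (simp add: off)
  qed (simp_all add: smooth X_def)
  moreover have "X (pullback_fun M F f) = pullback_fun M F (Y f)" if f: "f \<in> smooth_functions N" for f
  proof
    fix x
    show "X (pullback_fun M F f) x = pullback_fun M F (Y f) x"
    proof (cases "x \<in> ?T")
      case x: True
      have "X (pullback_fun M F f) x = Y f (F x)"
        by (rule X_eq[OF pullback_smooth[OF M N F f] f openin_topspace x]) (simp add: pullback_fun_def)
      then show ?thesis using x by (simp add: pullback_fun_def)
    qed (simp add: off pullback_fun_def)
  qed
  ultimately have "vf_related M N F X Y" using Y by (simp add: vf_related_def)
  then show ?thesis by blast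
qed

text \<open>A field on \<open>M\<close> need not descend to \<open>N\<close>, as \<open>F\<close>
  may identify points. Its value at \<open>y\<close>, however, can be pushed forward, extended to a
  global field \<open>Y\<close> and lifted again; the lift agrees with \<open>W\<close> at
  \<open>y\<close> because every smooth function on \<open>M\<close> is a pullback near
  \<open>y\<close>.\<close>

lemma push_forward_at:
  fixes M :: "('a, 'e::euclidean_space) manifold" and N :: "('b, 'f::euclidean_space) manifold"
  assumes M: "smooth_manifold M" and N: "smooth_manifold N"
    and F: "local_diffeomorphism M N F" and W: "W \<in> vector_fields M" and y: "y \<in> topspace (mtop M)"
  shows "\<exists>X Y. vf_related M N F X Y \<and> (\<forall>f\<in>smooth_functions M. X f y = W f y)"
proof -
  have pb: "pullback_fun M F f \<in> smooth_functions M" if "f \<in> smooth_functions N" for f :: "'b \<Rightarrow> real"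
    by (rule pullback_smooth[OF M N F that])
  have v: "point_derivation N (F y) (\<lambda>f. W (pullback_fun M F f) y)"
    unfolding point_derivation_def
  proof (intro conjI ballI allI)
    note pd = vector_field_point_derivation[OF W, of y]
    fix f g :: "'b \<Rightarrow> real" assume f: "f \<in> smooth_functions N" and g: "g \<in> smooth_functions N"
    have "pullback_fun M F (\<lambda>x. f x + g x) = (\<lambda>x. pullback_fun M F f x + pullback_fun M F g x)"
      by (auto simp: pullback_fun_def)
    then show "W (pullback_fun M F (\<lambda>x. f x + g x)) y = W (pullback_fun M F f) y + W (pullback_fun M F g) y"
      using point_derivation_add[OF pd pb[OF f] pb[OF g]] by simp
    have "pullback_fun M F (\<lambda>x. f x * g x) = (\<lambda>x. pullback_fun M F f x * pullback_fun M F g x)"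
      by (auto simp: pullback_fun_def)
    then show "W (pullback_fun M F (\<lambda>x. f x * g x)) y =
        W (pullback_fun M F f) y * g (F y) + f (F y) * W (pullback_fun M F g) y"
      using point_derivation_mult[OF pd pb[OF f] pb[OF g]] y by (simp add: pullback_fun_def)
  next
    fix f :: "'b \<Rightarrow> real" and c assume f: "f \<in> smooth_functions N"
    have "pullback_fun M F (\<lambda>x. c * f x) = (\<lambda>x. c * pullback_fun M F f x)"
      by (auto simp: pullback_fun_def)
    then show "W (pullback_fun M F (\<lambda>x. c * f x)) y = c * W (pullback_fun M F f) y"
      using point_derivation_cmult[OF vector_field_point_derivation[OF W] pb[OF f]] by simp
  qed
  obtain U \<phi> r \<rho> Q0 C where "bump_chart N U \<phi> (F y) r \<rho> Q0 C"
    by (rule bump_chart_exists[OF N local_diffeomorphism_topspace[OF F y]]) blast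
  then interpret bc: bump_chart N U \<phi> "F y" r \<rho> Q0 C .
  define Y where "Y = bc.coord_field (bc.tangent_coord (\<lambda>f. W (pullback_fun M F f) y))"
  have Y: "Y \<in> vector_fields N" unfolding Y_def by (rule bc.coord_field_vector_field)
  have YW: "Y f (F y) = W (pullback_fun M F f) y" if "f \<in> smooth_functions N" for f
    using bc.point_derivation_coord_field[OF v that] by (simp add: Y_def)
  obtain X where X: "vf_related M N F X Y" using lift_vector_field[OF M N F Y] by blast
  then have Xv: "X \<in> vector_fields M" by (simp add: vf_related_def)
  obtain Q and e :: "('a \<Rightarrow> real) \<Rightarrow> 'b \<Rightarrow> real" where Q: "openin (mtop M) Q" "y \<in> Q"
    "\<And>f. f \<in> smooth_functions M \<Longrightarrow> e f \<in> smooth_functions N"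
    "\<And>f y. f \<in> smooth_functions M \<Longrightarrow> y \<in> Q \<Longrightarrow> e f (F y) = f y"
    by (rule local_extension[OF M N F y]) blast
  have "X f y = W f y" if f: "f \<in> smooth_functions M" for f
  proof -
    let ?g = "pullback_fun M F (e f)"
    have eq: "f x = ?g x" if "x \<in> Q" for x
      using that openin_subset[OF Q(1)] Q(4)[OF f] by (auto simp: pullback_fun_def)
    have "X f y = X ?g y"
      by (rule point_derivation_local[OF M vector_field_point_derivation[OF Xv] f pb[OF Q(3)[OF f]] Q(1,2) eq])
    also have "\<dots> = W ?g y"
      using X Q(3)[OF f] YW[OF Q(3)[OF f]] y by (simp add: vf_related_def pullback_fun_def)
    also have "\<dots> = W f y"
      by (rule point_derivation_local[OF M vector_field_point_derivation[OF W] f pb[OF Q(3)[OF f]] Q(1,2) eq, symmetric])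
    finally show ?thesis .
  qed
  then show ?thesis using X by blast
qed

text \<open>In product charts the translation is multiplication restricted to the slice with first
  coordinate \<open>\<phi>0 h\<close>, for one chart \<open>\<phi>0\<close> at
  \<open>h\<close>.\<close>

lemma left_translation_smooth:
  fixes M :: "('g, 'e::euclidean_space) manifold"
  assumes G: "lie_group G M" and h: "h \<in> carrier G"
  shows "smooth_map M M (\<lambda>x. h \<otimes>\<^bsub>G\<^esub> x)"
proof -
  let ?m = "\<lambda>(x, y). x \<otimes>\<^bsub>G\<^esub> y" and ?L = "\<lambda>x. h \<otimes>\<^bsub>G\<^esub> x"
  have M: "smooth_manifold M" and top: "topspace (mtop M) = carrier G"
    and m: "smooth_map (prod_manifold M M) M ?m"
    using G by (simp_all add: lie_group_def)
  have "continuous_map (mtop M) (prod_topology (mtop M) (mtop M)) (\<lambda>x. (h, x))"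
    using h top by (simp add: continuous_map_pairwise o_def)
  moreover have cm: "continuous_map (prod_topology (mtop M) (mtop M)) (mtop M) ?m"
    using m by (simp add: smooth_map_def prod_manifold_def)
  ultimately have "continuous_map (mtop M) (mtop M) (?m \<circ> (\<lambda>x. (h, x)))"
    by (rule continuous_map_compose)
  then have cont: "continuous_map (mtop M) (mtop M) ?L" by (simp add: o_def)
  obtain U0 \<phi>0 where U0: "(U0, \<phi>0) \<in> atlas M" "h \<in> U0"
    using smooth_manifold_chart_at[OF M, of h] h top by blast
  note c0 = smooth_manifold_chart[OF M U0(1)]
  have "smooth_on (\<phi> ` (U \<inter> ?L -` V)) (\<psi> \<circ> ?L \<circ> inv_into U \<phi>)"
    if U: "(U, \<phi>) \<in> atlas M" and V: "(V, \<psi>) \<in> atlas M" for U \<phi> V \<psi>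
  proof -
    note cU = smooth_manifold_chart[OF M U] and cV = smooth_manifold_chart[OF M V]
    let ?P = "map_prod \<phi>0 \<phi>"
    have UT: "U \<subseteq> topspace (mtop M)" by (rule chart_subset[OF cU])
    have "openin (mtop M) (U \<inter> {x \<in> topspace (mtop M). ?L x \<in> V})"
      by (intro openin_Int chart_openin[OF cU] openin_continuous_map_preimage[OF cont chart_openin[OF cV]])
    moreover have "U \<inter> {x \<in> topspace (mtop M). ?L x \<in> V} = U \<inter> ?L -` V" using UT by blast
    ultimately have "openin (mtop M) (U \<inter> ?L -` V)" by simp
    then have o: "open (\<phi> ` (U \<inter> ?L -` V))" by (rule chart_image_open[OF cU]) simp
    have inj: "inj_on \<phi> U" "inj_on \<phi>0 U0" using chart_inj[OF cU] chart_inj[OF c0] .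
    then have injP: "inj_on ?P (U0 \<times> U)" by (auto simp: inj_on_def)
    have invP: "inv_into (U0 \<times> U) ?P (\<phi>0 h, \<phi> x) = (h, x)" if "x \<in> U" for x
      using inv_into_f_f[OF injP, of "(h, x)"] U0(2) that by simp
    have inv: "inv_into U \<phi> (\<phi> x) = x" if "x \<in> U" for x using inj(1) that by simp
    have a: "(U0 \<times> U, ?P) \<in> atlas (prod_manifold M M)"
      using U0(1) U by (auto simp: prod_manifold_def)
    have "\<forall>(U, \<phi>)\<in>atlas (prod_manifold M M). \<forall>(V, \<psi>)\<in>atlas M.
        smooth_on (\<phi> ` (U \<inter> ?m -` V)) (\<psi> \<circ> ?m \<circ> inv_into U \<phi>)"
      using m unfolding smooth_map_def by (elim conjE)
    from bspec[OF this a] V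
    have sm: "smooth_on (?P ` ((U0 \<times> U) \<inter> ?m -` V)) (\<psi> \<circ> ?m \<circ> inv_into (U0 \<times> U) ?P)"
      by fast
    \<comment> \<open>The inclusion of the slice, split into a constant and a linear map.\<close>
    have i1: "smooth_on (\<phi> ` (U \<inter> ?L -` V)) (\<lambda>y. (\<phi>0 h, 0) + (0, y))"
      by (intro smooth_on_add smooth_on_const o smooth_on_linear[OF _ o smooth_on_ident[OF o]]
          bounded_linear_Pair bounded_linear_zero bounded_linear_ident)
    have "smooth_on (\<phi> ` (U \<inter> ?L -` V))
        (\<lambda>y. (\<psi> \<circ> ?m \<circ> inv_into (U0 \<times> U) ?P) ((\<phi>0 h, 0) + (0, y)))"
    proof (rule smooth_on_compose[OF o _ i1 sm])
      show "(\<lambda>y. (\<phi>0 h, 0) + (0, y)) ` \<phi> ` (U \<inter> ?L -` V) \<subseteq> ?P ` ((U0 \<times> U) \<inter> ?m -` V)"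
        using U0(2) by force
    qed
    then show ?thesis
      by (rule smooth_on_cong[OF o, rotated]) (auto simp: invP inv)
  qed
  then show ?thesis using cont by (auto simp: smooth_map_def)
qed

lemma left_translation_local_diffeomorphism:
  assumes G: "lie_group G M" and h: "h \<in> carrier G"
  shows "local_diffeomorphism M M (\<lambda>x. h \<otimes>\<^bsub>G\<^esub> x)"
proof -
  have M: "smooth_manifold M" and top: "topspace (mtop M) = carrier G" and gr: "group G"
    using G by (simp_all add: lie_group_def)
  interpret group G by (rule gr)
  have "diffeomorphism M M (\<lambda>x. h \<otimes>\<^bsub>G\<^esub> x)"
    unfolding diffeomorphism_def
  proof (intro conjI exI[of _ "\<lambda>x. inv\<^bsub>G\<^esub> h \<otimes>\<^bsub>G\<^esub> x"])
    show "smooth_map M M (\<lambda>x. h \<otimes>\<^bsub>G\<^esub> x)" "smooth_map M M (\<lambda>x. inv\<^bsub>G\<^esub> h \<otimes>\<^bsub>G\<^esub> x)"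
      using left_translation_smooth[OF G] h by auto
  qed (use h top in \<open>simp_all flip: m_assoc\<close>)
  then show ?thesis
    unfolding local_diffeomorphism_def
    by (intro ballI exI[of _ "topspace (mtop M)"]) (simp add: open_submanifold_topspace[OF M])
qed

section \<open>Alternating complex-linear forms\<close>

text \<open>\<open>V\<close> and the addition are parameters because this serves both vectors of the
  model space with \<open>+\<close> and vector fields with \<open>vf_add\<close>, which are only a
  subset of their type. Scalars are left out: the sign rules come from additivity.\<close>

definition slot_alternating ::
  "nat \<Rightarrow> 'b set \<Rightarrow> ('b \<Rightarrow> 'b \<Rightarrow> 'b) \<Rightarrow> ('b list \<Rightarrow> complex) \<Rightarrow> bool" where
  "slot_alternating k V add A \<longleftrightarrow>
     (\<forall>x\<in>V. \<forall>y\<in>V. add x y \<in> V) \<and>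
     (\<forall>xs i x y. length xs = k \<and> set xs \<subseteq> V \<and> i < k \<and> x \<in> V \<and> y \<in> V \<longrightarrow>
        A (xs[i := add x y]) = A (xs[i := x]) + A (xs[i := y])) \<and>
     (\<forall>xs i j. length xs = k \<and> set xs \<subseteq> V \<and> i < j \<and> j < k \<and> xs ! i = xs ! j \<longrightarrow> A xs = 0)"

lemma slot_alternating_repeat:
  assumes "slot_alternating k V add A" "length xs = k" "set xs \<subseteq> V" "i < k" "j < k" "i \<noteq> j" "xs ! i = xs ! j"
  shows "A xs = 0"
  using assms unfolding slot_alternating_def by (metis linorder_neqE_nat)

text \<open>Put the sum of both entries into both slots and expand.\<close>

lemma slot_alternating_swap:
  assumes A: "slot_alternating k V add A" and xs: "length xs = k" "set xs \<subseteq> V"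
    and ij: "i < k" "j < k" "i \<noteq> j"
  shows "A (xs[i := xs ! j, j := xs ! i]) = - A xs"
proof -
  let ?x = "xs ! i" and ?y = "xs ! j"
  define B where "B u v = A (xs[i := u, j := v])" for u v
  have mem: "?x \<in> V" "?y \<in> V" using xs ij by auto
  have pl: "add ?x ?y \<in> V" using A mem unfolding slot_alternating_def by blast
  have set_upd: "set (xs[l := u]) \<subseteq> V" if "u \<in> V" for l u
    using set_update_subset_insert[of xs l u] xs(2) that by blast
  have add2: "B u (add v w) = B u v + B u w" if "u \<in> V" "v \<in> V" "w \<in> V" for u v w
    using A xs(1) set_upd[OF that(1), of i] ij that unfolding slot_alternating_def B_def by auto
  have add1: "B (add v w) u = B v u + B w u" if "u \<in> V" "v \<in> V" "w \<in> V" for u v w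
  proof -
    have "A ((xs[j := u])[i := add v w]) = A ((xs[j := u])[i := v]) + A ((xs[j := u])[i := w])"
      using A xs(1) set_upd[OF that(1), of j] ij that unfolding slot_alternating_def by auto
    then show ?thesis unfolding B_def by (simp add: list_update_swap[OF ij(3)])
  qed
  have z: "B u u = 0" if "u \<in> V" for u
    unfolding B_def
  proof (rule slot_alternating_repeat[OF A _ _ ij])
    show "set (xs[i := u, j := u]) \<subseteq> V"
      using set_update_subset_insert[of "xs[i := u]" j u] set_upd[OF that, of i] that by blast
  qed (use xs ij in auto)
  have "0 = B (add ?x ?y) (add ?x ?y)" using z[OF pl] by simp
  also have "\<dots> = B ?x ?y + B ?y ?x"
    using add1[OF pl mem] add2[OF mem(1) mem] add2[OF mem(2) mem] z mem by simp
  finally show ?thesis by (simp add: B_def add_eq_0_iff2)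
qed

text \<open>Moving \<open>z\<close> to the front takes \<open>l\<close> adjacent swaps, one sign
  each. The old entry \<open>xs ! l\<close> is overwritten, hence \<open>omit\<close>.\<close>

lemma slot_alternating_to_front:
  assumes A: "slot_alternating k V add A"
  shows "length xs = k \<Longrightarrow> set xs \<subseteq> V \<Longrightarrow> l < k \<Longrightarrow> z \<in> V \<Longrightarrow> A (xs[l := z]) = (- 1) ^ l * A (z # omit l xs)"
proof (induction l arbitrary: xs)
  case 0
  then show ?case by (cases xs) (auto simp: omit_def)
next
  case (Suc l)
  let ?ys = "xs[Suc l := z]" and ?xs' = "xs[Suc l := xs ! l]"
  have V: "set ?ys \<subseteq> V" "set ?xs' \<subseteq> V"
  proof -
    have "xs ! l \<in> V" using Suc.prems by auto
    then show "set ?ys \<subseteq> V" "set ?xs' \<subseteq> V"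
      using Suc.prems set_update_subset_insert[of xs "Suc l"] by (meson insert_subset order_trans)+
  qed
  have "A (?ys[l := ?ys ! Suc l, Suc l := ?ys ! l]) = - A ?ys"
    by (rule slot_alternating_swap[OF A]) (use Suc.prems V in auto)
  moreover have "?ys[l := ?ys ! Suc l, Suc l := ?ys ! l] = ?xs'[l := z]"
    using Suc.prems by (auto simp: list_eq_iff_nth_eq nth_list_update)
  ultimately have "A ?ys = - A (?xs'[l := z])" by simp
  also have "A (?xs'[l := z]) = (- 1) ^ l * A (z # omit l ?xs')"
    by (rule Suc.IH) (use Suc.prems V in auto)
  also have "omit l ?xs' = omit (Suc l) xs"
    using Suc.prems by (simp add: omit_def take_Suc_conv_app_nth drop_update_cancel flip: Cons_nth_drop_Suc)
  finally show ?case by simp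
qed

text \<open>Slots are replaced one at a time from the left, so invariance in a single slot suffices
  if it holds for arbitrary other entries.\<close>

lemma replace_slots:
  assumes A: "\<And>xs i. length xs = k \<Longrightarrow> set xs \<subseteq> V \<Longrightarrow> i < k \<Longrightarrow> A (xs[i := T (xs ! i)]) = A xs"
    and T: "\<And>x. x \<in> V \<Longrightarrow> T x \<in> V" and xs: "length xs = k" "set xs \<subseteq> V"
  shows "A (map T xs) = A xs"
proof -
  have "A (map T (take j xs) @ drop j xs) = A xs" if "j \<le> k" for j
    using that
  proof (induction j)
    case (Suc j)
    let ?ys = "map T (take j xs) @ drop j xs"
    have "set ?ys \<subseteq> V" using T xs(2) by (auto dest!: in_set_takeD in_set_dropD)
    then have "A (?ys[j := T (?ys ! j)]) = A ?ys"
      using Suc.prems xs by (intro A) auto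
    moreover have "?ys[j := T (?ys ! j)] = map T (take (Suc j) xs) @ drop (Suc j) xs"
      using Suc.prems xs by (simp add: list_update_append nth_append take_Suc_conv_app_nth flip: Cons_nth_drop_Suc)
    ultimately show ?case using Suc by simp
  qed simp
  from this[of k] xs show ?thesis by simp
qed

text \<open>Complex multilinearity on a real space, with the operator \<open>I\<close> in the role
  of multiplication by \<open>\<i>\<close>, since the model space of a manifold is real.\<close>

definition alt_clinear :: "nat \<Rightarrow> ('v::real_vector \<Rightarrow> 'v) \<Rightarrow> ('v list \<Rightarrow> complex) \<Rightarrow> bool" where
  "alt_clinear k I \<gamma> \<longleftrightarrow>
     (\<forall>vs i. length vs = k \<and> i < k \<longrightarrow> linear (\<lambda>v. \<gamma> (vs[i := v]))) \<and>
     (\<forall>vs i v. length vs = k \<and> i < k \<longrightarrow> \<gamma> (vs[i := I v]) = \<i> * \<gamma> (vs[i := v])) \<and>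
     (\<forall>vs i j. length vs = k \<and> i < j \<and> j < k \<and> vs ! i = vs ! j \<longrightarrow> \<gamma> vs = 0)"

lemma alt_clinear_slot_alternating:
  assumes "alt_clinear k I \<gamma>"
  shows "slot_alternating k UNIV (+) \<gamma>"
proof -
  have "\<gamma> (xs[i := x + y]) = \<gamma> (xs[i := x]) + \<gamma> (xs[i := y])" if "length xs = k" "i < k" for xs i x y
    using assms that linear_add[of "\<lambda>v. \<gamma> (xs[i := v])" x y] by (simp add: alt_clinear_def)
  then show ?thesis using assms unfolding alt_clinear_def slot_alternating_def by simp
qed

text \<open>The top exterior power of a complex space of dimension \<open>k\<close> is a line. The
  conclusion is cross-multiplied so that it stays free of division.\<close>

lemma alt_clinear_proportional:
  fixes I :: "'e::euclidean_space \<Rightarrow> 'e"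
  assumes dim: "DIM('e) = 2 * k" and \<alpha>: "alt_clinear k I \<alpha>" and \<beta>: "alt_clinear k I \<beta>"
    and bs: "length bs = k" "\<beta> bs \<noteq> 0" and vs: "length vs = k"
  shows "\<alpha> vs * \<beta> bs = \<alpha> bs * \<beta> vs"
proof -
  \<comment> \<open>\<open>\<gamma>\<close> vanishes on \<open>bs\<close>, and the \<open>2k\<close> vectors \<open>b\<close>, \<open>I b\<close> form a real basis because \<open>\<beta> bs \<noteq> 0\<close>.\<close>
  define \<gamma> where "\<gamma> vs = \<alpha> vs * \<beta> bs - \<alpha> bs * \<beta> vs" for vs
  have \<gamma>: "alt_clinear k I \<gamma>"
    unfolding alt_clinear_def
  proof (intro conjI allI impI)
    fix vs :: "'e list" and i assume a: "length vs = k \<and> i < k"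
    have "linear (\<lambda>v. \<alpha> (vs[i := v]))" "linear (\<lambda>v. \<beta> (vs[i := v]))"
      using a \<alpha> \<beta> by (simp_all add: alt_clinear_def)
    then show "linear (\<lambda>v. \<gamma> (vs[i := v]))"
      unfolding \<gamma>_def linear_iff by (simp add: algebra_simps)
    fix v show "\<gamma> (vs[i := I v]) = \<i> * \<gamma> (vs[i := v])"
      using a \<alpha> \<beta> by (simp add: alt_clinear_def \<gamma>_def algebra_simps)
  next
    fix vs :: "'e list" and i j assume "length vs = k \<and> i < j \<and> j < k \<and> vs ! i = vs ! j"
    then have "\<alpha> vs = 0" "\<beta> vs = 0" using \<alpha> \<beta> unfolding alt_clinear_def by blast+
    then show "\<gamma> vs = 0" by (simp add: \<gamma>_def)
  qed
  note alt = alt_clinear_slot_alternating[OF \<gamma>]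
  \<comment> \<open>Every permutation is reached by transpositions, and each of them only changes
    the sign of a value that is 0 on \<open>bs\<close>.\<close>
  have perm0: "\<gamma> (map (\<lambda>i. bs ! p i) [0..<k]) = 0" if "p permutes {..<k}" for p
    using finite_lessThan[of k] that
  proof (induction p rule: permutes_rev_induct)
    case id
    have "map (\<lambda>i. bs ! id i) [0..<k] = bs" using bs(1) by (auto intro: nth_equalityI)
    then show ?case by (simp add: \<gamma>_def)
  next
    case (swap a b p)
    let ?xs = "map (\<lambda>i. bs ! p i) [0..<k]"
    have "map (\<lambda>i. bs ! (p \<circ> Transposition.transpose a b) i) [0..<k] = ?xs[a := ?xs ! b, b := ?xs ! a]"
      using swap(1-3) by (auto simp: list_eq_iff_nth_eq nth_list_update Transposition.transpose_def)
    then show ?case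
      using slot_alternating_swap[OF alt, of ?xs a b] swap by simp
  qed
  have fun0: "\<gamma> (map (\<lambda>i. bs ! s i) [0..<k]) = 0" if s: "\<And>i. i < k \<Longrightarrow> s i < k" for s
  proof (cases "inj_on s {..<k}")
    case True
    define p where "p i = (if i < k then s i else i)" for i
    have "inj_on p {..<k}" using True by (auto simp: inj_on_def p_def)
    moreover have "p ` {..<k} \<subseteq> {..<k}" using s by (auto simp: p_def)
    ultimately have "bij_betw p {..<k} {..<k}"
      by (simp add: bij_betw_def endo_inj_surj)
    then have "p permutes {..<k}" by (rule bij_imp_permutes) (simp add: p_def)
    moreover have "map (\<lambda>i. bs ! p i) [0..<k] = map (\<lambda>i. bs ! s i) [0..<k]" by (simp add: p_def)
    ultimately show ?thesis using perm0 by metis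
  next
    case False
    then obtain i j where "i < k" "j < k" "i \<noteq> j" "s i = s j" by (auto simp: inj_on_def)
    then show ?thesis by (intro slot_alternating_repeat[OF alt, where i = i and j = j]) auto
  qed
  define f where "f z = (if snd z then I (bs ! fst z) else bs ! fst z)" for z :: "nat \<times> bool"
  define S where "S = {..<k} \<times> (UNIV :: bool set)"
  \<comment> \<open>With slot \<open>i\<close> free, \<open>\<beta>\<close> is, up to the factor
    \<open>\<beta> bs\<close>, the \<open>i\<close>-th complex coordinate: it separates the vectors
    \<open>f z\<close> and extracts the coefficients of a linear relation.\<close>
  have L: "\<beta> (bs[i := f z]) = (if fst z = i then (if snd z then \<i> else 1) * \<beta> bs else 0)"
    if "i < k" "z \<in> S" for i z
  proof -
    have "\<beta> (bs[i := bs ! j]) = (if j = i then \<beta> bs else 0)" if "j < k" for j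
    proof (cases "j = i")
      case False
      then have "\<beta> (bs[i := bs ! j]) = 0"
        using \<open>i < k\<close> that bs(1)
        by (intro slot_alternating_repeat[OF alt_clinear_slot_alternating[OF \<beta>], where i = i and j = j]) auto
      then show ?thesis using False by simp
    qed simp
    moreover have "\<beta> (bs[i := I v]) = \<i> * \<beta> (bs[i := v])" for v
      using \<beta> bs(1) \<open>i < k\<close> by (simp add: alt_clinear_def)
    ultimately show ?thesis using that(2) by (auto simp: f_def S_def)
  qed
  have inj: "inj_on f S"
  proof (rule inj_onI)
    fix z w assume z: "z \<in> S" and w: "w \<in> S" and eq: "f z = f w"
    then have "fst z < k" by (auto simp: S_def)
    from L[OF this z] L[OF this w] eq bs(2) show "z = w"
      by (auto simp: prod_eq_iff complex_eq_iff split: if_splits)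
  qed
  have ind: "independent (f ` S)"
  proof
    assume "dependent (f ` S)"
    moreover have "finite (f ` S)" by (simp add: S_def)
    ultimately obtain u z where s0: "(\<Sum>v\<in>f ` S. u v *\<^sub>R v) = 0" and z: "z \<in> S" "u (f z) \<noteq> 0"
      using real_vector.dependent_finite by blast
    let ?i = "fst z"
    have i: "?i < k" using z by (auto simp: S_def)
    have lin: "linear (\<lambda>v. \<beta> (bs[?i := v]))" using \<beta> bs(1) i by (simp add: alt_clinear_def)
    have "0 = \<beta> (bs[?i := \<Sum>z\<in>S. u (f z) *\<^sub>R f z])"
      using s0 linear_0[OF lin] by (simp add: sum.reindex[OF inj])
    also have "\<dots> = (\<Sum>z\<in>S. u (f z) *\<^sub>R \<beta> (bs[?i := f z]))"
      by (simp add: linear_sum[OF lin] linear_cmul[OF lin])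
    also have "\<dots> = (\<Sum>w\<in>S. if w \<in> {?i} \<times> UNIV then u (f w) *\<^sub>R ((if snd w then \<i> else 1) * \<beta> bs) else 0)"
      by (intro sum.cong refl) (auto simp: L[OF i])
    also have "\<dots> = (\<Sum>w\<in>{?i} \<times> UNIV. u (f w) *\<^sub>R ((if snd w then \<i> else 1) * \<beta> bs))"
      using i by (subst sum.inter_restrict[symmetric])
        (auto simp: S_def intro!: sum.cong)
    also have "\<dots> = (complex_of_real (u (f (?i, False))) + \<i> * complex_of_real (u (f (?i, True)))) * \<beta> bs"
      by (simp add: sum.cartesian_product[symmetric] UNIV_bool scaleR_conv_of_real algebra_simps)
    finally have "complex_of_real (u (f (?i, False))) + \<i> * complex_of_real (u (f (?i, True))) = 0"
      using bs(2) by simp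
    then have "u (f (?i, False)) = 0" "u (f (?i, True)) = 0" by (auto simp: complex_eq_iff)
    then show False using z by (cases z; cases "snd z") auto
  qed
  have "card (f ` S) = 2 * k" using card_image[OF inj] by (simp add: S_def)
  then have span: "UNIV \<subseteq> span (f ` S)"
    using dim by (intro card_ge_dim_independent[OF subset_UNIV ind]) simp
  \<comment> \<open>The first \<open>m\<close> slots hold arbitrary vectors, the others entries of
    \<open>bs\<close>. The selection \<open>s\<close> stays general because freeing slot
    \<open>m\<close> uses the previous stage with every entry of \<open>bs\<close> in that
    slot.\<close>
  have "\<gamma> (take m vs @ map (\<lambda>i. bs ! s i) [m..<k]) = 0" if "m \<le> k" "\<And>i. i < k \<Longrightarrow> s i < k" for m s
    using that
  proof (induction m arbitrary: s)
    case 0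
    then show ?case using fun0 by simp
  next
    case (Suc m)
    let ?xs = "take (Suc m) vs @ map (\<lambda>i. bs ! s i) [Suc m..<k]"
    have len: "length ?xs = k" using vs Suc.prems by simp
    have m: "m < k" using Suc.prems by simp
    have lin: "linear (\<lambda>v. \<gamma> (?xs[m := v]))" using \<gamma> len m by (simp add: alt_clinear_def)
    have b: "\<gamma> (?xs[m := bs ! j]) = 0" if "j < k" for j
    proof -
      have "?xs[m := bs ! j] = take m vs @ map (\<lambda>i. bs ! (s(m := j)) i) [m..<k]"
        using vs m by (auto simp: list_eq_iff_nth_eq nth_list_update nth_append min_def)
      then show ?thesis using Suc.IH[of "s(m := j)"] Suc.prems that by simp
    qed
    have "\<gamma> (?xs[m := v]) = 0" if "v \<in> span (f ` S)" for v
    proof (rule linear_eq_0_on_span[OF lin _ that])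
      fix w assume "w \<in> f ` S"
      then obtain j c where "j < k" "w = bs ! j \<or> w = I (bs ! j)" by (auto simp: f_def S_def)
      moreover have "\<gamma> (?xs[m := I v]) = \<i> * \<gamma> (?xs[m := v])" for v
        using \<gamma> len m unfolding alt_clinear_def by blast
      ultimately show "\<gamma> (?xs[m := w]) = 0" using b by auto
    qed
    then have "\<gamma> (?xs[m := vs ! m]) = 0" using span by blast
    moreover have "?xs[m := vs ! m] = ?xs"
      using vs m by (auto simp: list_eq_iff_nth_eq nth_list_update nth_append)
    ultimately show ?case by simp
  qed
  from this[of k "\<lambda>i. i"] vs have "\<gamma> vs = 0" by simp
  then show ?thesis by (simp add: \<gamma>_def)
qed

section \<open>Forms of type (k,0) and the exterior derivative\<close>

lemma smooth_functions_Re_Im: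
  assumes "smooth_manifold M" "h \<in> smooth_functions M"
  shows "(\<lambda>x. Re (h x)) \<in> smooth_functions M" "(\<lambda>x. Im (h x)) \<in> smooth_functions M"
  using smooth_functions_linear[OF assms(1) bounded_linear_Re assms(2)]
    smooth_functions_linear[OF assms(1) bounded_linear_Im assms(2)] .

lemma vector_field_add:
  assumes "X \<in> vector_fields M" "f \<in> smooth_functions M" "g \<in> smooth_functions M"
  shows "X (\<lambda>x. f x + g x) p = X f p + X g p"
  by (rule point_derivation_add[OF vector_field_point_derivation[OF assms(1)] assms(2,3)])

lemma vector_field_cmult:
  assumes "X \<in> vector_fields M" "f \<in> smooth_functions M"
  shows "X (\<lambda>x. c * f x) p = c * X f p"
  by (rule point_derivation_cmult[OF vector_field_point_derivation[OF assms(1)] assms(2)])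

lemma vector_field_mult:
  assumes "X \<in> vector_fields M" "f \<in> smooth_functions M" "g \<in> smooth_functions M"
  shows "X (\<lambda>x. f x * g x) p = X f p * g p + f p * X g p"
  by (rule point_derivation_mult[OF vector_field_point_derivation[OF assms(1)] assms(2,3)])

lemma vf_complex_add:
  assumes "smooth_manifold M" "X \<in> vector_fields M" "h \<in> smooth_functions M" "g \<in> smooth_functions M"
  shows "vf_complex X (\<lambda>x. h x + g x) p = vf_complex X h p + vf_complex X g p"
  using vector_field_add[OF assms(2)] smooth_functions_Re_Im[OF assms(1,3)] smooth_functions_Re_Im[OF assms(1,4)]
  by (simp add: vf_complex_def complex_eq_iff)

lemma vf_complex_cmult:
  assumes M: "smooth_manifold M" and X: "X \<in> vector_fields M" and h: "h \<in> smooth_functions M"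
  shows "vf_complex X (\<lambda>x. c * h x) p = c * vf_complex X h p"
proof -
  note ri = smooth_functions_Re_Im[OF M h]
  note sm = smooth_functions_cmult[OF M ri(1)] smooth_functions_cmult[OF M ri(2)]
  have "X (\<lambda>x. Re c * Re (h x) + (- Im c) * Im (h x)) p = Re c * X (\<lambda>x. Re (h x)) p + (- Im c) * X (\<lambda>x. Im (h x)) p"
    by (simp only: vector_field_add[OF X sm] vector_field_cmult[OF X ri(1)] vector_field_cmult[OF X ri(2)])
  moreover have "X (\<lambda>x. Im c * Re (h x) + Re c * Im (h x)) p = Im c * X (\<lambda>x. Re (h x)) p + Re c * X (\<lambda>x. Im (h x)) p"
    by (simp only: vector_field_add[OF X sm] vector_field_cmult[OF X ri(1)] vector_field_cmult[OF X ri(2)])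
  ultimately show ?thesis
    by (simp add: vf_complex_def complex_eq_iff algebra_simps)
qed

lemma vf_complex_of_real_mult:
  assumes M: "smooth_manifold M" and X: "X \<in> vector_fields M" and h: "h \<in> smooth_functions M"
    and g: "g \<in> smooth_functions M"
  shows "vf_complex X (\<lambda>x. complex_of_real (g x) * h x) p =
    complex_of_real (X g p) * h p + complex_of_real (g p) * vf_complex X h p"
  using vector_field_mult[OF X g smooth_functions_Re_Im(1)[OF M h]]
    vector_field_mult[OF X g smooth_functions_Re_Im(2)[OF M h]]
  by (simp add: vf_complex_def complex_eq_iff)

lemma vf_complex_cnj:
  assumes M: "smooth_manifold M" and X: "X \<in> vector_fields M" and h: "h \<in> smooth_functions M"
  shows "vf_complex X (\<lambda>x. cnj (h x)) p = cnj (vf_complex X h p)"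
  using vector_field_cmult[OF X smooth_functions_Re_Im(2)[OF M h], of "-1"]
  by (simp add: vf_complex_def complex_eq_iff)

lemma vf_complex_scale: "vf_complex (vf_scale g X) h p = complex_of_real (g p) * vf_complex X h p"
  by (simp add: vf_complex_def vf_scale_def complex_eq_iff)

lemma vector_field_off:
  "X \<in> vector_fields M \<Longrightarrow> x \<notin> topspace (mtop M) \<Longrightarrow> X f x = 0"
  using smooth_functions_off[of "X f" M x] by (cases "f \<in> smooth_functions M") (auto simp: vector_fields_def)

text \<open>A nonzero constant is not in \<open>smooth_functions M\<close> unless \<open>M\<close> is the whole type.\<close>

lemma vf_scale_const_eq:
  assumes "X \<in> vector_fields M"
  shows "vf_scale (\<lambda>_. c) X = vf_scale (\<lambda>x. if x \<in> topspace (mtop M) then c else 0) X"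
  using vector_field_off[OF assms] by (auto simp: vf_scale_def fun_eq_iff)

lemma vf_scale_const_vector_field:
  "smooth_manifold M \<Longrightarrow> X \<in> vector_fields M \<Longrightarrow> vf_scale (\<lambda>_. c) X \<in> vector_fields M"
  by (simp add: vf_scale_const_eq vf_scale_vector_field smooth_functions_const)

lemma pointlinear_scale_const:
  assumes "smooth_manifold M" "pointlinear M p A" "X \<in> vector_fields M" "p \<in> topspace (mtop M)"
  shows "A (vf_scale (\<lambda>_. c) X) = c *\<^sub>R A X"
  using pointlinear_scale[OF assms(2) smooth_functions_const[OF assms(1)] assms(3)] assms(4)
  by (simp add: vf_scale_const_eq[OF assms(3)])

lemma endo_field_vector_field: "endo_field M A \<Longrightarrow> X \<in> vector_fields M \<Longrightarrow> A X \<in> vector_fields M"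
  by (simp add: endo_field_def)

lemma vf_tuples_update: "Xs \<in> vf_tuples M k \<Longrightarrow> X \<in> vector_fields M \<Longrightarrow> Xs[i := X] \<in> vf_tuples M k"
  using set_update_subset_insert[of Xs i X] by (auto simp: vf_tuples_def)

lemma vf_tuples_nth: "Xs \<in> vf_tuples M k \<Longrightarrow> i < k \<Longrightarrow> Xs ! i \<in> vector_fields M"
  by (auto simp: vf_tuples_def)

lemma vf_tuples_map:
  "Xs \<in> vf_tuples M k \<Longrightarrow> (\<And>X. X \<in> vector_fields M \<Longrightarrow> f X \<in> vector_fields N) \<Longrightarrow> map f Xs \<in> vf_tuples N k"
  by (auto simp: vf_tuples_def)

lemma complex_form_smooth: "complex_form M k \<omega> \<Longrightarrow> Xs \<in> vf_tuples M k \<Longrightarrow> \<omega> Xs \<in> smooth_functions M"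
  by (simp add: complex_form_def)

lemma complex_form_add:
  "complex_form M k \<omega> \<Longrightarrow> Xs \<in> vf_tuples M k \<Longrightarrow> i < k \<Longrightarrow> X \<in> vector_fields M \<Longrightarrow> Y \<in> vector_fields M \<Longrightarrow>
     \<omega> (Xs[i := vf_add X Y]) = (\<lambda>x. \<omega> (Xs[i := X]) x + \<omega> (Xs[i := Y]) x)"
  by (simp add: complex_form_def)

lemma complex_form_scale:
  "complex_form M k \<omega> \<Longrightarrow> Xs \<in> vf_tuples M k \<Longrightarrow> i < k \<Longrightarrow> X \<in> vector_fields M \<Longrightarrow> h \<in> smooth_functions M \<Longrightarrow>
     \<omega> (Xs[i := vf_scale h X]) = (\<lambda>x. complex_of_real (h x) * \<omega> (Xs[i := X]) x)"
  by (simp add: complex_form_def)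

lemma complex_form_pointlinear:
  "complex_form M k \<omega> \<Longrightarrow> Xs \<in> vf_tuples M k \<Longrightarrow> i < k \<Longrightarrow> pointlinear M p (\<lambda>X. \<omega> (Xs[i := X]) p)"
  by (simp add: pointlinear_def complex_form_add complex_form_scale scaleR_conv_of_real)

lemma complex_form_slot_alternating:
  assumes "smooth_manifold M" "complex_form M k \<omega>"
  shows "slot_alternating k (vector_fields M) vf_add (\<lambda>Xs. \<omega> Xs p)"
  unfolding slot_alternating_def
proof (intro conjI allI impI ballI)
  fix Xs i X Y assume "length Xs = k \<and> set Xs \<subseteq> vector_fields M \<and> i < k \<and> X \<in> vector_fields M \<and> Y \<in> vector_fields M"
  then show "\<omega> (Xs[i := vf_add X Y]) p = \<omega> (Xs[i := X]) p + \<omega> (Xs[i := Y]) p"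
    using complex_form_add[OF assms(2)] by (simp add: vf_tuples_def)
next
  fix Xs :: "'a vfield list" and i j
  assume *: "length Xs = k \<and> set Xs \<subseteq> vector_fields M \<and> i < j \<and> j < k \<and> Xs ! i = Xs ! j"
  have "\<forall>Xs\<in>vf_tuples M k. \<forall>i j. i < j \<and> j < k \<and> Xs ! i = Xs ! j \<longrightarrow> \<omega> Xs = (\<lambda>x. 0)"
    using assms(2) by (simp add: complex_form_def)
  then have "\<omega> Xs = (\<lambda>x. 0)" using * by (simp add: vf_tuples_def) blast
  then show "\<omega> Xs p = 0" by simp
qed (simp add: vf_add_vector_field[OF assms(1)])

text \<open>Covers \<open>\<eta>\<close>, its covariant derivative and its conjugate twist by
  \<open>J\<close>, all as functionals at one point, so that they can be compared with each
  other.\<close>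

definition type_form_at ::
  "('a, 'e::euclidean_space) manifold \<Rightarrow> ('a vfield \<Rightarrow> 'a vfield) \<Rightarrow> nat \<Rightarrow> 'a \<Rightarrow> ('a vfield list \<Rightarrow> complex) \<Rightarrow> bool" where
  "type_form_at M I k p \<alpha> \<longleftrightarrow> slot_alternating k (vector_fields M) vf_add \<alpha> \<and>
     (\<forall>Xs\<in>vf_tuples M k. \<forall>i<k. pointlinear M p (\<lambda>X. \<alpha> (Xs[i := X])) \<and>
        (\<forall>X\<in>vector_fields M. \<alpha> (Xs[i := I X]) = \<i> * \<alpha> (Xs[i := X])))"

text \<open>Coordinate fields at \<open>p\<close> carry both functionals to the model space, whose
  complex dimension is \<open>k\<close>; there \<open>alt_clinear_proportional\<close>
  applies.\<close>

lemma type_form_at_proportional: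
  fixes M :: "('a, 'e::euclidean_space) manifold"
  assumes M: "smooth_manifold M" and dim: "DIM('e) = 2 * k" and p: "p \<in> topspace (mtop M)"
    and I: "endo_field M I" and \<alpha>: "type_form_at M I k p \<alpha>" and \<beta>: "type_form_at M I k p \<beta>"
    and Bs: "Bs \<in> vf_tuples M k" "\<beta> Bs \<noteq> 0" and Ys: "Ys \<in> vf_tuples M k"
  shows "\<alpha> Ys * \<beta> Bs = \<alpha> Bs * \<beta> Ys"
proof -
  obtain U \<phi> r \<rho> Q0 C where "bump_chart M U \<phi> p r \<rho> Q0 C"
    by (rule bump_chart_exists[OF M p]) blast
  then interpret bc: bump_chart M U \<phi> p r \<rho> Q0 C .
  \<comment> \<open>The operator \<open>I\<close> at \<open>p\<close>, read in the model
    space.\<close>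
  define I' where "I' v = bc.tangent_vector (I (bc.coord_field v))" for v
  define lift where "lift \<gamma> vs = \<gamma> (map bc.coord_field vs)" for \<gamma> :: "'a vfield list \<Rightarrow> complex" and vs
  have tup: "map bc.coord_field vs \<in> vf_tuples M k" if "length vs = k" for vs
    using that bc.coord_field_vector_field by (auto simp: vf_tuples_def)
  have upd: "lift \<gamma> (vs[i := v]) = \<gamma> ((map bc.coord_field vs)[i := bc.coord_field v])" for \<gamma> vs i v
    by (simp add: lift_def map_update)
  have lift: "alt_clinear k I' (lift \<gamma>)" if \<gamma>: "type_form_at M I k p \<gamma>" for \<gamma>
    unfolding alt_clinear_def
  proof (intro conjI allI impI)
    fix vs :: "'e list" and i assume a: "length vs = k \<and> i < k"
    let ?A = "\<lambda>X. \<gamma> ((map bc.coord_field vs)[i := X])"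
    have A: "pointlinear M p ?A" using \<gamma> tup a by (simp add: type_form_at_def)
    note tv = pointlinear_add[OF bc.pointlinear_tangent_vector bc.coord_field_vector_field bc.coord_field_vector_field]
      pointlinear_scale_const[OF M bc.pointlinear_tangent_vector bc.coord_field_vector_field p]
    show "linear (\<lambda>v. lift \<gamma> (vs[i := v]))"
      unfolding upd linear_iff
    proof (intro conjI allI)
      fix v w c
      \<comment> \<open>By tensoriality it is enough that both fields have the same tangent vector
        at \<open>p\<close>.\<close>
      have "?A (bc.coord_field (v + w)) = ?A (vf_add (bc.coord_field v) (bc.coord_field w))"
        by (rule bc.pointlinear_cong[OF A bc.coord_field_vector_field
          vf_add_vector_field[OF M bc.coord_field_vector_field bc.coord_field_vector_field]])
          (simp add: bc.tangent_vector_coord_field tv)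
      then show "?A (bc.coord_field (v + w)) = ?A (bc.coord_field v) + ?A (bc.coord_field w)"
        by (simp add: pointlinear_add[OF A bc.coord_field_vector_field bc.coord_field_vector_field])
      have "?A (bc.coord_field (c *\<^sub>R v)) = ?A (vf_scale (\<lambda>_. c) (bc.coord_field v))"
        by (rule bc.pointlinear_cong[OF A bc.coord_field_vector_field
          vf_scale_const_vector_field[OF M bc.coord_field_vector_field]])
          (simp add: bc.tangent_vector_coord_field tv)
      then show "?A (bc.coord_field (c *\<^sub>R v)) = c *\<^sub>R ?A (bc.coord_field v)"
        by (simp add: pointlinear_scale_const[OF M A bc.coord_field_vector_field p])
    qed
    fix v
    have "?A (bc.coord_field (I' v)) = ?A (I (bc.coord_field v))"
      by (rule bc.pointlinear_cong[OF A bc.coord_field_vector_field endo_field_vector_field[OF I bc.coord_field_vector_field]])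
        (simp add: bc.tangent_vector_coord_field I'_def)
    then show "lift \<gamma> (vs[i := I' v]) = \<i> * lift \<gamma> (vs[i := v])"
      using \<gamma> tup a bc.coord_field_vector_field by (simp add: type_form_at_def upd)
  next
    fix vs :: "'e list" and i j assume a: "length vs = k \<and> i < j \<and> j < k \<and> vs ! i = vs ! j"
    show "lift \<gamma> vs = 0"
      unfolding lift_def
      by (rule slot_alternating_repeat[where i = i and j = j])
        (use \<gamma> a tup[of vs] in \<open>auto simp: type_form_at_def vf_tuples_def\<close>)
  qed
  have red: "\<gamma> Xs = lift \<gamma> (map bc.tangent_vector Xs)"
    if \<gamma>: "type_form_at M I k p \<gamma>" and Xs: "Xs \<in> vf_tuples M k" for \<gamma> Xs
  proof -
    let ?T = "\<lambda>X. bc.coord_field (bc.tangent_vector X)"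
    have "\<gamma> (map ?T Xs) = \<gamma> Xs"
    proof (rule replace_slots[where A = \<gamma> and k = k and V = "vector_fields M"])
      fix Zs :: "'a vfield list" and i assume Zs: "length Zs = k" "set Zs \<subseteq> vector_fields M" and i: "i < k"
      have "pointlinear M p (\<lambda>X. \<gamma> (Zs[i := X]))"
        using \<gamma> Zs i by (simp add: type_form_at_def vf_tuples_def)
      then have "\<gamma> (Zs[i := ?T (Zs ! i)]) = \<gamma> (Zs[i := Zs ! i])"
        by (rule bc.pointlinear_cong[OF _ bc.coord_field_vector_field])
          (use Zs i bc.tangent_vector_coord_field in auto)
      then show "\<gamma> (Zs[i := ?T (Zs ! i)]) = \<gamma> Zs" by simp
    qed (use Xs bc.coord_field_vector_field in \<open>auto simp: vf_tuples_def\<close>)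
    then show ?thesis by (simp add: lift_def o_def)
  qed
  have "length Bs = k" "length Ys = k" using Bs Ys by (simp_all add: vf_tuples_def)
  then show ?thesis
    using alt_clinear_proportional[OF dim lift[OF \<alpha>] lift[OF \<beta>], of "map bc.tangent_vector Bs" "map bc.tangent_vector Ys"]
      red[OF \<alpha>] red[OF \<beta>] Bs Ys by simp
qed

text \<open>The type condition evaluates \<open>\<eta>\<close> on the (1,0)-parts of all arguments,
  and the (1,0)-part of \<open>I X\<close> is \<open>\<i>\<close> times that of \<open>X\<close>. In
  the expansion over the set \<open>T\<close> of slots contributing the imaginary part, this pairs
  the term \<open>T\<close> for \<open>I X\<close> with the term \<open>\<sigma> T\<close> for
  \<open>X\<close>.\<close>

lemma form_of_type_I_linear:
  assumes M: "smooth_manifold M" and I: "complex_structure M I" and \<eta>: "form_of_type M I k 0 \<eta>"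
    and Xs: "Xs \<in> vf_tuples M k" and i: "i < k" and X: "X \<in> vector_fields M"
    and p: "p \<in> topspace (mtop M)"
  shows "\<eta> (Xs[i := I X]) p = \<i> * \<eta> (Xs[i := X]) p"
proof -
  have \<omega>: "complex_form M k \<eta>" using \<eta> by (simp add: form_of_type_def)
  have Iv: "I Y \<in> vector_fields M" if "Y \<in> vector_fields M" for Y
    using I that by (simp add: complex_structure_def endo_field_def)
  have II: "I (I X) = vf_scale (\<lambda>_. - 1) X" using I X by (simp add: complex_structure_def)
  define W where "W Zs T = map (\<lambda>j. if j \<in> T then vf_scale (\<lambda>_. - (1/2)) (I (Zs ! j)) else vf_scale (\<lambda>_. 1/2) (Zs ! j)) [0..<k]"
    for Zs T
  have expand: "\<eta> Zs p = (\<Sum>T\<in>Pow {..<k}. \<i> ^ card T * \<eta> (W Zs T) p)"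
    if Zs: "Zs \<in> vf_tuples M k" for Zs
  proof -
    have len: "length Zs = k" using Zs by (simp add: vf_tuples_def)
    have "{S. S \<subseteq> {..<k} \<and> card S = k} = {{..<k}}"
      using card_subset_eq[of "{..<k}"] by auto
    moreover have "\<eta> Zs p = bidegree_part I k \<eta> Zs p"
      using \<eta> Zs by (simp add: form_of_type_def)
    moreover have "map (\<lambda>j. if j \<in> T then map (\<lambda>j. vf_scale (\<lambda>_. if j < k then - (1/2) else 1/2) (I (Zs ! j))) [0..<k] ! j
          else map (vf_scale (\<lambda>_. 1/2)) Zs ! j) [0..<k] = W Zs T" for T
      using len by (auto simp: W_def)
    ultimately show ?thesis
      using len by (simp add: bidegree_part_def form_cext_def)
  qed
  define \<sigma> where "\<sigma> T = (if i \<in> T then T - {i} else insert i T)" for T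
  let ?X1 = "Xs[i := I X]" and ?X2 = "Xs[i := X]"
  have W_tup: "W Zs T \<in> vf_tuples M k" if "Zs \<in> vf_tuples M k" for Zs T
    using vf_tuples_nth[OF that] Iv vf_scale_const_vector_field[OF M] by (auto simp: W_def vf_tuples_def)
  have sc: "\<eta> (Zs[i := vf_scale (\<lambda>_. c) Y]) p = complex_of_real c * \<eta> (Zs[i := Y]) p"
    if "Zs \<in> vf_tuples M k" "Y \<in> vector_fields M" for Zs Y c
    using pointlinear_scale_const[OF M complex_form_pointlinear[OF \<omega> that(1) i] that(2) p]
    by (simp add: scaleR_conv_of_real)
  have len: "length Xs = k" using Xs by (simp add: vf_tuples_def)
  have W_upd: "W (Xs[i := Y]) T = (W Xs T)[i := if i \<in> T then vf_scale (\<lambda>_. - (1/2)) (I Y) else vf_scale (\<lambda>_. 1/2) Y]" for Y T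
    using len i by (auto simp: W_def list_eq_iff_nth_eq nth_list_update)
  have W_ins: "(W Xs (insert i T))[i := Y] = (W Xs T)[i := Y]" "(W Xs (T - {i}))[i := Y] = (W Xs T)[i := Y]" for T Y
    using len i by (auto simp: W_def list_eq_iff_nth_eq nth_list_update)
  have key: "\<i> ^ card T * \<eta> (W ?X1 T) p = \<i> * (\<i> ^ card (\<sigma> T) * \<eta> (W ?X2 (\<sigma> T)) p)"
    if T: "T \<in> Pow {..<k}" for T
  proof -
    have fin: "finite T" using T finite_subset by auto
    note Wt = W_tup[OF Xs, of T]
    show ?thesis
    proof (cases "i \<in> T")
      case True
      have "vf_scale (\<lambda>_. - (1/2)) (vf_scale (\<lambda>_. - 1) X) = vf_scale (\<lambda>_. 1/2) X"
        by (simp add: vf_scale_def)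
      moreover have "\<i> ^ card T = \<i> * \<i> ^ card (T - {i})"
        unfolding card.remove[OF fin True] by (rule power_Suc)
      ultimately show ?thesis
        using True by (simp add: \<sigma>_def W_upd II W_ins sc[OF Wt X] del: card_Diff_singleton card_Diff_insert)
    next
      case False
      then show ?thesis
        using fin by (simp add: \<sigma>_def W_upd W_ins sc[OF Wt Iv[OF X]] flip: mult.assoc)
    qed
  qed
  have "\<eta> ?X1 p = (\<Sum>T\<in>Pow {..<k}. \<i> ^ card T * \<eta> (W ?X1 T) p)"
    by (rule expand[OF vf_tuples_update[OF Xs Iv[OF X]]])
  also have "\<dots> = (\<Sum>T\<in>Pow {..<k}. \<i> * (\<i> ^ card T * \<eta> (W ?X2 T) p))"
    by (rule sum.reindex_bij_witness[of _ \<sigma> \<sigma>]) (use i key in \<open>auto simp: \<sigma>_def\<close>)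
  also have "\<dots> = \<i> * \<eta> ?X2 p"
    unfolding expand[OF vf_tuples_update[OF Xs X]] by (simp add: sum_distrib_left)
  finally show ?thesis .
qed

section \<open>The exterior derivative through a torsion-free connection\<close>

lemma omit_nth: "l < length xs \<Longrightarrow> i < length xs \<Longrightarrow> l < length xs - 1 \<Longrightarrow>
    omit i xs ! l = xs ! (if l < i then l else Suc l)"
  by (auto simp: omit_def nth_append min_def)

lemma length_omit: "i < length xs \<Longrightarrow> length (omit i xs) = length xs - 1"
  by (auto simp: omit_def)

lemma set_omit: "set (omit i xs) \<subseteq> set xs"
  by (auto simp: omit_def dest: in_set_takeD in_set_dropD)

lemma omit_omit:
  assumes "i \<le> l" "Suc l < length xs"
  shows "omit l (omit i xs) = omit i (omit (Suc l) xs)"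
  using assms by (auto simp: list_eq_iff_nth_eq length_omit omit_nth)

text \<open>Replacing each bracket by the difference of two covariant derivatives turns the bracket
  sum into the correction terms of \<open>form_cov_deriv\<close>; what remains is bookkeeping of
  indices and signs.\<close>

lemma ext_deriv_torsion_free:
  assumes M: "smooth_manifold M" and \<eta>: "complex_form M k \<eta>"
    and D: "affine_connection M D" "torsion_free M D" and Xs: "Xs \<in> vf_tuples M (Suc k)"
    and p: "p \<in> topspace (mtop M)"
  shows "ext_deriv \<eta> Xs p = (\<Sum>i<Suc k. (- 1) ^ i * form_cov_deriv D (Xs ! i) \<eta> (omit i Xs) p)"
proof -
  have len: "length Xs = Suc k" using Xs by (simp add: vf_tuples_def)
  have Xv: "Xs ! i \<in> vector_fields M" if "i < Suc k" for i using vf_tuples_nth[OF Xs that] .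
  have Dv: "D X Y \<in> vector_fields M" if "X \<in> vector_fields M" "Y \<in> vector_fields M" for X Y
    using D(1) that by (simp add: affine_connection_def)
  note alt = complex_form_slot_alternating[OF M \<eta>, of p]
  \<comment> \<open>The term in which \<open>Xs ! j\<close> is differentiated along
    \<open>Xs ! i\<close> and placed in front; \<open>min\<close> and \<open>max\<close> let one
    formula serve both orders of \<open>i\<close> and \<open>j\<close>.\<close>
  define P where "P i j = (- 1) ^ (i + j) * \<eta> (D (Xs ! i) (Xs ! j) # omit (min i j) (omit (max i j) Xs)) p" for i j
  have sub: "set (omit i Xs) \<subseteq> vector_fields M" for i
    using set_omit[of i Xs] Xs by (auto simp: vf_tuples_def)
  have bracket: "(- 1) ^ (i + j) * \<eta> (lie_bracket (Xs ! i) (Xs ! j) # omit i (omit j Xs)) p = P i j - P j i"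
    if ij: "i < j" "j < Suc k" for i j
  proof -
    let ?R = "omit i (omit j Xs)" and ?X = "Xs ! i" and ?Y = "Xs ! j"
    have X: "?X \<in> vector_fields M" and Y: "?Y \<in> vector_fields M" using Xv ij by auto
    have k: "0 < k" using ij by simp
    have lR: "length ?R = k - 1" using len ij by (simp add: length_omit)
    have t: "?X # ?R \<in> vf_tuples M k"
      using X lR k set_omit[of i "omit j Xs"] sub[of j] by (auto simp: vf_tuples_def)
    have "lie_bracket ?X ?Y = vf_add (D ?X ?Y) (vf_scale (\<lambda>_. - 1) (D ?Y ?X))"
      using D(2) X Y by (simp add: torsion_free_def)
    then have "\<eta> ((?X # ?R)[0 := lie_bracket ?X ?Y]) p =
        \<eta> ((?X # ?R)[0 := D ?X ?Y]) p + \<eta> ((?X # ?R)[0 := vf_scale (\<lambda>_. - 1) (D ?Y ?X)]) p"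
      using complex_form_add[OF \<eta> t k Dv[OF X Y] vf_scale_const_vector_field[OF M Dv[OF Y X]]]
      by (simp only:)
    also have "\<eta> ((?X # ?R)[0 := vf_scale (\<lambda>_. - 1) (D ?Y ?X)]) p = - \<eta> ((?X # ?R)[0 := D ?Y ?X]) p"
      using pointlinear_scale_const[OF M complex_form_pointlinear[OF \<eta> t k] Dv[OF Y X] p] by simp
    finally have "\<eta> (lie_bracket ?X ?Y # ?R) p = \<eta> (D ?X ?Y # ?R) p - \<eta> (D ?Y ?X # ?R) p" by simp
    then show ?thesis
      using ij by (simp add: P_def min_def max_def right_diff_distrib add.commute[of j i])
  qed
  have front: "\<eta> ((omit i Xs)[l := Z]) p = (- 1) ^ l * \<eta> (Z # omit l (omit i Xs)) p"
    if "i < Suc k" "l < k" "Z \<in> vector_fields M" for i l Z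
    by (rule slot_alternating_to_front[OF alt]) (use that sub len in \<open>auto simp: length_omit\<close>)
  \<comment> \<open>Entry \<open>l\<close> of \<open>omit i Xs\<close> has original index
    \<open>l\<close> if \<open>l < i\<close> and \<open>Suc l\<close> otherwise. The shift costs a
    sign, hence \<open>P i l\<close> in the first case and \<open>- P i (Suc l)\<close> in the
    second.\<close>
  define g where "g i l = (- 1) ^ i * \<eta> ((omit i Xs)[l := D (Xs ! i) (omit i Xs ! l)]) p" for i l
  have g1: "g i l = P i l" if "i < Suc k" "l < i" for i l
  proof -
    have "omit i Xs ! l = Xs ! l" using that len by (simp add: omit_nth)
    then show ?thesis
      using front[of i l "D (Xs ! i) (Xs ! l)"] that Dv Xv
      by (simp add: g_def P_def min_def max_def power_add)
  qed
  have g2: "g i l = - P i (Suc l)" if "i \<le> l" "l < k" for i l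
  proof -
    have "omit i Xs ! l = Xs ! Suc l" using that len by (simp add: omit_nth)
    moreover have "omit l (omit i Xs) = omit i (omit (Suc l) Xs)" using that len by (intro omit_omit) auto
    ultimately show ?thesis
      using front[of i l "D (Xs ! i) (Xs ! Suc l)"] that Dv Xv
      by (simp add: g_def P_def min_def max_def power_add)
  qed
  have split: "(\<Sum>l<k. g i l) = (\<Sum>l<i. P i l) - (\<Sum>j\<in>{i<..k}. P i j)" if i: "i < Suc k" for i
  proof -
    have "(\<Sum>l<k. g i l) = (\<Sum>l\<in>{..<i}. g i l) + (\<Sum>l\<in>{i..<k}. g i l)"
      using i by (subst sum.union_disjoint[symmetric]) (auto intro!: sum.cong)
    also have "(\<Sum>l\<in>{..<i}. g i l) = (\<Sum>l<i. P i l)" using g1[OF i] by simp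
    also have "(\<Sum>l\<in>{i..<k}. g i l) = (\<Sum>l\<in>{i..<k}. - P i (Suc l))" using g2 by simp
    also have "\<dots> = - (\<Sum>l\<in>{i..<k}. P i (Suc l))" by (rule sum_negf)
    also have "(\<Sum>l\<in>{i..<k}. P i (Suc l)) = (\<Sum>j\<in>{i<..k}. P i j)"
      by (rule sum.reindex_bij_witness[of _ "\<lambda>j. j - 1" Suc]) auto
    finally show ?thesis by simp
  qed
  have swap: "(\<Sum>i<Suc k. \<Sum>j\<in>{i<..k}. P i j) = (\<Sum>j<Suc k. \<Sum>i<j. P i j)"
    by (subst (1 2) sum.Sigma, simp_all, rule sum.reindex_bij_witness[of _ prod.swap prod.swap]) auto
  have "(\<Sum>j<Suc k. \<Sum>i<j. (- 1) ^ (i + j) * \<eta> (lie_bracket (Xs ! i) (Xs ! j) # omit i (omit j Xs)) p) =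
      (\<Sum>j<Suc k. \<Sum>i<j. P i j - P j i)"
    by (intro sum.cong refl bracket) auto
  also have "\<dots> = (\<Sum>i<Suc k. \<Sum>j\<in>{i<..k}. P i j) - (\<Sum>j<Suc k. \<Sum>i<j. P j i)"
    unfolding swap by (simp only: sum_subtractf)
  also have "\<dots> = - (\<Sum>i<Suc k. \<Sum>l<k. g i l)"
    unfolding sum_negf[symmetric] sum_subtractf[symmetric] by (intro sum.cong refl) (simp add: split sum_negf)
  finally have br: "(\<Sum>j<Suc k. \<Sum>i<j. (- 1) ^ (i + j) * \<eta> (lie_bracket (Xs ! i) (Xs ! j) # omit i (omit j Xs)) p) =
      - (\<Sum>i<Suc k. \<Sum>l<k. g i l)" .
  have "(- 1) ^ i * form_cov_deriv D (Xs ! i) \<eta> (omit i Xs) p =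
      (- 1) ^ i * vf_complex (Xs ! i) (\<eta> (omit i Xs)) p - (\<Sum>l<k. g i l)" if "i < Suc k" for i
    using that len by (simp add: form_cov_deriv_def length_omit g_def sum_distrib_left algebra_simps)
  then show ?thesis
    unfolding ext_deriv_def len br by (simp add: sum_subtractf)
qed

section \<open>Transport of left-invariant forms and the Obata connection\<close>

text \<open>Tensoriality in terms of the action of fields on functions, free of any choice of a
  chart.\<close>

lemma pointlinear_cong_at:
  assumes M: "smooth_manifold M" and p: "p \<in> topspace (mtop M)" and A: "pointlinear M p A"
    and XY: "X \<in> vector_fields M" "Y \<in> vector_fields M" "\<And>f. f \<in> smooth_functions M \<Longrightarrow> X f p = Y f p"
  shows "A X = A Y"
proof -
  obtain U \<phi> r \<rho> Q0 C where "bump_chart M U \<phi> p r \<rho> Q0 C"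
    by (rule bump_chart_exists[OF M p]) blast
  then interpret bc: bump_chart M U \<phi> p r \<rho> Q0 C .
  have "bc.tangent_vector X = bc.tangent_vector Y"
    by (simp add: bc.tangent_coord_def XY(3) bc.coordinate_cut_smooth)
  from bc.pointlinear_cong[OF A XY(1,2) this] show ?thesis .
qed

text \<open>\<open>T\<close> preserves values at \<open>p\<close>; as \<open>A\<close> is tensorial
  there, \<open>A (T X)\<close> and \<open>A X\<close> agree at \<open>p\<close> too, and the form
  sees nothing else.\<close>

lemma complex_form_map_cong_at:
  assumes M: "smooth_manifold M" and p: "p \<in> topspace (mtop M)" and \<omega>: "complex_form M k \<omega>"
    and T: "\<And>X. X \<in> vector_fields M \<Longrightarrow> T X \<in> vector_fields M"
      "\<And>X f. X \<in> vector_fields M \<Longrightarrow> f \<in> smooth_functions M \<Longrightarrow> T X f p = X f p"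
    and A: "\<And>X. X \<in> vector_fields M \<Longrightarrow> A X \<in> vector_fields M"
      "\<And>f. f \<in> smooth_functions M \<Longrightarrow> pointlinear M p (\<lambda>X. A X f p)"
    and Xs: "Xs \<in> vf_tuples M k"
  shows "\<omega> (map (\<lambda>X. A (T X)) Xs) p = \<omega> (map A Xs) p"
proof -
  have "\<omega> (map A (map T Xs)) p = \<omega> (map A Xs) p"
  proof (rule replace_slots[where A = "\<lambda>Xs. \<omega> (map A Xs) p" and k = k and V = "vector_fields M"])
    fix Zs :: "'a vfield list" and i assume Zs: "length Zs = k" "set Zs \<subseteq> vector_fields M" and i: "i < k"
    then have Z: "Zs ! i \<in> vector_fields M" by auto
    have tup: "map A Zs \<in> vf_tuples M k" using Zs A(1) by (auto simp: vf_tuples_def)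
    have "A (T (Zs ! i)) f p = A (Zs ! i) f p" if "f \<in> smooth_functions M" for f
      by (rule pointlinear_cong_at[OF M p A(2)[OF that] T(1)[OF Z] Z T(2)[OF Z]])
    then have "\<omega> ((map A Zs)[i := A (T (Zs ! i))]) p = \<omega> ((map A Zs)[i := A (Zs ! i)]) p"
      by (intro pointlinear_cong_at[OF M p complex_form_pointlinear[OF \<omega> tup i]] A(1) T(1) Z)
    moreover have "(map A Zs)[i := A (Zs ! i)] = map A Zs"
      using Zs i list_update_id[of "map A Zs" i] by simp
    ultimately show "\<omega> (map A (Zs[i := T (Zs ! i)])) p = \<omega> (map A Zs) p"
      by (simp add: map_update)
  qed (use Xs T(1) in \<open>auto simp: vf_tuples_def\<close>)
  then show ?thesis by (simp add: o_def)
qed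

text \<open>One tuple \<open>Zs\<close> serves \<open>\<eta>\<close> and its composite with
  \<open>J\<close>, so that the ratio of the two is the same at \<open>p\<close> and
  \<open>q\<close>. Each field is lifted from \<open>N\<close> to \<open>G\<close>, lifted again
  along the translation taking \<open>y\<close> to \<open>x\<close>, replaced by a field that
  descends and has the same value at \<open>y\<close>, and projected.\<close>

lemma left_invariant_transport:
  fixes M :: "('g, 'e::euclidean_space) manifold" and N :: "('g set, 'e) manifold"
  assumes N: "hypercomplex_nilmanifold G M \<Gamma> N I J K" and \<eta>: "left_invariant_section G M \<Gamma> N k \<eta>"
    and p: "p \<in> topspace (mtop N)" and q: "q \<in> topspace (mtop N)" and Ys: "Ys \<in> vf_tuples N k"
  shows "\<exists>Zs\<in>vf_tuples N k. \<eta> Zs q = \<eta> Ys p \<and> \<eta> (map J Zs) q = \<eta> (map J Ys) p"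
proof -
  let ?\<pi> = "coset_proj G \<Gamma>"
  have nil: "nilmanifold G M \<Gamma> N" using N by (simp add: hypercomplex_nilmanifold_def)
  then have G: "lie_group G M" and sN: "smooth_manifold N" and topN: "topspace (mtop N) = rcosets\<^bsub>G\<^esub> \<Gamma>"
    and \<pi>: "local_diffeomorphism M N ?\<pi>"
    by (simp_all add: nilmanifold_def)
  then have sM: "smooth_manifold M" and topM: "topspace (mtop M) = carrier G" and gr: "group G"
    by (simp_all add: lie_group_def)
  interpret group G by (rule gr)
  obtain I' J' K' where HC: "hypercomplex M I' J' K'"
    and J'': "left_invariant_endo G M J'" "endo_related M N ?\<pi> J' J"
    using N unfolding hypercomplex_nilmanifold_def by blast
  have "endo_field M J'" using HC by (simp add: hypercomplex_def complex_structure_def)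
  note J' = this J''
  obtain \<omega> where \<omega>: "complex_form M k \<omega>" "left_invariant_form G M k \<omega>" "form_related M N ?\<pi> k \<omega> \<eta>"
    using \<eta> by (auto simp: left_invariant_section_def)
  obtain x where x: "x \<in> carrier G" "p = ?\<pi> x"
    using p unfolding topN RCOSETS_def coset_proj_def by blast
  obtain y where y: "y \<in> carrier G" "q = ?\<pi> y"
    using q unfolding topN RCOSETS_def coset_proj_def by blast
  \<comment> \<open>Translation by \<open>g\<close> takes the representative \<open>y\<close> of
    \<open>q\<close> to the representative \<open>x\<close> of \<open>p\<close>, so pullback along
    it moves values from \<open>x\<close> to \<open>y\<close>.\<close>
  define g where "g = x \<otimes>\<^bsub>G\<^esub> inv\<^bsub>G\<^esub> y"
  have g: "g \<in> carrier G" "g \<otimes>\<^bsub>G\<^esub> y = x" using x y by (simp_all add: g_def m_assoc)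
  let ?L = "\<lambda>x. g \<otimes>\<^bsub>G\<^esub> x"
  have L: "local_diffeomorphism M M ?L" by (rule left_translation_local_diffeomorphism[OF G g(1)])
  have yM: "y \<in> topspace (mtop M)" and xM: "x \<in> topspace (mtop M)" using x y topM by simp_all
  obtain lX where lX: "\<And>Y. Y \<in> vector_fields N \<Longrightarrow> vf_related M N ?\<pi> (lX Y) Y"
    using lift_vector_field[OF sM sN \<pi>] by metis
  obtain lW where lW: "\<And>X. X \<in> vector_fields M \<Longrightarrow> vf_related M M ?L (lW X) X"
    using lift_vector_field[OF sM sM L] by metis
  \<comment> \<open>A field \<open>W\<close> on \<open>G\<close>, such as a lift along the
    translation, need not be projectable; \<open>lZ W\<close> is, with projection
    \<open>Z W\<close>, and it has the value of \<open>W\<close> at \<open>y\<close>.\<close>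
  have "\<forall>W. \<exists>X Z. W \<in> vector_fields M \<longrightarrow>
      vf_related M N ?\<pi> X Z \<and> (\<forall>f\<in>smooth_functions M. X f y = W f y)"
    using push_forward_at[OF sM sN \<pi> _ yM] by metis
  then obtain lZ Z where lZ: "\<And>W. W \<in> vector_fields M \<Longrightarrow> vf_related M N ?\<pi> (lZ W) (Z W)"
    "\<And>W f. W \<in> vector_fields M \<Longrightarrow> f \<in> smooth_functions M \<Longrightarrow> lZ W f y = W f y"
    by metis
  have lXv: "lX Y \<in> vector_fields M" if "Y \<in> vector_fields N" for Y
    using lX[OF that] by (simp add: vf_related_def)
  have lWv: "lW X \<in> vector_fields M" if "X \<in> vector_fields M" for X
    using lW[OF that] by (simp add: vf_related_def)
  have lZv: "lZ X \<in> vector_fields M" "Z X \<in> vector_fields N" if "X \<in> vector_fields M" for X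
    using lZ(1)[OF that] by (simp_all add: vf_related_def)
  define Zs where "Zs = map (\<lambda>Y. Z (lW (lX Y))) Ys"
  have Zs: "Zs \<in> vf_tuples N k"
    unfolding Zs_def using lXv lWv lZv by (intro vf_tuples_map[OF Ys]) auto
  \<comment> \<open>Stated for any invariant tensor \<open>A\<close> on \<open>G\<close> lying over
    \<open>B\<close>, and used with the identity and with the lift of \<open>J\<close>.\<close>
  have transport: "\<eta> (map B Zs) q = \<eta> (map B Ys) p"
    if A: "endo_field M A" "left_invariant_endo G M A" "endo_related M N ?\<pi> A B"
    for A B
  proof -
    note Av = endo_field_vector_field[OF A(1)]
    have "\<eta> (map B Ys) p = \<omega> (map (\<lambda>Y. A (lX Y)) Ys) x"
    proof -
      have "list_all2 (vf_related M N ?\<pi>) (map (\<lambda>Y. A (lX Y)) Ys) (map B Ys)"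
        using A(3) lX Ys by (auto simp: list_all2_map1 list_all2_map2 list_all2_same endo_related_def vf_tuples_def)
      then have "\<omega> (map (\<lambda>Y. A (lX Y)) Ys) = pullback_fun M ?\<pi> (\<eta> (map B Ys))"
        using \<omega>(3) Ys by (simp add: form_related_def vf_tuples_def)
      then show ?thesis using xM x by (simp add: pullback_fun_def)
    qed
    also have "\<dots> = \<omega> (map (\<lambda>Y. A (lW (lX Y))) Ys) y"
    proof -
      have "endo_related M M ?L A A" "form_related M M ?L k \<omega> \<omega>"
        using A(2) \<omega>(2) g(1) by (simp_all add: left_invariant_endo_def left_invariant_form_def)
      moreover have "list_all2 (vf_related M M ?L) (map (\<lambda>Y. A (lW (lX Y))) Ys) (map (\<lambda>Y. A (lX Y)) Ys)"
        using calculation(1) lW lXv Ys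
        by (auto simp: list_all2_map1 list_all2_map2 list_all2_same endo_related_def vf_tuples_def)
      ultimately have "\<omega> (map (\<lambda>Y. A (lW (lX Y))) Ys) = pullback_fun M ?L (\<omega> (map (\<lambda>Y. A (lX Y)) Ys))"
        using Ys by (simp add: form_related_def vf_tuples_def)
      then show ?thesis using yM g(2) by (simp add: pullback_fun_def)
    qed
    also have "\<dots> = \<omega> (map (\<lambda>Y. A (lZ (lW (lX Y)))) Ys) y"
    proof -
      have "pointlinear M y (\<lambda>X. A X f y)" for f
        using A(1) by (simp add: pointlinear_def endo_field_def vf_add_def vf_scale_def)
      moreover have "map (\<lambda>Y. lW (lX Y)) Ys \<in> vf_tuples M k"
        using lXv lWv by (intro vf_tuples_map[OF Ys]) auto
      ultimately have "\<omega> (map (\<lambda>X. A (lZ X)) (map (\<lambda>Y. lW (lX Y)) Ys)) y = \<omega> (map A (map (\<lambda>Y. lW (lX Y)) Ys)) y"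
        by (intro complex_form_map_cong_at[OF sM yM \<omega>(1), where T = lZ and A = A] lZv(1) lZ(2) Av)
      then show ?thesis by (simp add: o_def)
    qed
    also have "\<dots> = \<eta> (map B Zs) q"
    proof -
      have "list_all2 (vf_related M N ?\<pi>) (map (\<lambda>Y. A (lZ (lW (lX Y)))) Ys) (map B Zs)"
        using A(3) lZ(1) lXv lWv Ys
        by (auto simp: Zs_def list_all2_map1 list_all2_map2 list_all2_same endo_related_def vf_tuples_def)
      then have "\<omega> (map (\<lambda>Y. A (lZ (lW (lX Y)))) Ys) = pullback_fun M ?\<pi> (\<eta> (map B Zs))"
        using \<omega>(3) Ys by (simp add: form_related_def vf_tuples_def)
      then show ?thesis using yM y by (simp add: pullback_fun_def)
    qed
    finally show ?thesis by simp
  qed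
  have "\<eta> (map (\<lambda>X. X) Zs) q = \<eta> (map (\<lambda>X. X) Ys) p"
    by (rule transport[where A = "\<lambda>X. X"]) (simp_all add: endo_field_def left_invariant_endo_def endo_related_def)
  then show ?thesis using transport[OF J'] Zs by auto
qed

section \<open>The (k,1)-part of a wedge product\<close>

lemma scale_slots:
  assumes len: "length js = k" and V: "\<And>j. j \<in> set js \<Longrightarrow> h j \<in> V \<and> X j \<in> V"
    and A: "\<And>Zs i j. length Zs = k \<Longrightarrow> set Zs \<subseteq> V \<Longrightarrow> i < k \<Longrightarrow> j \<in> set js \<Longrightarrow> A (Zs[i := h j]) = c j * A (Zs[i := X j])"
  shows "A (map h js) = prod_list (map c js) * (A (map X js) :: complex)"
proof -
  have "A (map h (take n js) @ map X (drop n js)) = prod_list (map c (take n js)) * A (map X js)" if "n \<le> k" for n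
    using that
  proof (induction n)
    case (Suc n)
    let ?Zs = "map h (take n js) @ map X (drop n js)"
    have "set ?Zs \<subseteq> V" using V by (auto dest: in_set_takeD in_set_dropD)
    then have "A (?Zs[n := h (js ! n)]) = c (js ! n) * A (?Zs[n := X (js ! n)])"
      using Suc.prems len by (intro A) auto
    moreover have "?Zs[n := h (js ! n)] = map h (take (Suc n) js) @ map X (drop (Suc n) js)"
      using Suc.prems len by (simp add: list_update_append take_Suc_conv_app_nth flip: Cons_nth_drop_Suc)
    moreover have "?Zs[n := X (js ! n)] = ?Zs"
      using Suc.prems len by (simp add: list_update_append flip: Cons_nth_drop_Suc)
    ultimately show ?case
      using Suc len by (simp add: take_Suc_conv_app_nth)
  qed simp
  from this[of k] len show ?thesis by simp
qed

text \<open>At \<open>p\<close>, \<open>\<Omega>\<close> is the wedge product of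
  \<open>\<theta>\<close> and \<open>\<eta>\<close>. Since \<open>\<eta>\<close> kills
  (0,1)-vectors, the single (0,1)-slot must feed \<open>\<theta>\<close>, and
  \<open>(\<theta> X + \<i> * \<theta> (I X)) / 2\<close> is the (0,1)-part of
  \<open>\<theta>\<close>.\<close>

lemma bidegree_part_wedge:
  assumes M: "smooth_manifold M" and I: "complex_structure M I" and \<eta>: "form_of_type M I k 0 \<eta>"
    and p: "p \<in> topspace (mtop M)"
    and \<theta>: "\<And>c X. X \<in> vector_fields M \<Longrightarrow> \<theta> (vf_scale (\<lambda>_. c) X) = complex_of_real c * \<theta> X"
    and \<Omega>: "\<And>Ws. Ws \<in> vf_tuples M (Suc k) \<Longrightarrow>
      \<Omega> Ws p = (\<Sum>l<Suc k. (- 1) ^ l * \<theta> (Ws ! l) * \<eta> (omit l Ws) p)"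
    and Xs: "Xs \<in> vf_tuples M (Suc k)"
  shows "bidegree_part I k \<Omega> Xs p =
    (\<Sum>l<Suc k. (- 1) ^ l * ((\<theta> (Xs ! l) + \<i> * \<theta> (I (Xs ! l))) / 2) * \<eta> (omit l Xs) p)"
proof -
  let ?m = "Suc k"
  have \<omega>: "complex_form M k \<eta>" using \<eta> by (simp add: form_of_type_def)
  have Iv: "I Y \<in> vector_fields M" if "Y \<in> vector_fields M" for Y
    using I that by (simp add: complex_structure_def endo_field_def)
  have len: "length Xs = ?m" using Xs by (simp add: vf_tuples_def)
  have Xv: "Xs ! j \<in> vector_fields M" if "j < ?m" for j by (rule vf_tuples_nth[OF Xs that])
  \<comment> \<open>Coefficient of \<open>I (Xs ! j)\<close>: negative in the (1,0)-slots, positive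
    in the (0,1)-slot.\<close>
  define \<epsilon> where "\<epsilon> S j = (if j \<in> S then - (1/2) else 1/2 :: real)" for S and j :: nat
  define w where "w S T j = (if j \<in> T then vf_scale (\<lambda>_. \<epsilon> S j) (I (Xs ! j)) else vf_scale (\<lambda>_. 1/2) (Xs ! j))"
    for S T j
  \<comment> \<open>Contribution of slot \<open>j\<close> to the term in which slot \<open>l\<close>
    goes into \<open>\<theta>\<close>: \<open>a\<close> for the imaginary part, with its factor
    \<open>\<i>\<close>, and \<open>b\<close> for the real part.\<close>
  define a where "a S l j = (if j = l then \<i> * (complex_of_real (\<epsilon> S j) * \<theta> (I (Xs ! j)))
    else \<i> * (complex_of_real (\<epsilon> S j) * \<i>))" for S l j
  define b where "b l j = (if j = l then \<theta> (Xs ! j) / 2 else 1/2)" for l j :: nat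
  have wv: "w S T j \<in> vector_fields M" if "j < ?m" for S T j
    using Xv[OF that] Iv vf_scale_const_vector_field[OF M] by (simp add: w_def)
  have summand: "\<i> ^ card T * (\<theta> (w S T l) * \<eta> (omit l (map (w S T) [0..<?m])) p) =
      (\<Prod>j<?m. if j \<in> T then a S l j else b l j) * \<eta> (omit l Xs) p"
    if T: "T \<subseteq> {..<?m}" and l: "l < ?m" for S T l
  proof -
    let ?js = "omit l [0..<?m]"
    define c where "c j = (if j \<in> T then complex_of_real (\<epsilon> S j) * \<i> else 1/2)" for j
    have js: "length ?js = k" "set ?js = {..<?m} - {l}" "distinct ?js"
      using l by (auto simp: length_omit omit_def simp del: upt_Suc)
    have om: "omit l (map f [0..<?m]) = map f ?js" for f :: "nat \<Rightarrow> 'a vfield"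
      by (simp add: omit_def take_map drop_map del: upt_Suc)
    have "\<eta> (map (w S T) ?js) p = prod_list (map c ?js) * \<eta> (map ((!) Xs) ?js) p"
    proof (rule scale_slots[where A = "\<lambda>Xs. \<eta> Xs p" and V = "vector_fields M", OF js(1)])
      show "w S T j \<in> vector_fields M \<and> Xs ! j \<in> vector_fields M" if "j \<in> set ?js" for j
        using that js(2) wv Xv by auto
      fix Zs :: "'a vfield list" and i j
      assume Zs: "length Zs = k" "set Zs \<subseteq> vector_fields M" and i: "i < k" and j: "j \<in> set ?js"
      then have t: "Zs \<in> vf_tuples M k" and X: "Xs ! j \<in> vector_fields M"
        using Xv js(2) by (auto simp: vf_tuples_def)
      note pl = pointlinear_scale_const[OF M complex_form_pointlinear[OF \<omega> t i] _ p]
      show "\<eta> (Zs[i := w S T j]) p = c j * \<eta> (Zs[i := Xs ! j]) p"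
        using pl[OF X] pl[OF Iv[OF X]] form_of_type_I_linear[OF M I \<eta> t i X p]
        by (simp add: w_def c_def scaleR_conv_of_real)
    qed
    moreover have "map ((!) Xs) ?js = omit l Xs"
      using om[of "(!) Xs"] len by (metis map_nth)
    moreover have "prod_list (map c ?js) = (\<Prod>j\<in>{..<?m} - {l}. c j)"
      using prod.distinct_set_conv_list[OF js(3), of c] js(2) by simp
    moreover have "\<i> ^ card T = (\<Prod>j<?m. if j \<in> T then \<i> else 1)"
      using T by (simp add: prod.If_cases Int_absorb1 del: lessThan_Suc prod.lessThan_Suc)
    moreover have "(\<Prod>j<?m. if j \<in> T then \<i> else 1) * (\<theta> (w S T l) * (\<Prod>j\<in>{..<?m} - {l}. c j)) =
        (\<Prod>j<?m. if j \<in> T then a S l j else b l j)"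
    proof -
      have "(if l \<in> T then \<i> else 1) * \<theta> (w S T l) = (if l \<in> T then a S l l else b l l)"
        using \<theta> Xv[OF l] Iv by (simp add: w_def a_def b_def)
      moreover have "(if j \<in> T then \<i> else 1) * c j = (if j \<in> T then a S l j else b l j)" if "j \<noteq> l" for j
        using that by (simp add: a_def b_def c_def)
      then have "(\<Prod>j\<in>{..<?m} - {l}. (if j \<in> T then \<i> else 1) * c j) =
          (\<Prod>j\<in>{..<?m} - {l}. if j \<in> T then a S l j else b l j)"
        by (intro prod.cong) auto
      ultimately show ?thesis
        using l prod.remove[of "{..<?m}" l "\<lambda>j. if j \<in> T then \<i> else 1"]
          prod.remove[of "{..<?m}" l "\<lambda>j. if j \<in> T then a S l j else b l j"]
        by (simp add: prod.distrib mult_ac del: lessThan_Suc)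
    qed
    ultimately show ?thesis unfolding om by (simp add: mult_ac del: lessThan_Suc upt_Suc)
  qed
  \<comment> \<open>Expanding the product of the sums of \<open>a\<close> and \<open>b\<close> gives
    one term for each \<open>T\<close>.\<close>
  have prods: "(\<Sum>T\<in>Pow {..<?m}. \<Prod>j<?m. if j \<in> T then a S l j else b l j) = (\<Prod>j<?m. a S l j + b l j)" for S l
  proof -
    have "(\<Prod>j<?m. if j \<in> T then a S l j else b l j) = (\<Prod>j\<in>T. a S l j) * (\<Prod>j\<in>{..<?m} - T. b l j)"
      if "T \<in> Pow {..<?m}" for T
      using that by (simp add: prod.If_cases Int_absorb1 Diff_eq del: lessThan_Suc prod.lessThan_Suc)
    then show ?thesis by (simp add: prod_add del: lessThan_Suc prod.lessThan_Suc)
  qed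
  have cext: "form_cext \<Omega> (map (vf_scale (\<lambda>_. 1/2)) Xs)
        (map (\<lambda>j. vf_scale (\<lambda>_. if j \<in> S then - (1/2) else 1/2) (I (Xs ! j))) [0..<length Xs]) p =
      (\<Sum>l<?m. (- 1) ^ l * (\<Prod>j<?m. a S l j + b l j) * \<eta> (omit l Xs) p)" for S
  proof -
    have W: "map (\<lambda>j. if j \<in> T then map (\<lambda>j. vf_scale (\<lambda>_. if j \<in> S then - (1/2) else 1/2) (I (Xs ! j))) [0..<?m] ! j
        else map (vf_scale (\<lambda>_. 1/2)) Xs ! j) [0..<?m] = map (w S T) [0..<?m]" for T
      using len by (auto simp: w_def \<epsilon>_def simp del: upt_Suc)
    have \<Omega>W: "\<i> ^ card T * \<Omega> (map (w S T) [0..<?m]) p =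
        (\<Sum>l<?m. (- 1) ^ l * ((\<Prod>j<?m. if j \<in> T then a S l j else b l j) * \<eta> (omit l Xs) p))"
      if "T \<in> Pow {..<?m}" for T
    proof -
      have "map (w S T) [0..<?m] \<in> vf_tuples M ?m" using wv by (auto simp: vf_tuples_def simp del: upt_Suc)
      from \<Omega>[OF this]
      have "\<i> ^ card T * \<Omega> (map (w S T) [0..<?m]) p =
          (\<Sum>l<?m. (- 1) ^ l * (\<i> ^ card T * (\<theta> (map (w S T) [0..<?m] ! l) * \<eta> (omit l (map (w S T) [0..<?m])) p)))"
        by (simp add: sum_distrib_left mult_ac del: upt_Suc sum.lessThan_Suc)
      also have "\<dots> = (\<Sum>l<?m. (- 1) ^ l * ((\<Prod>j<?m. if j \<in> T then a S l j else b l j) * \<eta> (omit l Xs) p))"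
      proof (intro sum.cong refl)
        fix l assume "l \<in> {..<?m}"
        then have l: "l < ?m" and nth: "map (w S T) [0..<?m] ! l = w S T l" by (simp_all del: upt_Suc)
        have "T \<subseteq> {..<?m}" using that by simp
        then show "(- 1) ^ l * (\<i> ^ card T * (\<theta> (map (w S T) [0..<?m] ! l) * \<eta> (omit l (map (w S T) [0..<?m])) p)) =
            (- 1) ^ l * ((\<Prod>j<?m. if j \<in> T then a S l j else b l j) * \<eta> (omit l Xs) p)"
          by (simp only: nth summand[OF _ l])
      qed
      finally show ?thesis .
    qed
    have "(\<Sum>T\<in>Pow {..<?m}. \<i> ^ card T * \<Omega> (map (w S T) [0..<?m]) p) =
        (\<Sum>l<?m. \<Sum>T\<in>Pow {..<?m}. (- 1) ^ l * ((\<Prod>j<?m. if j \<in> T then a S l j else b l j) * \<eta> (omit l Xs) p))"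
      by (subst sum.swap) (intro sum.cong refl \<Omega>W)
    also have "\<dots> = (\<Sum>l<?m. (- 1) ^ l * (\<Prod>j<?m. a S l j + b l j) * \<eta> (omit l Xs) p)"
      unfolding prods[symmetric]
      by (intro sum.cong refl) (simp add: sum_distrib_left sum_distrib_right mult_ac)
    finally show ?thesis
      unfolding form_cext_def length_map len W .
  qed
  \<comment> \<open>For \<open>j \<noteq> l\<close> the factor is
    \<open>1/2 - \<epsilon> S j\<close>, i.e. 1 for \<open>j \<in> S\<close> and 0 otherwise. As
    \<open>S\<close> has \<open>k\<close> elements, only \<open>S = {..<?m} - {l}\<close>
    survives.\<close>
  have prod_val: "(\<Prod>j<?m. a S l j + b l j) =
      (if S = {..<?m} - {l} then (\<theta> (Xs ! l) + \<i> * \<theta> (I (Xs ! l))) / 2 else 0)"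
    if S: "S \<subseteq> {..<?m}" "card S = k" and l: "l < ?m" for S l
  proof (cases "S = {..<?m} - {l}")
    case True
    have "(\<Prod>j<?m. a S l j + b l j) = (a S l l + b l l) * (\<Prod>j\<in>{..<?m} - {l}. a S l j + b l j)"
      using l by (intro prod.remove) auto
    also have "(\<Prod>j\<in>{..<?m} - {l}. a S l j + b l j) = (\<Prod>j\<in>{..<?m} - {l}. 1)"
      by (intro prod.cong refl) (auto simp: True a_def b_def \<epsilon>_def)
    finally show ?thesis using True by (simp add: a_def b_def \<epsilon>_def field_simps)
  next
    case False
    have "\<exists>j. j < ?m \<and> j \<noteq> l \<and> j \<notin> S"
    proof (rule ccontr)
      assume "\<not> ?thesis"
      then have sub: "{..<?m} - {l} \<subseteq> S" by blast
      have "finite S" using S(1) finite_subset by blast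
      moreover have "card ({..<?m} - {l}) = card S" using S l by simp
      ultimately show False using card_subset_eq[OF _ sub] False by simp
    qed
    then obtain j where "j < ?m" "a S l j + b l j = 0" by (auto simp: a_def b_def \<epsilon>_def)
    then have "(\<Prod>j<?m. a S l j + b l j) = 0" by (intro prod_zero) auto
    then show ?thesis using False by simp
  qed
  let ?\<S> = "{S. S \<subseteq> {..<?m} \<and> card S = k}"
  have fin: "finite ?\<S>" by simp
  have "bidegree_part I k \<Omega> Xs p =
      (\<Sum>S\<in>?\<S>. \<Sum>l<?m. (- 1) ^ l * (\<Prod>j<?m. a S l j + b l j) * \<eta> (omit l Xs) p)"
    unfolding bidegree_part_def cext unfolding len ..
  also have "\<dots> = (\<Sum>S\<in>?\<S>. \<Sum>l<?m. if S = {..<?m} - {l} then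
      (- 1) ^ l * ((\<theta> (Xs ! l) + \<i> * \<theta> (I (Xs ! l))) / 2) * \<eta> (omit l Xs) p else 0)"
  proof (intro sum.cong refl)
    fix S l assume "S \<in> ?\<S>" "l \<in> {..<?m}"
    then have pv: "(\<Prod>j<?m. a S l j + b l j) =
        (if S = {..<?m} - {l} then (\<theta> (Xs ! l) + \<i> * \<theta> (I (Xs ! l))) / 2 else 0)"
      by (intro prod_val) auto
    show "(- 1) ^ l * (\<Prod>j<?m. a S l j + b l j) * \<eta> (omit l Xs) p = (if S = {..<?m} - {l} then
        (- 1) ^ l * ((\<theta> (Xs ! l) + \<i> * \<theta> (I (Xs ! l))) / 2) * \<eta> (omit l Xs) p else 0)"
      unfolding pv by simp
  qed
  also have "\<dots> = (\<Sum>l<?m. \<Sum>S\<in>?\<S>. if S = {..<?m} - {l} then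
      (- 1) ^ l * ((\<theta> (Xs ! l) + \<i> * \<theta> (I (Xs ! l))) / 2) * \<eta> (omit l Xs) p else 0)"
    by (rule sum.swap)
  also have "\<dots> = (\<Sum>l<?m. (- 1) ^ l * ((\<theta> (Xs ! l) + \<i> * \<theta> (I (Xs ! l))) / 2) * \<eta> (omit l Xs) p)"
    using fin by (intro sum.cong refl) (auto simp: sum.delta)
  finally show ?thesis .
qed

text \<open>Tensoriality holds because the derivative of the scalar coming from
  \<open>vf_complex\<close> cancels the one coming from \<open>D X (vf_scale h Y)\<close>;
  compatibility with \<open>I\<close> comes from the parallelism of \<open>I\<close>.\<close>

lemma cov_deriv_type_form_at:
  assumes M: "smooth_manifold M" and I: "complex_structure M I" and \<eta>: "form_of_type M I k 0 \<eta>"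
    and D: "affine_connection M D" "parallel_endo M D I"
    and X: "X \<in> vector_fields M" and p: "p \<in> topspace (mtop M)"
  shows "type_form_at M I k p (\<lambda>Ys. form_cov_deriv D X \<eta> Ys p)"
proof -
  have \<omega>: "complex_form M k \<eta>" using \<eta> by (simp add: form_of_type_def)
  have Iv: "I Y \<in> vector_fields M" if "Y \<in> vector_fields M" for Y
    using I that by (simp add: complex_structure_def endo_field_def)
  have Dv: "D X Y \<in> vector_fields M" if "Y \<in> vector_fields M" for Y
    using D(1) X that by (simp add: affine_connection_def)
  \<comment> \<open>The correction terms in which \<open>D X\<close> hits a slot other than
    \<open>i\<close>.\<close>
  define R where "R Zs i Y = (\<Sum>l\<in>{..<k} - {i}. \<eta> ((Zs[l := D X (Zs ! l)])[i := Y]) p)" for Zs i Y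
  have cov: "form_cov_deriv D X \<eta> (Zs[i := Y]) p =
      vf_complex X (\<eta> (Zs[i := Y])) p - (\<eta> (Zs[i := D X Y]) p + R Zs i Y)"
    if Zs: "Zs \<in> vf_tuples M k" and i: "i < k" for Zs i Y
  proof -
    have len: "length Zs = k" using Zs by (simp add: vf_tuples_def)
    have "(\<Sum>l<k. \<eta> ((Zs[i := Y])[l := D X (Zs[i := Y] ! l)]) p) =
        \<eta> ((Zs[i := Y])[i := D X (Zs[i := Y] ! i)]) p +
        (\<Sum>l\<in>{..<k} - {i}. \<eta> ((Zs[i := Y])[l := D X (Zs[i := Y] ! l)]) p)"
      using i by (intro sum.remove) auto
    also have "(\<Sum>l\<in>{..<k} - {i}. \<eta> ((Zs[i := Y])[l := D X (Zs[i := Y] ! l)]) p) = R Zs i Y"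
      unfolding R_def by (intro sum.cong refl) (auto simp: list_update_swap)
    finally show ?thesis using len i by (simp add: form_cov_deriv_def)
  qed
  have upd: "Zs[l := D X (Zs ! l)] \<in> vf_tuples M k" if "Zs \<in> vf_tuples M k" "l < k" for Zs l
    using vf_tuples_update[OF that(1) Dv[OF vf_tuples_nth[OF that]]] .
  have add: "form_cov_deriv D X \<eta> (Zs[i := vf_add Y Y']) p =
      form_cov_deriv D X \<eta> (Zs[i := Y]) p + form_cov_deriv D X \<eta> (Zs[i := Y']) p"
    if Zs: "Zs \<in> vf_tuples M k" and i: "i < k" and Y: "Y \<in> vector_fields M" "Y' \<in> vector_fields M" for Zs i Y Y'
  proof -
    have "vf_complex X (\<eta> (Zs[i := vf_add Y Y'])) p = vf_complex X (\<eta> (Zs[i := Y])) p + vf_complex X (\<eta> (Zs[i := Y'])) p"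
      unfolding complex_form_add[OF \<omega> Zs i Y]
      by (rule vf_complex_add[OF M X complex_form_smooth[OF \<omega> vf_tuples_update[OF Zs Y(1)]]
        complex_form_smooth[OF \<omega> vf_tuples_update[OF Zs Y(2)]]])
    moreover have "D X (vf_add Y Y') = vf_add (D X Y) (D X Y')"
      using D(1) X Y by (simp add: affine_connection_def)
    moreover have "R Zs i (vf_add Y Y') = R Zs i Y + R Zs i Y'"
      unfolding R_def sum.distrib[symmetric]
      by (intro sum.cong refl) (simp add: complex_form_add[OF \<omega> upd[OF Zs] i Y])
    ultimately show ?thesis
      unfolding cov[OF Zs i] using complex_form_add[OF \<omega> Zs i Dv[OF Y(1)] Dv[OF Y(2)]] by simp
  qed
  have scale: "form_cov_deriv D X \<eta> (Zs[i := vf_scale h Y]) p = h p *\<^sub>R form_cov_deriv D X \<eta> (Zs[i := Y]) p"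
    if Zs: "Zs \<in> vf_tuples M k" and i: "i < k" and Y: "Y \<in> vector_fields M" and h: "h \<in> smooth_functions M" for Zs i Y h
  proof -
    have Xh: "X h \<in> smooth_functions M" by (rule vector_field_smooth[OF X h])
    have "vf_complex X (\<eta> (Zs[i := vf_scale h Y])) p =
        complex_of_real (X h p) * \<eta> (Zs[i := Y]) p + complex_of_real (h p) * vf_complex X (\<eta> (Zs[i := Y])) p"
      unfolding complex_form_scale[OF \<omega> Zs i Y h]
      by (rule vf_complex_of_real_mult[OF M X complex_form_smooth[OF \<omega> vf_tuples_update[OF Zs Y]] h])
    moreover have "D X (vf_scale h Y) = vf_add (vf_scale (X h) Y) (vf_scale h (D X Y))"
      using D(1) X Y h by (simp add: affine_connection_def)
    moreover have "R Zs i (vf_scale h Y) = complex_of_real (h p) * R Zs i Y"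
      unfolding R_def sum_distrib_left
      by (intro sum.cong refl) (simp add: complex_form_scale[OF \<omega> upd[OF Zs] i Y h])
    ultimately show ?thesis
      unfolding cov[OF Zs i]
      using complex_form_add[OF \<omega> Zs i vf_scale_vector_field[OF M Xh Y] vf_scale_vector_field[OF M h Dv[OF Y]]]
        complex_form_scale[OF \<omega> Zs i Y Xh] complex_form_scale[OF \<omega> Zs i Dv[OF Y] h]
      by (simp add: scaleR_conv_of_real algebra_simps)
  qed
  have I_lin: "form_cov_deriv D X \<eta> (Zs[i := I Y]) p = \<i> * form_cov_deriv D X \<eta> (Zs[i := Y]) p"
    if Zs: "Zs \<in> vf_tuples M k" and i: "i < k" and Y: "Y \<in> vector_fields M" for Zs i Y
  proof -
    have fI: "\<eta> (Zs[i := I Y]) = (\<lambda>x. \<i> * \<eta> (Zs[i := Y]) x)"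
    proof
      fix x show "\<eta> (Zs[i := I Y]) x = \<i> * \<eta> (Zs[i := Y]) x"
      proof (cases "x \<in> topspace (mtop M)")
        case True
        then show ?thesis by (rule form_of_type_I_linear[OF M I \<eta> Zs i Y])
      next
        case False
        then show ?thesis
          using smooth_functions_off[OF complex_form_smooth[OF \<omega> vf_tuples_update[OF Zs Y]]]
            smooth_functions_off[OF complex_form_smooth[OF \<omega> vf_tuples_update[OF Zs Iv[OF Y]]]] by simp
      qed
    qed
    have "vf_complex X (\<eta> (Zs[i := I Y])) p = \<i> * vf_complex X (\<eta> (Zs[i := Y])) p"
      unfolding fI by (rule vf_complex_cmult[OF M X complex_form_smooth[OF \<omega> vf_tuples_update[OF Zs Y]]])
    moreover have "D X (I Y) = I (D X Y)" using D(2) X Y by (simp add: parallel_endo_def)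
    moreover have "R Zs i (I Y) = \<i> * R Zs i Y"
      unfolding R_def sum_distrib_left
      by (intro sum.cong refl) (simp add: form_of_type_I_linear[OF M I \<eta> upd[OF Zs] i Y p])
    ultimately show ?thesis
      unfolding cov[OF Zs i] using form_of_type_I_linear[OF M I \<eta> Zs i Dv[OF Y] p]
      by (simp add: algebra_simps)
  qed
  have alt: "form_cov_deriv D X \<eta> Ys p = 0"
    if Ys: "length Ys = k" "set Ys \<subseteq> vector_fields M" and ij: "i < j" "j < k" "Ys ! i = Ys ! j" for Ys i j
  proof -
    have t: "Ys \<in> vf_tuples M k" using Ys by (simp add: vf_tuples_def)
    note sa = complex_form_slot_alternating[OF M \<omega>]
    have ijk: "i < k" "i \<noteq> j" using ij by auto
    let ?Z = "D X (Ys ! i)"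
    let ?f = "\<lambda>l. \<eta> (Ys[l := D X (Ys ! l)]) p"
    have "\<eta> Ys = (\<lambda>x. 0)"
      using slot_alternating_repeat[OF sa Ys ijk(1) ij(2) ijk(2) ij(3)] by auto
    then have "vf_complex X (\<eta> Ys) p = 0"
      using vf_complex_cmult[OF M X complex_form_smooth[OF \<omega> t], of 0 p] by simp
    moreover have "(\<Sum>l<k. ?f l) = 0"
    proof -
      \<comment> \<open>Differentiating a slot other than \<open>i\<close> and \<open>j\<close>
        leaves the repeated entry in place; the two remaining terms differ by a swap and
        cancel.\<close>
      have "(\<Sum>l<k. ?f l) = (\<Sum>l\<in>{i, j}. ?f l)"
      proof (rule sum.mono_neutral_right)
        show "\<forall>l\<in>{..<k} - {i, j}. ?f l = 0"
        proof
          fix l assume l: "l \<in> {..<k} - {i, j}"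
          have "set (Ys[l := D X (Ys ! l)]) \<subseteq> vector_fields M"
            using upd[OF t, of l] l by (simp add: vf_tuples_def)
          then show "?f l = 0"
            using Ys ij ijk l by (intro slot_alternating_repeat[OF sa, where i = i and j = j]) auto
        qed
      qed (use ij in auto)
      also have "\<dots> = \<eta> (Ys[i := ?Z]) p + \<eta> (Ys[j := ?Z]) p" using ijk ij by simp
      also have "\<eta> (Ys[j := ?Z]) p = - \<eta> (Ys[i := ?Z]) p"
      proof -
        have "set (Ys[i := ?Z]) \<subseteq> vector_fields M"
          using upd[OF t, of i] ijk by (simp add: vf_tuples_def)
        from slot_alternating_swap[OF sa[of p] _ this ijk(1) ij(2) ijk(2)] Ys
        have "\<eta> ((Ys[i := ?Z])[i := (Ys[i := ?Z]) ! j, j := (Ys[i := ?Z]) ! i]) p = - \<eta> (Ys[i := ?Z]) p"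
          by simp
        moreover have "(Ys[i := ?Z])[i := (Ys[i := ?Z]) ! j, j := (Ys[i := ?Z]) ! i] = Ys[j := ?Z]"
          using Ys ij ijk by (auto simp: list_eq_iff_nth_eq nth_list_update)
        ultimately show ?thesis by simp
      qed
      finally show ?thesis by simp
    qed
    ultimately show ?thesis using Ys by (simp add: form_cov_deriv_def)
  qed
  show ?thesis
    unfolding type_form_at_def slot_alternating_def pointlinear_def
    using add scale I_lin vf_add_vector_field[OF M] by (simp add: vf_tuples_def) (intro allI impI, elim conjE exE, rule alt)
qed


text \<open>\<open>J I = - I J\<close> makes the twist by \<open>J\<close> antilinear for
  \<open>I\<close>, and conjugation makes it linear again.\<close>

lemma conj_type_form_at:
  assumes N: "hypercomplex N I J K" and \<eta>: "form_of_type N I k 0 \<eta>" and p: "p \<in> topspace (mtop N)"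
  shows "type_form_at N I k p (\<lambda>Ys. cnj (\<eta> (map J Ys) p))"
proof -
  have M: "smooth_manifold N" and I: "complex_structure N I" and J: "endo_field N J"
    using N by (simp_all add: hypercomplex_def complex_structure_def)
  have \<omega>: "complex_form N k \<eta>" using \<eta> by (simp add: form_of_type_def)
  note Jv = endo_field_vector_field[OF J]
  have Iv: "I Y \<in> vector_fields N" if "Y \<in> vector_fields N" for Y
    using I that by (simp add: complex_structure_def endo_field_def)
  have tup: "map J Zs \<in> vf_tuples N k" if "Zs \<in> vf_tuples N k" for Zs
    by (rule vf_tuples_map[OF that Jv])
  have JI: "J (I Y) = vf_scale (\<lambda>_. - 1) (I (J Y))" if Y: "Y \<in> vector_fields N" for Y
  proof -
    have "I (J Y) = vf_scale (\<lambda>_. - 1) (J (I Y))" using N Y by (simp add: hypercomplex_def)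
    then show ?thesis by (simp add: vf_scale_def)
  qed
  have I_lin: "cnj (\<eta> (map J (Zs[i := I Y])) p) = \<i> * cnj (\<eta> (map J (Zs[i := Y])) p)"
    if Zs: "Zs \<in> vf_tuples N k" and i: "i < k" and Y: "Y \<in> vector_fields N" for Zs i Y
    using pointlinear_scale_const[OF M complex_form_pointlinear[OF \<omega> tup[OF Zs] i] Iv[OF Jv[OF Y]] p, of "- 1"]
      form_of_type_I_linear[OF M I \<eta> tup[OF Zs] i Jv[OF Y] p]
    by (simp add: map_update JI[OF Y])
  have J_add: "J (vf_add X Y) = vf_add (J X) (J Y)" if "X \<in> vector_fields N" "Y \<in> vector_fields N" for X Y
    using J that by (simp add: endo_field_def)
  have J_scale: "J (vf_scale h Y) = vf_scale h (J Y)" if "h \<in> smooth_functions N" "Y \<in> vector_fields N" for h Y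
    using J that by (simp add: endo_field_def)
  have add: "cnj (\<eta> (map J (Zs[i := vf_add X Y])) p) = cnj (\<eta> (map J (Zs[i := X])) p) + cnj (\<eta> (map J (Zs[i := Y])) p)"
    if "Zs \<in> vf_tuples N k" "i < k" "X \<in> vector_fields N" "Y \<in> vector_fields N" for Zs i X Y
    using complex_form_add[OF \<omega> tup[OF that(1)] that(2) Jv Jv] that by (simp add: map_update J_add)
  have scale: "cnj (\<eta> (map J (Zs[i := vf_scale h Y])) p) = h p *\<^sub>R cnj (\<eta> (map J (Zs[i := Y])) p)"
    if "Zs \<in> vf_tuples N k" "i < k" "Y \<in> vector_fields N" "h \<in> smooth_functions N" for Zs i Y h
    using complex_form_scale[OF \<omega> tup[OF that(1)] that(2) Jv that(4)] that
    by (simp add: map_update J_scale scaleR_conv_of_real)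
  have alt: "\<eta> (map J Ys) p = 0"
    if "length Ys = k" "set Ys \<subseteq> vector_fields N" "i < j" "j < k" "Ys ! i = Ys ! j" for Ys i j
    by (rule slot_alternating_repeat[OF complex_form_slot_alternating[OF M \<omega>], where i = i and j = j])
      (use that tup[of Ys] in \<open>auto simp: vf_tuples_def\<close>)
  show ?thesis
    unfolding type_form_at_def slot_alternating_def pointlinear_def
    using add scale I_lin vf_add_vector_field[OF M]
    by (simp add: vf_tuples_def) (intro allI impI, elim conjE exE, rule alt)
qed

lemma form_of_type_type_form_at:
  assumes M: "smooth_manifold M" and I: "complex_structure M I" and \<eta>: "form_of_type M I k 0 \<eta>"
    and p: "p \<in> topspace (mtop M)"
  shows "type_form_at M I k p (\<lambda>Ys. \<eta> Ys p)"
proof -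
  have \<omega>: "complex_form M k \<eta>" using \<eta> by (simp add: form_of_type_def)
  show ?thesis
    unfolding type_form_at_def
    using complex_form_slot_alternating[OF M \<omega>] complex_form_pointlinear[OF \<omega>]
      form_of_type_I_linear[OF M I \<eta> _ _ _ p] by blast
qed

section \<open>Reality and vanishing of the connection form\<close>

theorem theorem3p2:
  fixes G :: "'g monoid"
    and M :: "('g, 'e::euclidean_space) manifold"
    and \<Gamma> :: "'g set"
    and N :: "('g set, 'e) manifold"
    and I J K :: "'g set vfield \<Rightarrow> 'g set vfield"
    and D :: "'g set vfield \<Rightarrow> 'g set vfield \<Rightarrow> 'g set vfield"
    and n :: nat
    and \<eta> :: "'g set cform"
  assumes "hypercomplex_nilmanifold G M \<Gamma> N I J K"
    and "DIM('e) = 4 * n"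
    and "obata_connection N I J K D"
    and "holomorphic_form N I (2 * n) \<eta>"
    and "left_invariant_section G M \<Gamma> N (2 * n) \<eta>"
  shows "parallel_form N D (2 * n) \<eta>"
proof -
  define k where "k = 2 * n"
  let ?T = "topspace (mtop N)" and ?V = "vector_fields N"
  have dim: "DIM('e) = 2 * k" using assms(2) by (simp add: k_def)
  have HC: "hypercomplex N I J K" using assms(1) by (simp add: hypercomplex_nilmanifold_def)
  then have sN: "smooth_manifold N" and I: "complex_structure N I" and J: "complex_structure N J"
    by (simp_all add: hypercomplex_def)
  have IE: "endo_field N I" and JE: "endo_field N J" using I J by (simp_all add: complex_structure_def)
  note Iv = endo_field_vector_field[OF IE] and Jv = endo_field_vector_field[OF JE]
  have D: "affine_connection N D" "torsion_free N D" "parallel_endo N D I" "parallel_endo N D J"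
    using assms(3) by (simp_all add: obata_connection_def)
  have Dv: "D X Y \<in> ?V" if "X \<in> ?V" "Y \<in> ?V" for X Y
    using D(1) that by (simp add: affine_connection_def)
  have type: "form_of_type N I k 0 \<eta>"
    and holo: "\<And>Xs. Xs \<in> vf_tuples N (Suc k) \<Longrightarrow> dolbeault I k \<eta> Xs = (\<lambda>x. 0)"
    using assms(4) by (simp_all add: holomorphic_form_def k_def)
  have \<omega>: "complex_form N k \<eta>" using type by (simp add: form_of_type_def)
  have Jtup: "map J Ys \<in> vf_tuples N k" if "Ys \<in> vf_tuples N k" for Ys
    by (rule vf_tuples_map[OF that Jv])
  have upd: "Ys[i := D X (Ys ! i)] \<in> vf_tuples N k" if "Ys \<in> vf_tuples N k" "i < k" "X \<in> ?V" for Ys i X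
    using vf_tuples_update[OF that(1) Dv[OF that(3) vf_tuples_nth[OF that(1,2)]]] .
  have transport: "\<exists>Zs\<in>vf_tuples N k. \<eta> Zs q = \<eta> Ys p \<and> \<eta> (map J Zs) q = \<eta> (map J Ys) p"
    if "p \<in> ?T" "q \<in> ?T" "Ys \<in> vf_tuples N k" for p q Ys
    using left_invariant_transport[OF assms(1) _ that] assms(5) by (simp add: k_def)
  have off: "\<eta> Ys x = 0" if "Ys \<in> vf_tuples N k" "x \<notin> ?T" for Ys x
    by (rule smooth_functions_off[OF complex_form_smooth[OF \<omega> that(1)] that(2)])
  \<comment> \<open>Serves the points where \<open>\<eta>\<close> vanishes and the points of the
    ambient type outside \<open>N\<close>.\<close>
  have cov_zero: "form_cov_deriv D X \<eta> Ys x = 0"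
    if Ys: "Ys \<in> vf_tuples N k" and X: "X \<in> ?V" and z: "vf_complex X (\<eta> Ys) x = 0"
      "\<And>Zs. Zs \<in> vf_tuples N k \<Longrightarrow> \<eta> Zs x = 0" for X Ys x
    using z upd[OF Ys _ X] Ys by (simp add: form_cov_deriv_def vf_tuples_def)
  have main: "form_cov_deriv D X \<eta> Ys p = 0"
    if X: "X \<in> ?V" and Ys: "Ys \<in> vf_tuples N k" and p: "p \<in> ?T" for X Ys p
  proof (cases "\<exists>Bs\<in>vf_tuples N k. \<eta> Bs p \<noteq> 0")
    case False
    \<comment> \<open>Vanishing at \<open>p\<close> alone would not control the derivative of
      \<open>\<eta> Ys\<close>; transport spreads it to all points.\<close>
    have "\<eta> Zs q = 0" if "Zs \<in> vf_tuples N k" for Zs q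
      using transport[OF _ p that, of q] off[OF that, of q] False by (cases "q \<in> ?T") auto
    then have "\<eta> Ys = (\<lambda>x. 0 * \<eta> Ys x)" using Ys by auto
    then have "vf_complex X (\<eta> Ys) p = 0 * vf_complex X (\<eta> Ys) p"
      using vf_complex_cmult[OF sN X complex_form_smooth[OF \<omega> Ys], of 0 p] by simp
    then show ?thesis using cov_zero[OF Ys X] False by auto
  next
    case True
    then obtain Bs where Bs: "Bs \<in> vf_tuples N k" "\<eta> Bs p \<noteq> 0" by blast
    have lenB: "length Bs = k" using Bs by (simp add: vf_tuples_def)
    note proportional = type_form_at_proportional[OF sN dim _ IE]
    \<comment> \<open>The ratio at the point \<open>p\<close>; it is the ratio at every
      \<open>q\<close>, because the transported tuple \<open>Cs\<close> reproduces both
      values.\<close>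
    define u where "u = cnj (\<eta> (map J Bs) p) / \<eta> Bs p"
    have u: "cnj (\<eta> (map J Zs) q) = u * \<eta> Zs q" if Zs: "Zs \<in> vf_tuples N k" and q: "q \<in> ?T" for Zs q
    proof -
      obtain Cs where Cs: "Cs \<in> vf_tuples N k" "\<eta> Cs q = \<eta> Bs p" "\<eta> (map J Cs) q = \<eta> (map J Bs) p"
        using transport[OF p q Bs(1)] by blast
      have "cnj (\<eta> (map J Zs) q) * \<eta> Cs q = cnj (\<eta> (map J Cs) q) * \<eta> Zs q"
        by (rule proportional[OF q conj_type_form_at[OF HC type q] form_of_type_type_form_at[OF sN I type q] Cs(1) _ Zs])
          (simp add: Cs Bs)
      then show ?thesis using Bs(2) by (simp add: u_def Cs field_simps)
    qed
    \<comment> \<open>The quotient on the single tuple \<open>Bs\<close>; proportionality of forms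
      of type \<open>(k,0)\<close> extends it to all tuples at \<open>p\<close>.\<close>
    define \<theta> where "\<theta> X = form_cov_deriv D X \<eta> Bs p / \<eta> Bs p" for X
    have cov: "form_cov_deriv D X \<eta> Zs p = \<theta> X * \<eta> Zs p" if X: "X \<in> ?V" and Zs: "Zs \<in> vf_tuples N k" for X Zs
    proof -
      have "form_cov_deriv D X \<eta> Zs p * \<eta> Bs p = form_cov_deriv D X \<eta> Bs p * \<eta> Zs p"
        by (rule proportional[OF p cov_deriv_type_form_at[OF sN I type D(1,3) X p]
          form_of_type_type_form_at[OF sN I type p] Bs Zs])
      then show ?thesis using Bs(2) by (simp add: \<theta>_def field_simps)
    qed
    have cov_J: "form_cov_deriv D X \<eta> (map J Zs) p = cnj (u * form_cov_deriv D X \<eta> Zs p)"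
      if X: "X \<in> ?V" and Zs: "Zs \<in> vf_tuples N k" for X Zs
    proof -
      have len: "length Zs = k" using Zs by (simp add: vf_tuples_def)
      \<comment> \<open>An identity of functions, including points off \<open>N\<close>, because it
        is differentiated along \<open>X\<close>; the constant \<open>u\<close> then passes through
        the derivative.\<close>
      have eq: "\<eta> (map J Zs) = (\<lambda>x. cnj (u * \<eta> Zs x))"
      proof
        fix x show "\<eta> (map J Zs) x = cnj (u * \<eta> Zs x)"
        proof (cases "x \<in> ?T")
          case True
          then show ?thesis using u[OF Zs] by (metis complex_cnj_cnj)
        qed (simp add: off[OF Zs] off[OF Jtup[OF Zs]])
      qed
      have sm: "(\<lambda>x. u * \<eta> Zs x) \<in> smooth_functions N"
        by (rule smooth_functions_linear[OF sN bounded_linear_mult_right complex_form_smooth[OF \<omega> Zs]])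
      have "vf_complex X (\<eta> (map J Zs)) p = cnj (u * vf_complex X (\<eta> Zs) p)"
        by (simp only: eq vf_complex_cnj[OF sN X sm] vf_complex_cmult[OF sN X complex_form_smooth[OF \<omega> Zs]])
      moreover have "\<eta> ((map J Zs)[i := D X (map J Zs ! i)]) p = cnj (u * \<eta> (Zs[i := D X (Zs ! i)]) p)"
        if i: "i < k" for i
      proof -
        have "D X (J (Zs ! i)) = J (D X (Zs ! i))"
          using D(4) X vf_tuples_nth[OF Zs i] by (simp add: parallel_endo_def)
        then have "(map J Zs)[i := D X (map J Zs ! i)] = map J (Zs[i := D X (Zs ! i)])"
          using len i by (simp add: map_update)
        then show ?thesis using u[OF upd[OF Zs i X] p] by (metis complex_cnj_cnj)
      qed
      ultimately show ?thesis
        using len by (simp add: form_cov_deriv_def sum_distrib_left right_diff_distrib)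
    qed
    have \<theta>_real: "cnj (\<theta> X) = \<theta> X" if X: "X \<in> ?V" for X
    proof -
      \<comment> \<open>The two sides are compared on \<open>J Bs\<close>, since applying
        \<open>J\<close> once more gives \<open>- Bs\<close> in every slot, where
        \<open>\<eta>\<close> is nonzero at \<open>p\<close>.\<close>
      let ?Cs = "map J Bs"
      have JJ: "map J ?Cs = map (vf_scale (\<lambda>_. - 1)) Bs"
        using J Bs(1) by (auto simp: complex_structure_def vf_tuples_def)
      have "\<eta> (map (vf_scale (\<lambda>_. - 1)) Bs) p = prod_list (map (\<lambda>_. - 1) Bs) * \<eta> (map (\<lambda>X. X) Bs) p"
      proof (rule scale_slots[OF lenB, where V = ?V])
        show "vf_scale (\<lambda>_. - 1) Y \<in> ?V \<and> Y \<in> ?V" if "Y \<in> set Bs" for Y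
          using that Bs(1) vf_scale_const_vector_field[OF sN] by (auto simp: vf_tuples_def)
        show "\<eta> (Zs[i := vf_scale (\<lambda>_. - 1) Y]) p = - 1 * \<eta> (Zs[i := Y]) p"
          if "length Zs = k" "set Zs \<subseteq> ?V" "i < k" "Y \<in> set Bs" for Zs i Y
          using pointlinear_scale_const[OF sN complex_form_pointlinear[OF \<omega> _ that(3)] _ p, of Zs Y "- 1"] that Bs(1)
          by (auto simp: vf_tuples_def)
      qed
      then have nz: "\<eta> (map J ?Cs) p \<noteq> 0" unfolding JJ using Bs(2) by (auto simp: prod_list_zero_iff)
      have "\<theta> X * \<eta> (map J ?Cs) p = cnj (u * (\<theta> X * \<eta> ?Cs p))"
        using cov_J[OF X Jtup[OF Bs(1)]] cov[OF X Jtup[OF Bs(1)]] cov[OF X Jtup[OF Jtup[OF Bs(1)]]] by simp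
      also have "\<dots> = cnj (\<theta> X) * cnj (u * \<eta> ?Cs p)" by simp
      also have "\<dots> = cnj (\<theta> X) * \<eta> (map J ?Cs) p"
        using u[OF Jtup[OF Bs(1)] p] by (metis complex_cnj_cnj)
      finally show ?thesis using nz by simp
    qed
    have \<theta>_scale: "\<theta> (vf_scale (\<lambda>_. c) X) = complex_of_real c * \<theta> X" if X: "X \<in> ?V" for c X
    proof -
      have "\<eta> (Bs[i := D (vf_scale (\<lambda>_. c) X) (Bs ! i)]) p = complex_of_real c * \<eta> (Bs[i := D X (Bs ! i)]) p"
        if i: "i < k" for i
      proof -
        have Y: "Bs ! i \<in> ?V" by (rule vf_tuples_nth[OF Bs(1) i])
        have "D (vf_scale (\<lambda>_. c) X) (Bs ! i) = vf_scale (\<lambda>x. if x \<in> ?T then c else 0) (D X (Bs ! i))"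
          using D(1) X Y smooth_functions_const[OF sN, of c]
          by (simp add: vf_scale_const_eq[OF X] affine_connection_def)
        then show ?thesis
          using complex_form_scale[OF \<omega> Bs(1) i Dv[OF X Y] smooth_functions_const[OF sN, of c]] p by simp
      qed
      then show ?thesis
        using lenB by (simp add: \<theta>_def form_cov_deriv_def vf_complex_scale sum_distrib_left algebra_simps diff_divide_distrib)
    qed
    \<comment> \<open>Twice the (0,1)-part of \<open>\<theta>\<close>.\<close>
    define \<tau> where "\<tau> X = \<theta> X + \<i> * \<theta> (I X)" for X
    have wedge: "(\<Sum>l<Suc k. (- 1) ^ l * (\<tau> (Xs ! l) / 2) * \<eta> (omit l Xs) p) = 0"
      if Xs: "Xs \<in> vf_tuples N (Suc k)" for Xs
    proof -
      have ext: "ext_deriv \<eta> Ws p = (\<Sum>l<Suc k. (- 1) ^ l * \<theta> (Ws ! l) * \<eta> (omit l Ws) p)"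
        if Ws: "Ws \<in> vf_tuples N (Suc k)" for Ws
        unfolding ext_deriv_torsion_free[OF sN \<omega> D(1,2) Ws p]
      proof (intro sum.cong refl)
        fix l assume "l \<in> {..<Suc k}"
        then have l: "l < Suc k" by simp
        have "omit l Ws \<in> vf_tuples N k"
          using Ws l set_omit[of l Ws] by (auto simp: vf_tuples_def length_omit)
        then show "(- 1) ^ l * form_cov_deriv D (Ws ! l) \<eta> (omit l Ws) p = (- 1) ^ l * \<theta> (Ws ! l) * \<eta> (omit l Ws) p"
          using cov[OF vf_tuples_nth[OF Ws l]] by simp
      qed
      have "bidegree_part I k (ext_deriv \<eta>) Xs p =
          (\<Sum>l<Suc k. (- 1) ^ l * ((\<theta> (Xs ! l) + \<i> * \<theta> (I (Xs ! l))) / 2) * \<eta> (omit l Xs) p)"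
        by (rule bidegree_part_wedge[OF sN I type p _ _ Xs]) (fact \<theta>_scale, fact ext)
      then show ?thesis using holo[OF Xs] by (simp add: dolbeault_def \<tau>_def del: sum.lessThan_Suc)
    qed
    \<comment> \<open>The \<open>(k,1)\<close>-part of \<open>d\<eta>\<close> evaluated on \<open>I X, B\<^sub>1, \<dots>, B\<^sub>k\<close>.\<close>
    have test: "\<tau> (I X) * \<eta> Bs p = \<i> * (\<Sum>j<k. \<tau> (Bs ! j) * \<eta> (Bs[j := X]) p)" if X: "X \<in> ?V" for X
    proof -
      have t: "I X # Bs \<in> vf_tuples N (Suc k)" using Iv[OF X] Bs(1) by (simp add: vf_tuples_def)
      let ?F = "\<lambda>l. (- 1) ^ l * (\<tau> ((I X # Bs) ! l) / 2) * \<eta> (omit l (I X # Bs)) p"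
      \<comment> \<open>Moving \<open>I X\<close> from the front into slot \<open>j\<close> costs
        \<open>(- 1) ^ j\<close>, so of the sign \<open>(- 1) ^ Suc j\<close> only a minus
        remains.\<close>
      have step: "(- 1) ^ Suc j * (\<tau> ((I X # Bs) ! Suc j) / 2) * \<eta> (omit (Suc j) (I X # Bs)) p =
          - (\<tau> (Bs ! j) * (\<i> * \<eta> (Bs[j := X]) p)) / 2" if j: "j < k" for j
      proof -
        have "\<eta> (Bs[j := I X]) p = (- 1) ^ j * \<eta> (I X # omit j Bs) p"
          by (rule slot_alternating_to_front[OF complex_form_slot_alternating[OF sN \<omega>]])
            (use Bs(1) j Iv[OF X] in \<open>auto simp: vf_tuples_def\<close>)
        then have "(- 1) ^ j * \<eta> (I X # omit j Bs) p = \<i> * \<eta> (Bs[j := X]) p"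
          using form_of_type_I_linear[OF sN I type Bs(1) j X p] by simp
        moreover have "omit (Suc j) (I X # Bs) = I X # omit j Bs" by (simp add: omit_def)
        ultimately show ?thesis by (simp add: mult_ac)
      qed
      have "0 = ?F 0 + (\<Sum>j<k. ?F (Suc j))"
        using wedge[OF t] by (simp only: sum.lessThan_Suc_shift)
      also have "(\<Sum>j<k. ?F (Suc j)) = (\<Sum>j<k. - (\<tau> (Bs ! j) * (\<i> * \<eta> (Bs[j := X]) p)) / 2)"
        by (rule sum.cong[OF refl]) (rule step, simp)
      also have "?F 0 = (\<tau> (I X) / 2) * \<eta> Bs p" by (simp add: omit_def)
      finally have "(\<tau> (I X) / 2) * \<eta> Bs p + (\<Sum>j<k. - (\<tau> (Bs ! j) * (\<i> * \<eta> (Bs[j := X]) p)) / 2) = 0"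
        by (rule sym)
      then have "\<tau> (I X) * \<eta> Bs p - (\<Sum>j<k. \<tau> (Bs ! j) * (\<i> * \<eta> (Bs[j := X]) p)) = 0"
        by (simp add: sum_negf sum_divide_distrib[symmetric] diff_divide_distrib[symmetric])
      then show ?thesis by (simp add: sum_distrib_left mult_ac)
    qed
    have \<tau>_I: "\<tau> (I X) = - \<i> * \<tau> X" if X: "X \<in> ?V" for X
    proof -
      have "I (I X) = vf_scale (\<lambda>_. - 1) X" using I X by (simp add: complex_structure_def)
      then show ?thesis using \<theta>_scale[OF X, of "- 1"] by (simp add: \<tau>_def algebra_simps)
    qed
    \<comment> \<open>For \<open>X = Bs ! m\<close> every term with \<open>j \<noteq> m\<close> has
      a repeated entry, so \<open>test\<close> reads \<open>\<tau> (I X) = \<i> * \<tau> X\<close>;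
      this contradicts \<open>\<tau>_I\<close> unless \<open>\<tau> X = 0\<close>.\<close>
    have \<tau>_B: "\<tau> (Bs ! m) = 0" if m: "m < k" for m
    proof -
      have "\<tau> (Bs ! j) * \<eta> (Bs[j := Bs ! m]) p = (if j = m then \<tau> (Bs ! m) * \<eta> Bs p else 0)" if j: "j < k" for j
      proof (cases "j = m")
        case False
        have "\<eta> (Bs[j := Bs ! m]) p = 0"
          by (rule slot_alternating_repeat[OF complex_form_slot_alternating[OF sN \<omega>], where i = j and j = m])
            (use False j m lenB vf_tuples_update[OF Bs(1) vf_tuples_nth[OF Bs(1) m]] in \<open>auto simp: vf_tuples_def\<close>)
        then show ?thesis using False by simp
      qed simp
      then have "(\<Sum>j<k. \<tau> (Bs ! j) * \<eta> (Bs[j := Bs ! m]) p) = \<tau> (Bs ! m) * \<eta> Bs p"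
        using m by (simp add: sum.delta)
      with test[OF vf_tuples_nth[OF Bs(1) m]] \<tau>_I[OF vf_tuples_nth[OF Bs(1) m]] Bs(2)
      show ?thesis by simp
    qed
    \<comment> \<open>By \<open>\<tau>_B\<close> the right side of \<open>test\<close> vanishes for
      every field, not only for those in \<open>Bs\<close>.\<close>
    have "\<tau> X = 0"
    proof -
      have "\<tau> (I X) * \<eta> Bs p = 0" using test[OF X] \<tau>_B by simp
      then show ?thesis using \<tau>_I[OF X] Bs(2) by simp
    qed
    moreover have "Im (\<theta> X) = 0" "Im (\<theta> (I X)) = 0"
      using \<theta>_real[OF X] \<theta>_real[OF Iv[OF X]] by (simp_all add: complex_eq_iff)
    \<comment> \<open>Both values of \<open>\<theta>\<close> being real, the real part of
      \<open>\<tau> X\<close> is \<open>\<theta> X\<close>.\<close>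
    ultimately have "\<theta> X = 0" by (simp add: \<tau>_def complex_eq_iff)
    then show ?thesis using cov[OF X Ys] by simp
  qed
  have "form_cov_deriv D X \<eta> Ys = (\<lambda>x. 0)" if X: "X \<in> ?V" and Ys: "Ys \<in> vf_tuples N k" for X Ys
  proof
    fix x show "form_cov_deriv D X \<eta> Ys x = 0"
    proof (cases "x \<in> ?T")
      case False
      then have "vf_complex X (\<eta> Ys) x = 0"
        by (simp add: vf_complex_def vector_field_off[OF X] complex_eq_iff)
      then show ?thesis using cov_zero[OF Ys X] off False by blast
    qed (rule main[OF X Ys])
  qed
  then show ?thesis by (simp add: parallel_form_def k_def)
qed

end
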